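(* For every integer $r\ge1$ there is a constant $C_r$ such that for every prime $q$, every non-principal multiplicative Dirichlet character $\chi$ modulo $q$, every integer $N$ and every integer $H\ge1$, $$\Big|\sum_{m\in(N,N+H]}\chi(m)\Big|\le C_r\,H^{1-\frac1r}\,q^{\frac{r+1}{4r^2}}\,(\log q)^2,$$ where the sum is over integers $m$ with $N<m\le N+H$. *)

theory Defs
  imports Complex_Main "HOL-Computational_Algebra.Primes"
begin

text \<open>
  A multiplicative Dirichlet character modulo \<open>q\<close>: a homomorphism from the unit group of
  \<open>\<int>/q\<int>\<close> to the nonzero complex numbers, lifted to a \<open>q\<close>-periodic function on the integers and
  extended by zero to the integers not coprime to \<open>q\<close>.
\<close>

definition dirichlet_character :: "nat \<Rightarrow> (int \<Rightarrow> complex) \<Rightarrow> bool" where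
  "dirichlet_character q \<chi> \<longleftrightarrow>
     (\<forall>m. \<chi> (m + int q) = \<chi> m) \<and>
     (\<forall>m n. \<chi> (m * n) = \<chi> m * \<chi> n) \<and>
     (\<forall>m. \<chi> m \<noteq> 0 \<longleftrightarrow> coprime m (int q))"

definition principal_character :: "nat \<Rightarrow> int \<Rightarrow> complex" where
  "principal_character q m = (if coprime m (int q) then 1 else 0)"

end

theory Submission
  imports Defs "HOL-Analysis.Analysis" "HOL-Algebra.Algebraic_Closure_Type"
    "Berlekamp_Zassenhaus.Finite_Field"
begin

text \<open>
  Burgess' method.  Shifting the interval by products \<open>a b\<close> replaces the sum by an average of
  \<open>\<Sum>x. \<nu> x * \<bar>\<Sum>b\<le>B. \<chi> (x + b)\<bar>\<close>, where \<open>\<nu>\<close> counts representations of \<open>x\<close> as a quotient modulo \<open>q\<close>; the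
  shift itself costs two shorter sums of the same kind, which induction on \<open>H\<close> absorbs.
  Hoelder's inequality separates the second moment of \<open>\<nu>\<close>, which is counted by hand, from the
  \<open>2r\<close>-th moment of the short sums.  Expanding the latter gives complete sums of \<open>\<chi>\<close> at
  products of linear factors.  If some factor occurs exactly once, Weil's bound gives square
  root cancellation, and the remaining tuples are few.  Very long intervals and \<open>r = 1\<close> are
  covered by the Polya-Vinogradov inequality.

  Weil's bound for \<open>f = \<Prod>a\<in>A. (a - X) ^ e a\<close> is proved as follows.  Let \<open>c n\<close> be the sum of
  \<open>\<chi> (\<Prod>a\<in>A. g a ^ e a)\<close> over the monic \<open>g\<close> of degree \<open>n\<close> over the prime field.  The values of \<open>g\<close> at
  the points of \<open>A\<close> are equidistributed once \<open>n \<ge> card A\<close>, so that \<open>c n = 0\<close>.  Newton's identities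
  relate \<open>c\<close> to the sums \<open>S n\<close> of \<open>\<chi>\<close> at the norms of \<open>f x\<close>, for \<open>x\<close> in the field with \<open>q ^ n\<close>
  elements.  Stepanov's method bounds \<open>S n\<close> by a multiple of \<open>sqrt q ^ n\<close>, uniformly in \<open>n\<close>, and this
  forces the roots of the polynomial \<open>\<Sum>n. c n * z ^ n\<close> out of the disc of radius \<open>1 / sqrt q\<close>.
\<close>

hide_const (open) Divisibility.prime Divisibility.irreducible Coset.order
  Polynomials.degree Polynomials.lead_coeff up_ring.coeff up_ring.monom module.smult
no_notation vec_lambda (binder "\<chi>" 10)

text \<open>Stepanov's method alone is too weak for the moment estimate: it bounds the number of
  points from one side only, its constant depends on \<open>q\<close> and on the degree of
  \<open>f\<close>, and it starts at large \<open>n\<close>. The L-function repairs this. Any bound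
  by a multiple of \<open>sqrt q ^ n\<close> for large \<open>n\<close> makes the generating series
  of \<open>S\<close> converge in the disc of radius \<open>1 / sqrt q\<close>, and that alone
  decides where the zeros lie. The first sum is minus the sum of the inverse zeros, of which there
  are at most \<open>card A\<close>, so the final constant forgets where the convergence came from.
  The factor of exponent one is used twice: \<open>f\<close> has a simple zero there, which keeps
  the auxiliary polynomial from vanishing identically, and the value of a random monic polynomial at
  that point enters \<open>c n\<close> to the first power, so that the sum over it cancels. In
  Burgess' argument the shifts \<open>a * b\<close> are squeezed from two sides. They must be a
  small fraction of \<open>H\<close> for the induction to absorb the boundary sums, but not much
  smaller, or the average is too short; and \<open>A * H \<le> q\<close> is needed to turn
  congruences into equations. The two outer ranges of \<open>H\<close> are split off to make both
  possible.\<close>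

lemma homogeneous_system_nontrivial:
  fixes A :: "'e \<Rightarrow> 'i \<Rightarrow> 'a::field"
  assumes "finite E" "finite I" "card E < card I"
  shows "\<exists>v. (\<exists>i\<in>I. v i \<noteq> 0) \<and> (\<forall>e\<in>E. (\<Sum>i\<in>I. A e i * v i) = 0)"
  using assms
proof (induction E arbitrary: I A rule: finite_induct)
  case empty
  then obtain i where "i \<in> I" by fastforce
  then show ?case by (intro exI[of _ "\<lambda>_. 1"]) auto
next
  case (insert e E)
  show ?case
  proof (cases "\<forall>i\<in>I. A e i = 0")
    case True
    have "card E < card I" using insert by simp
    then obtain v where "\<exists>i\<in>I. v i \<noteq> 0" "\<forall>e\<in>E. (\<Sum>i\<in>I. A e i * v i) = 0"
      using insert.IH[of I A] insert.prems by auto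
    with True show ?thesis by (intro exI[of _ v]) auto
  next
    case False
    then obtain i0 where i0: "i0 \<in> I" "A e i0 \<noteq> 0" by auto
    \<comment> \<open>One step of Gaussian elimination: equation \<open>e\<close> removes the
      unknown \<open>i0\<close> from the others, and back substitution in \<open>e\<close> gives
      \<open>w i0\<close>.\<close>
    define B where "B = (\<lambda>f i. A f i - A f i0 * A e i / A e i0)"
    have "card E < card (I - {i0})" using insert i0 by simp
    then obtain v where v: "\<exists>i\<in>I-{i0}. v i \<noteq> 0" "\<forall>f\<in>E. (\<Sum>i\<in>I-{i0}. B f i * v i) = 0"
      using insert.IH[of "I - {i0}" B] insert.prems by auto
    define u where "u = (\<Sum>i\<in>I-{i0}. A e i * v i)"
    define w where "w = v(i0 := - u / A e i0)"
    have split: "(\<Sum>i\<in>I. A f i * w i) = - A f i0 * u / A e i0 + (\<Sum>i\<in>I-{i0}. A f i * v i)" for f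
      using insert.prems i0 by (subst sum.remove[of _ i0]) (auto simp: w_def intro!: sum.cong)
    have "(\<Sum>i\<in>I. A f i * w i) = 0" if "f \<in> E" for f
    proof -
      have "0 = (\<Sum>i\<in>I-{i0}. A f i * v i) - A f i0 / A e i0 * u"
        using v(2) that by (simp add: B_def u_def sum_subtractf sum_distrib_left algebra_simps)
      then show ?thesis unfolding split by simp
    qed
    moreover have "(\<Sum>i\<in>I. A e i * w i) = 0"
      unfolding split using i0 by (simp add: u_def)
    moreover have "\<exists>i\<in>I. w i \<noteq> 0" using v(1) by (auto simp: w_def)
    ultimately show ?thesis by (intro exI[of _ w]) auto
  qed
qed

section \<open>Taylor expansion of polynomials\<close>

text \<open>\<open>taylor p\<close> is \<open>p (X + Y)\<close> as a polynomial in \<open>Y\<close>, so its coefficients are the Hasse derivatives of \<open>p\<close>.\<close>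
definition taylor :: "'a::comm_ring_1 poly \<Rightarrow> 'a poly poly" where
  "taylor p = pcompose (map_poly (\<lambda>c. [:c:]) p) [:[:0, 1:], 1:]"

lemma map_poly_pCons_zero:
  assumes "f 0 = 0"
  shows "map_poly f (pCons c p) = pCons (f c) (map_poly f p)"
  using assms by (intro poly_eqI) (simp add: coeff_map_poly coeff_pCons split: nat.split)

lemma map_poly_const_poly:
  "map_poly (\<lambda>c::'a::comm_ring_1. [:c:]) (p + q) = map_poly (\<lambda>c. [:c:]) p + map_poly (\<lambda>c. [:c:]) q"
  "map_poly (\<lambda>c::'a::comm_ring_1. [:c:]) (p * q) = map_poly (\<lambda>c. [:c:]) p * map_poly (\<lambda>c. [:c:]) q"
proof -
  show "map_poly (\<lambda>c::'a::comm_ring_1. [:c:]) (p + q) = map_poly (\<lambda>c. [:c:]) p + map_poly (\<lambda>c. [:c:]) q" for p q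
    by (intro poly_eqI) (simp add: coeff_map_poly)
  have "[:sum f A:] = (\<Sum>x\<in>A. [:f x:])" for f :: "nat \<Rightarrow> 'a" and A
    by (intro poly_eqI) (simp add: coeff_sum coeff_pCons split: nat.split)
  then show "map_poly (\<lambda>c::'a::comm_ring_1. [:c:]) (p * q) = map_poly (\<lambda>c. [:c:]) p * map_poly (\<lambda>c. [:c:]) q"
    by (intro poly_eqI) (simp add: coeff_map_poly coeff_mult mult.commute)
qed

lemma taylor_add: "taylor (p + q) = taylor p + taylor q"
  and taylor_mult: "taylor (p * q) = taylor p * taylor q"
  by (simp_all add: taylor_def map_poly_const_poly pcompose_add pcompose_mult)

lemma taylor_0 [simp]: "taylor 0 = 0"
  and taylor_1 [simp]: "taylor 1 = 1"
  by (simp_all add: taylor_def pcompose_1 map_poly_1 one_pCons)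

lemma taylor_power: "taylor (p ^ n) = taylor p ^ n"
  by (induction n) (simp_all add: taylor_mult)

lemma taylor_const: "taylor [:c:] = [:[:c:]:]"
  by (simp add: taylor_def map_poly_pCons_zero)

lemma taylor_pCons: "taylor (pCons c p) = [:[:c:]:] + [:[:0, 1:], 1:] * taylor p"
  by (simp add: taylor_def map_poly_pCons_zero pcompose_pCons)

lemma taylor_smult: "taylor (smult c p) = smult [:c:] (taylor p)"
  using taylor_mult[of "[:c:]" p] by (simp add: taylor_const)

lemma taylor_sum: "taylor (\<Sum>x\<in>A. f x) = (\<Sum>x\<in>A. taylor (f x))"
  by (induction A rule: infinite_finite_induct) (simp_all add: taylor_add)

lemma taylor_linear: "taylor [:a, 1:] = [:[:a, 1:], 1:]"
  by (simp add: taylor_pCons taylor_const)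

text \<open>In \<open>X\<close> and \<open>Y\<close> together, \<open>p (X + Y)\<close> has total
  degree \<open>degree p\<close>. Zero coefficients are excluded because they have degree 0 by
  convention while their index \<open>l\<close> is unbounded.\<close>

lemma degree_coeff_taylor: "coeff (taylor p) l \<noteq> 0 \<Longrightarrow> degree (coeff (taylor p) l) + l \<le> degree p"
proof (induction p arbitrary: l)
  case 0
  then show ?case by simp
next
  case (pCons c p)
  show ?case
  proof (cases "p = 0")
    case True
    then show ?thesis using pCons by (cases l) (auto simp: taylor_const)
  next
    case False
    have *: "coeff (taylor (pCons c p)) l
      = (if l = 0 then [:c:] else coeff (taylor p) (l - 1)) + [:0, 1:] * coeff (taylor p) l"
      by (cases l) (auto simp: taylor_pCons)
    show ?thesis
    proof (cases "l > degree p + 1")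
      case True
      then have "coeff (taylor p) (l - 1) = 0" "coeff (taylor p) l = 0"
        using pCons.IH[of l] pCons.IH[of "l - 1"] by fastforce+
      then show ?thesis using pCons.prems True by (simp add: *)
    next
      case l: False
      have "degree ([:0, 1:] * coeff (taylor p) l) \<le> degree p + 1 - l"
        using pCons.IH[of l] by (cases "coeff (taylor p) l = 0") auto
      moreover have "degree (if l = 0 then [:c:] else coeff (taylor p) (l - 1)) \<le> degree p + 1 - l"
        using pCons.IH[of "l - 1"] by (cases "coeff (taylor p) (l - 1) = 0") auto
      ultimately have "degree (coeff (taylor (pCons c p)) l) \<le> degree p + 1 - l"
        unfolding * by (intro degree_add_le)
      then show ?thesis using l False by simp
    qed
  qed
qed

lemma map_poly_eval_taylor: "map_poly (\<lambda>c. poly c x) (taylor p) = pcompose p [:x, 1:]"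
proof (induction p)
  case 0
  then show ?case by simp
next
  case (pCons c p)
  have hom: "map_poly (\<lambda>c. poly c x) (u + v) = map_poly (\<lambda>c. poly c x) u + map_poly (\<lambda>c. poly c x) v"
     "map_poly (\<lambda>c. poly c x) (u * v) = map_poly (\<lambda>c. poly c x) u * map_poly (\<lambda>c. poly c x) v" for u v :: "'a poly poly"
    by (intro poly_eqI; simp add: coeff_map_poly coeff_mult poly_sum)+
  have "map_poly (\<lambda>c. poly c x) [:[:0, 1:], 1:] = [:x, 1:]" "map_poly (\<lambda>c. poly c x) [:[:c:]:] = [:c:]"
    by (simp_all add: map_poly_pCons_zero)
  then show ?case
    unfolding taylor_pCons[of c p] hom pcompose_pCons pCons.IH by simp
qed

text \<open>In positive characteristic ordinary derivatives lose multiplicities, as factorials may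
  vanish; Hasse derivatives do not. Their values at \<open>x\<close> are the coefficients of
  \<open>p (x + X)\<close>, so \<open>X ^ M\<close> divides that polynomial, and translating back
  moves the zero to \<open>x\<close>.\<close>

lemma pow_dvd_if_taylor_vanishes:
  fixes p :: "'a::idom poly"
  assumes "\<And>l. l < M \<Longrightarrow> poly (coeff (taylor p) l) x = 0"
  shows "[:-x, 1:] ^ M dvd p"
proof -
  define P where "P = pcompose p [:x, 1:]"
  have "coeff P l = 0" if "l < M" for l
    using assms[OF that] by (simp add: P_def coeff_map_poly flip: map_poly_eval_taylor)
  then have "monom 1 M dvd P"
    by (simp add: monom_1_dvd_iff')
  then obtain q where q: "P = monom 1 M * q" by blast
  have "p = pcompose P [:-x, 1:]"
    by (simp add: P_def pcompose_pCons flip: pcompose_assoc)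
  also have "\<dots> = [:-x, 1:] ^ M * pcompose q [:-x, 1:]"
    unfolding q pcompose_mult monom_altdef by (simp add: pcompose_pCons pcompose_hom.hom_power)
  finally show ?thesis by simp
qed

lemma coeff_taylor_mult:
  "coeff (taylor (p * q)) l = (\<Sum>i\<le>l. coeff (taylor p) i * coeff (taylor q) (l - i))"
  by (simp add: taylor_mult coeff_mult)

lemma coeff_taylor_0 [simp]: "coeff (taylor p) 0 = p"
proof (induction p)
  case (pCons c p)
  then show ?case by (simp add: taylor_pCons)
qed simp

text \<open>By the product rule each order of differentiation costs at most one factor
  \<open>f\<close>. In the induction either the split-off \<open>f\<close> is left alone and
  survives, or it absorbs at least one order.\<close>

lemma power_dvd_coeff_taylor: "f ^ (N - l) dvd coeff (taylor (f ^ N)) l"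
proof (induction N arbitrary: l)
  case 0
  then show ?case by simp
next
  case (Suc N)
  have "f ^ (Suc N - l) dvd coeff (taylor f) i * coeff (taylor (f ^ N)) (l - i)" if "i \<le> l" for i
  proof (cases i)
    case 0
    have "f ^ (Suc N - l) dvd f * f ^ (N - l)"
      unfolding power_Suc[symmetric] by (intro le_imp_power_dvd) simp
    also have "\<dots> dvd f * coeff (taylor (f ^ N)) l"
      by (intro mult_dvd_mono dvd_refl Suc.IH)
    finally show ?thesis using 0 by simp
  next
    case (Suc i')
    have "f ^ (Suc N - l) dvd f ^ (N - (l - i))"
      using Suc that by (intro le_imp_power_dvd) auto
    also have "\<dots> dvd coeff (taylor (f ^ N)) (l - i)" by (rule Suc.IH)
    finally show ?thesis by (rule dvd_mult)
  qed
  then show ?case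
    unfolding power_Suc coeff_taylor_mult by (intro dvd_sum) auto
qed

lemma power_dvd_coeff_taylor_mult: "f ^ (N - l) dvd coeff (taylor (g * f ^ N)) l"
  unfolding coeff_taylor_mult
  by (intro dvd_sum dvd_mult dvd_trans[OF le_imp_power_dvd power_dvd_coeff_taylor]) simp

text \<open>Because \<open>(a + X + Y) ^ Q = (a + X) ^ Q + Y ^ Q\<close> in characteristic \<open>p\<close>.\<close>
lemma coeff_taylor_frobenius_power:
  fixes a :: "'a::comm_ring_1"
  assumes "prime CHAR('a)" "Q = CHAR('a) ^ n" "0 < u" "u < Q"
  shows "coeff (taylor ([:a, 1:] ^ (Q * i))) u = 0"
proof -
  have ch: "CHAR('a poly poly) = CHAR('a)" by simp
  have "[:[:a, 1:], 1:] = [:[:a, 1:]:] + monom 1 1" by (simp add: monom_altdef)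
  then have "taylor ([:a, 1:] ^ Q) = ([:[:a, 1:]:] + monom 1 1) ^ Q"
    by (simp add: taylor_power taylor_linear)
  also have "\<dots> = [:[:a, 1:]:] ^ Q + monom 1 1 ^ Q"
    using assms ch by (intro freshmans_dream'[where n = n]) auto
  also have "\<dots> = [:[:a, 1:] ^ Q:] + monom 1 Q"
    by (simp add: monom_power poly_const_pow)
  finally have 1: "taylor ([:a, 1:] ^ Q) = [:[:a, 1:] ^ Q:] + monom 1 Q" .
  have "\<exists>r. taylor ([:a, 1:] ^ (Q * i)) = [:[:a, 1:] ^ (Q * i):] + monom 1 Q * r"
  proof (induction i)
    case 0
    then show ?case by (auto intro: exI[of _ 0])
  next
    case (Suc i)
    then obtain r where r: "taylor ([:a, 1:] ^ (Q * i)) = [:[:a, 1:] ^ (Q * i):] + monom 1 Q * r" by auto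
    have "taylor ([:a, 1:] ^ (Q * Suc i)) = ([:[:a, 1:] ^ Q:] + monom 1 Q) * ([:[:a, 1:] ^ (Q * i):] + monom 1 Q * r)"
      by (simp add: power_add taylor_mult 1 r)
    also have "\<dots> = [:[:a, 1:] ^ (Q * Suc i):] +
       monom 1 Q * ([:[:a, 1:] ^ Q:] * r + ([:[:a, 1:] ^ (Q * i):] + monom 1 Q * r))"
      by (simp add: algebra_simps power_add)
    finally show ?case by blast
  qed
  then obtain r where "taylor ([:a, 1:] ^ (Q * i)) = [:[:a, 1:] ^ (Q * i):] + monom 1 Q * r" by auto
  then show ?thesis using assms by (simp add: coeff_monom_mult coeff_pCons split: nat.split)
qed

section \<open>Stepanov's method\<close>

text \<open>Take the least index with \<open>k w \<noteq> 0\<close>. A nonzero polynomial of degree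
  below \<open>D\<close> vanishes at \<open>a\<close> to order below \<open>D\<close>, so this
  summand has order below \<open>e w + D\<close>, whereas all later ones are divisible by
  \<open>[:-a, 1:] ^ (e w + D)\<close> and cannot cancel it.\<close>

lemma linear_combination_separated_orders:
  fixes k u :: "nat \<Rightarrow> 'a::field poly"
  assumes deg: "\<And>w. w < W \<Longrightarrow> k w = 0 \<or> degree (k w) < D"
    and u: "\<And>w. w < W \<Longrightarrow> poly (u w) a \<noteq> 0"
    and e: "\<And>w w'. w < w' \<Longrightarrow> w' < W \<Longrightarrow> e w + D \<le> e w'"
    and zero: "(\<Sum>w<W. k w * u w * [:-a, 1:] ^ e w) = 0"
    and w: "w < W"
  shows "k w = 0"
proof (rule ccontr)
  assume "k w \<noteq> 0"
  define w0 where "w0 = (LEAST w. w < W \<and> k w \<noteq> 0)"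
  have w0: "w0 < W" "k w0 \<noteq> 0"
    using LeastI[of "\<lambda>w. w < W \<and> k w \<noteq> 0" w] w \<open>k w \<noteq> 0\<close> by (auto simp: w0_def)
  have below: "k v = 0" if "v < w0" for v
    using not_less_Least[of v "\<lambda>w. w < W \<and> k w \<noteq> 0"] that w0 by (auto simp: w0_def)
  let ?L = "[:-a, 1:]"
  have "(\<Sum>w<W. k w * u w * ?L ^ e w) = k w0 * u w0 * ?L ^ e w0 + (\<Sum>w\<in>{..<W}-{w0}. k w * u w * ?L ^ e w)"
    using w0 by (subst sum.remove[of _ w0]) auto
  moreover have "?L ^ (e w0 + D) dvd (\<Sum>w\<in>{..<W}-{w0}. k w * u w * ?L ^ e w)"
  proof (intro dvd_sum)
    fix v assume v: "v \<in> {..<W} - {w0}"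
    show "?L ^ (e w0 + D) dvd k v * u v * ?L ^ e v"
    proof (cases "v < w0")
      case False
      then have "e w0 + D \<le> e v" using v e[of w0 v] by auto
      then show ?thesis by (intro dvd_mult le_imp_power_dvd)
    qed (simp add: below)
  qed
  ultimately have "?L ^ (e w0 + D) dvd k w0 * u w0 * ?L ^ e w0"
    using zero by (simp add: add_eq_0_iff del: mult_minus_left mult_minus_right)
  then have "?L ^ e w0 * ?L ^ D dvd ?L ^ e w0 * (k w0 * u w0)"
    by (simp add: power_add mult_ac)
  then have "?L ^ D dvd k w0 * u w0"
    by (subst (asm) dvd_mult_cancel_left) auto
  moreover have "u w0 \<noteq> 0" "order a (u w0) = 0"
    using u[OF w0(1)] by (auto simp: order_root)
  ultimately have "D \<le> order a (k w0)"
    using w0 by (simp add: order_divides order_mult)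
  moreover have "order a (k w0) \<le> degree (k w0)" using w0 by (intro order_degree)
  ultimately show False using deg[of w0] w0 by auto
qed

lemma card_mult_le_degree:
  fixes R :: "'a::field poly"
  assumes "R \<noteq> 0" "finite S" "\<And>x. x \<in> S \<Longrightarrow> [:-x, 1:] ^ M dvd R"
  shows "card S * M \<le> degree R"
proof (cases "M = 0")
  case False
  have ord: "M \<le> order x R" if "x \<in> S" for x
    using assms that by (simp add: order_divides)
  have "card S * M = (\<Sum>x\<in>S. M)" by simp
  also have "\<dots> \<le> (\<Sum>x\<in>S. order x R)" by (intro sum_mono ord)
  also have "\<dots> \<le> (\<Sum>x | poly R x = 0. order x R)"
    using assms(1) ord False by (intro sum_mono2 poly_roots_finite) (auto simp: order_root dest!: ord)
  also have "\<dots> \<le> degree R" using assms(1) by (rule sum_order_le_degree)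
  finally show ?thesis .
qed simp

text \<open>
  The auxiliary polynomial is \<open>R = \<Sum> v (w, s) * X ^ s * f ^ (M + j D) * (X - a) ^ (Q i)\<close> with
  \<open>i = w div d\<close>, \<open>j = w mod d\<close> and \<open>s < D\<close>.  On \<open>S\<close>, where \<open>x ^ Q = x\<close> and \<open>f x ^ D = \<zeta>\<close>, its \<open>l\<close>-th Hasse derivative
  is a power of \<open>f\<close> times a polynomial \<open>\<Sum> v t * H l t\<close> of low degree.  Making all of these vanish
  identically for \<open>l < M\<close> is a linear system in \<open>v\<close> with fewer equations than unknowns.
  For \<open>v \<noteq> 0\<close> also \<open>R \<noteq> 0\<close>, as the summands have distinct orders of vanishing at \<open>a\<close>.
\<close>
lemma stepanov_bound:
  fixes f f1 :: "'a::field poly" and a \<zeta> :: 'a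
  assumes char: "prime CHAR('a)" and Q: "Q = CHAR('a) ^ n" and a: "a ^ Q = a"
    and f: "f = [:-a, 1:] * f1" "poly f1 a \<noteq> 0" and m: "m = degree f"
    and D: "D * d = Q - 1" "D > 0" "d > 0"
    and S: "finite S" "\<And>x. x \<in> S \<Longrightarrow> x ^ Q = x \<and> poly f x ^ D = \<zeta>"
    and K: "K > 0" and M: "M \<le> Q" "M * (D + m * M + K) < K * d * D"
  shows "card S * M \<le> D + m * M + m * Q + Q * (K - 1)"
proof -
  define L where "L = [:-a, 1:]"
  define W where "W = K * d"
  define I where "I = {..<W} \<times> {..<D}"
  \<comment> \<open>The offset \<open>M\<close> guarantees that a factor \<open>f ^ (M - l)\<close>
    can be pulled out of every Hasse derivative of order \<open>l < M\<close>, uniformly in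
    \<open>w\<close>.\<close>
  define N where "N = (\<lambda>w. M + (w mod d) * D)"
  have "f1 \<noteq> 0" using f(2) by auto
  then have f0: "f \<noteq> 0" "f1 \<noteq> 0" unfolding f(1) mult_eq_0_iff by auto
  have Qpos: "Q > 0" using char Q by (simp add: prime_gt_0_nat)
  have "\<exists>h. coeff (taylor (monom 1 s * f ^ N w)) l = f ^ (N w - l) * h" for l w s
    using power_dvd_coeff_taylor_mult[of f "N w" l "monom 1 s"] by (auto simp: dvd_def)
  then have "\<forall>l w s. \<exists>h. coeff (taylor (monom 1 s * f ^ N w)) l = f ^ (N w - l) * h" by blast
  then obtain h where h: "\<And>l w s. coeff (taylor (monom 1 s * f ^ N w)) l = f ^ (N w - l) * h l w s"
    unfolding choice_iff by blast
  \<comment> \<open>The bound is free of \<open>N w\<close>, because the large power of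
    \<open>f\<close> has been divided out. This keeps the number of equations small.\<close>
  have degh: "degree (h l w s) \<le> s + m * l" if "l < M" for l w s
  proof (cases "h l w s = 0")
    case False
    have "degree (f ^ (N w - l) * h l w s) + l \<le> degree (monom 1 s * f ^ N w)"
      using degree_coeff_taylor[of "monom 1 s * f ^ N w" l] False f0 by (simp add: h)
    then have "m * (N w - l) + degree (h l w s) \<le> s + m * N w"
      using False f0 by (simp add: degree_mult_eq degree_power_eq degree_monom_eq m mult.commute)
    moreover have "m * N w = m * (N w - l) + m * l"
      using that by (simp add: N_def flip: add_mult_distrib2)
    ultimately show ?thesis by simp
  qed simp
  define E where "E = {..<M} \<times> {..<D + m * M + K}"
  define H where "H = (\<lambda>l (w, s). h l w s * L ^ (w div d) * [:\<zeta> ^ (w mod d):])"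
  \<comment> \<open>There are \<open>M\<close> derivatives with \<open>D + m * M + K\<close>
    coefficients each, against \<open>K * d * D\<close> unknowns.\<close>
  have "card E < card I" using M by (simp add: E_def I_def W_def)
  then have "\<exists>v. (\<exists>t\<in>I. v t \<noteq> 0) \<and> (\<forall>e\<in>E. (\<Sum>t\<in>I. coeff (H (fst e) t) (snd e) * v t) = 0)"
    by (intro homogeneous_system_nontrivial) (auto simp: E_def I_def)
  then obtain v where v: "\<exists>t\<in>I. v t \<noteq> 0" "\<And>l c. (l, c) \<in> E \<Longrightarrow> (\<Sum>t\<in>I. coeff (H l t) c * v t) = 0"
    by fastforce
  have H0: "(\<Sum>t\<in>I. smult (v t) (H l t)) = 0" if l: "l < M" for l
  proof (intro poly_eqI)
    fix c
    show "coeff (\<Sum>t\<in>I. smult (v t) (H l t)) c = coeff 0 c"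
    proof (cases "c < D + m * M + K")
      case True
      then show ?thesis using v(2)[of l c] l by (simp add: E_def coeff_sum mult.commute)
    next
      case False
      have "coeff (H l (w, s)) c = 0" if "(w, s) \<in> I" for w s
      proof (rule coeff_eq_0)
        have "degree (H l (w, s)) \<le> degree (h l w s) + degree (L ^ (w div d)) + degree [:\<zeta> ^ (w mod d):]"
          unfolding H_def prod.case by (intro order_trans[OF degree_mult_le] add_mono degree_mult_le) auto
        also have "degree (L ^ (w div d)) = w div d" by (simp add: L_def degree_linear_power)
        also have "degree (h l w s) + w div d + degree [:\<zeta> ^ (w mod d):] \<le> s + m * l + w div d"
          using degh[OF l] by simp
        also have "m * l \<le> m * M" using l by simp
        also have "s < D" using that by (simp add: I_def)
        also have "w div d < K" using that D by (simp add: I_def W_def less_mult_imp_div_less)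
        finally show "degree (H l (w, s)) < c" using False by simp
      qed
      then show ?thesis by (auto simp: coeff_sum intro!: sum.neutral)
    qed
  qed
  define B where "B = (\<lambda>(w, s). monom 1 s * f ^ N w * L ^ (Q * (w div d)))"
  define R where "R = (\<Sum>t\<in>I. smult (v t) (B t))"

  have "R \<noteq> 0"
  proof
    assume R: "R = 0"
    define k where "k = (\<lambda>w. \<Sum>s<D. monom (v (w, s)) s)"
    have k: "coeff (k w) s = (if s < D then v (w, s) else 0)" for w s
      by (simp add: k_def coeff_sum)
    \<comment> \<open>The order at \<open>a\<close> coming from the powers of \<open>f\<close> and
      of \<open>L\<close>, once the common factor \<open>L ^ M\<close> is removed. Its values are
      spaced by at least \<open>D\<close>: inside a block by the step of \<open>w mod d\<close>,
      between blocks because \<open>Q = D * d + 1\<close>.\<close>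
    define e where "e = (\<lambda>w. Q * (w div d) + D * (w mod d))"
    have "R = (\<Sum>w<W. \<Sum>s<D. smult (v (w, s)) (B (w, s)))"
      by (simp add: R_def I_def sum.cartesian_product)
    also have "\<dots> = (\<Sum>w<W. k w * f ^ N w * L ^ (Q * (w div d)))"
      by (intro sum.cong refl)
        (simp add: k_def B_def sum_distrib_right smult_monom flip: mult_smult_left)
    also have "\<dots> = (\<Sum>w<W. L ^ M * (k w * f1 ^ N w * L ^ e w))"
      by (intro sum.cong refl)
        (simp add: f(1) e_def N_def power_add power_mult_distrib mult_ac flip: L_def)
    finally have "L ^ M * (\<Sum>w<W. k w * f1 ^ N w * L ^ e w) = 0"
      using R by (simp add: sum_distrib_left)
    then have z: "(\<Sum>w<W. k w * f1 ^ N w * [:-a, 1:] ^ e w) = 0"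
      by (simp add: L_def)
    have "k w = 0" if "w < W" for w
    proof (rule linear_combination_separated_orders[OF _ _ _ z that])
      fix w assume "w < W"
      show "k w = 0 \<or> degree (k w) < D"
        using k[of w "degree (k w)"] by (cases "degree (k w) < D") auto
      show "poly (f1 ^ N w) a \<noteq> 0" using f by simp
    next
      fix w w' assume w: "w < w'" "w' < W"
      show "e w + D \<le> e w'"
      proof (cases "w div d = w' div d")
        case True
        have "w div d * d + w mod d = w" "w' div d * d + w' mod d = w'" by simp_all
        then have "w mod d + 1 \<le> w' mod d" using w unfolding True by linarith
        then have "D * (w mod d + 1) \<le> D * (w' mod d)" by (rule mult_le_mono2)
        then show ?thesis using True by (simp add: e_def)
      next
        case False
        then have "w div d + 1 \<le> w' div d" using div_le_mono[of w w' d] w by simp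
        then have "Q * (w div d + 1) \<le> Q * (w' div d)" by (rule mult_le_mono2)
        moreover have "w mod d + 1 \<le> d" using D by (simp add: Suc_le_eq)
        then have "D * (w mod d + 1) \<le> D * d" by (rule mult_le_mono2)
        ultimately show ?thesis using D by (simp add: e_def)
      qed
    qed
    then have "v (w, s) = 0" if "(w, s) \<in> I" for w s
      using that k[of w s] by (simp add: I_def)
    then show False using v(1) by auto
  qed

  have "degree R \<le> D + m * M + m * Q + Q * (K - 1)"
    unfolding R_def
  proof (intro degree_sum_le)
    show "finite I" by (simp add: I_def)
    fix t assume "t \<in> I"
    then obtain w s where t: "t = (w, s)" "w < W" "s < D" by (auto simp: I_def)
    have "degree (smult (v t) (B t)) \<le> degree (B t)" by (rule degree_smult_le)
    also have "\<dots> = s + m * N w + Q * (w div d)"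
      using f0 by (simp add: B_def t degree_mult_eq degree_power_eq degree_monom_eq m L_def mult.commute)
    also have "\<dots> \<le> D + m * (M + Q) + Q * (K - 1)"
    proof (intro add_mono mult_le_mono2)
      show "s \<le> D" using t by simp
      have "w mod d * D \<le> d * D" using D by (intro mult_le_mono1) (simp add: less_imp_le)
      then show "N w \<le> M + Q" using D by (simp add: N_def mult.commute)
      have "w div d < K" using t D by (simp add: W_def less_mult_imp_div_less)
      then show "w div d \<le> K - 1" by simp
    qed
    finally show "degree (smult (v t) (B t)) \<le> D + m * M + m * Q + Q * (K - 1)"
      by (simp add: algebra_simps)
  qed
  moreover have "card S * M \<le> degree R"
  proof (rule card_mult_le_degree[OF \<open>R \<noteq> 0\<close> S(1)])
    fix x assume "x \<in> S"
    then have x: "x ^ Q = x" "poly f x ^ D = \<zeta>" using S by auto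
    \<comment> \<open>On \<open>S\<close> the exponent \<open>Q * i\<close> collapses to
      \<open>i\<close>. This is why \<open>R\<close> may have large degree while the polynomials
      \<open>H\<close> that govern its derivatives on \<open>S\<close> have small degree.\<close>
    have xa: "(x - a) ^ (Q * i) = (x - a) ^ i" for i
    proof -
      have "(x - a + a) ^ Q = (x - a) ^ Q + a ^ Q"
        by (rule freshmans_dream'[OF char Q])
      then have "(x - a) ^ Q + a = x" using x a by simp
      then have "(x - a) ^ Q = x - a" by (simp add: eq_diff_eq)
      then show ?thesis by (simp add: power_mult)
    qed
    show "[:-x, 1:] ^ M dvd R"
    proof (rule pow_dvd_if_taylor_vanishes)
      fix l assume l: "l < M"
      have "poly (coeff (taylor (B t)) l) x = poly f x ^ (M - l) * poly (H l t) x" if "t \<in> I" for t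
      proof -
        obtain w s where t: "t = (w, s)" by force
        have "coeff (taylor (B t)) l = (\<Sum>u\<le>l. coeff (taylor (monom 1 s * f ^ N w)) u *
            coeff (taylor (L ^ (Q * (w div d)))) (l - u))"
          by (simp add: B_def t coeff_taylor_mult)
        \<comment> \<open>The power of \<open>L\<close> has exponent divisible by \<open>Q\<close>,
          so its Hasse derivatives of orders 1 to \<open>Q - 1\<close> vanish; as
          \<open>l < M \<le> Q\<close>, only \<open>u = l\<close> survives.\<close>
        also have "\<dots> = (\<Sum>u\<in>{l}. coeff (taylor (monom 1 s * f ^ N w)) u *
            coeff (taylor (L ^ (Q * (w div d)))) (l - u))"
        proof (rule sum.mono_neutral_right)
          show "\<forall>i\<in>{..l} - {l}. coeff (taylor (monom 1 s * f ^ N w)) i * coeff (taylor (L ^ (Q * (w div d)))) (l - i) = 0"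
            using coeff_taylor_frobenius_power[OF char Q, of _ "-a" "w div d"] l M by (auto simp: L_def)
        qed auto
        also have "\<dots> = f ^ (N w - l) * h l w s * L ^ (Q * (w div d))"
          by (simp add: h)
        finally have *: "poly (coeff (taylor (B t)) l) x = poly f x ^ (N w - l) * poly (h l w s) x * (x - a) ^ (w div d)"
          using xa by (simp add: L_def)
        have "N w - l = (M - l) + D * (w mod d)" using l by (simp add: N_def mult.commute)
        then have "poly f x ^ (N w - l) = poly f x ^ (M - l) * \<zeta> ^ (w mod d)"
          using x by (simp add: power_add power_mult)
        then show ?thesis using * by (simp add: H_def t L_def)
      qed
      then have "poly (coeff (taylor R) l) x = (\<Sum>t\<in>I. v t * (poly f x ^ (M - l) * poly (H l t) x))"
        by (simp add: R_def taylor_sum taylor_smult coeff_sum poly_sum)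
      also have "\<dots> = poly f x ^ (M - l) * poly (\<Sum>t\<in>I. smult (v t) (H l t)) x"
        by (simp add: poly_sum sum_distrib_left mult_ac)
      finally show "poly (coeff (taylor R) l) x = 0" using H0[OF l] by simp
    qed
  qed
  ultimately show ?thesis by simp
qed

lemma geometric_sum_nat:
  fixes q :: nat
  assumes "q > 0"
  shows "(\<Sum>i<n. q ^ i) * (q - 1) = q ^ n - 1"
proof -
  have "(\<Sum>i<n. q ^ i) * (q - 1) + 1 = q ^ n"
  proof (induction n)
    case (Suc n)
    have "(\<Sum>i<Suc n. q ^ i) * (q - 1) + 1 = ((\<Sum>i<n. q ^ i) * (q - 1) + 1) + q ^ n * (q - 1)"
      by (simp add: algebra_simps)
    also have "\<dots> = q ^ n * (1 + (q - 1))" unfolding Suc.IH by (simp only: distrib_left mult_1_right)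
    finally show ?case using assms by simp
  qed simp
  then show ?thesis by simp
qed

text \<open>\<open>stepanov_bound\<close> gives about \<open>Q * (K + 2 * m) / M\<close>, and its
  side condition allows \<open>M\<close> to be just below \<open>K * d\<close>. The result is
  \<open>Q / d\<close> with an error of order \<open>Q / K\<close>, so \<open>K\<close> is taken as
  large as possible, which is of the size of \<open>sqrt Q\<close>.\<close>

lemma stepanov_asymptotic:
  fixes f f1 :: "'a::field poly" and a :: 'a and q :: nat
  assumes q: "prime q" "CHAR('a) = q" and a: "a ^ q = a"
    and f: "f = [:-a, 1:] * f1" "poly f1 a \<noteq> 0"
  obtains C n0 where "C \<ge> 0" and "\<And>n \<zeta> S. n \<ge> n0 \<Longrightarrow> finite S \<Longrightarrow>
      (\<And>x. x \<in> S \<Longrightarrow> x ^ (q ^ n) = x \<and> poly f x ^ (\<Sum>i<n. q ^ i) = \<zeta>) \<Longrightarrow>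
      real (card S) \<le> real (q ^ n) / real (q - 1) + C * sqrt (real (q ^ n))"
proof -
  define m where "m = degree f"
  \<comment> \<open>The gap between \<open>M\<close> and \<open>K * d\<close>: the quadratic terms
    of the side condition amount to at most \<open>(m + 1) * D\<close>, and one further
    \<open>D\<close> makes the inequality strict.\<close>
  define c where "c = m + 2"
  define d where "d = q - 1"
  \<comment> \<open>Ensures \<open>2 * c \<le> t < K\<close>, hence
    \<open>M \<ge> K / 2\<close>.\<close>
  define n0 where "n0 = 4 * c + 5"
  define C where "C = 2 * (real d * (2 * real m) + real c) * real q ^ 2"
  have q2: "q \<ge> 2" using q prime_ge_2_nat by blast
  then have d: "d \<ge> 1" "q = d + 1" by (auto simp: d_def)
  show ?thesis
  proof
    show "C \<ge> 0" by (simp add: C_def)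
    fix n \<zeta> and S :: "'a set"
    assume n: "n \<ge> n0" and S: "finite S" "\<And>x. x \<in> S \<Longrightarrow> x ^ (q ^ n) = x \<and> poly f x ^ (\<Sum>i<n. q ^ i) = \<zeta>"
    \<comment> \<open>The largest \<open>t\<close> with \<open>2 * t + 2 \<le> n - 1\<close>, so
      that \<open>W * W \<le> q ^ (n - 1) \<le> D\<close>. Rounding makes \<open>K\<close> smaller
      than \<open>sqrt Q\<close> by at most the factor \<open>q ^ 2\<close> that appears in
      \<open>C\<close>.\<close>
    define t where "t = (n - 3) div 2"
    define Q where "Q = q ^ n"
    define D where "D = (\<Sum>i<n. q ^ i)"
    define K where "K = q ^ t"
    define W where "W = K * d"
    define M where "M = W - c"
    have t: "2 * t + 3 \<le> n" "n \<le> 2 * t + 4" "2 * c \<le> t"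
      using n unfolding t_def n0_def by linarith+
    have "t < 2 ^ t" by (rule less_exp)
    also have "(2::nat) ^ t \<le> K" using q2 by (simp add: K_def power_mono)
    finally have tK: "t < K" .
    have KW: "K \<le> W" using d by (simp add: W_def)
    have Wq: "W \<le> q ^ (t + 1)" using d by (simp add: W_def K_def)
    have cM: "M + c = W" using t tK KW by (simp add: M_def)
    have Ddef: "D * d = Q - 1" unfolding D_def Q_def d_def using q2 by (intro geometric_sum_nat) simp
    have Dge: "q ^ (n - 1) \<le> D" unfolding D_def using t by (intro member_le_sum) auto
    have Qpos: "Q > 0" using q2 by (simp add: Q_def)
    have Dpos: "D > 0" using Dge q2 by (metis gr0I le_zero_eq not_numeral_le_zero power_not_zero)
    have DQ: "D \<le> Q" using Ddef d by (metis diff_le_self le_trans mult_le_mono2 nat_mult_1_right)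
    have MQ: "M \<le> Q"
    proof -
      have "M \<le> q ^ (t + 1)" using Wq by (simp add: M_def)
      also have "\<dots> \<le> q ^ n" using t q2 by (intro power_increasing) auto
      finally show ?thesis by (simp add: Q_def)
    qed
    have "M * (D + m * M + K) < K * d * D"
    proof -
      have "W * W \<le> q ^ (t + 1) * q ^ (t + 1)" by (intro mult_le_mono Wq)
      also have "\<dots> = q ^ (2 * t + 2)" by (simp add: mult_2 flip: power_add)
      also have "\<dots> \<le> q ^ (n - 1)" using t q2 by (intro power_increasing) auto
      also have "\<dots> \<le> D" by (rule Dge)
      finally have WD: "W * W \<le> D" .
      have "M * (D + m * M + K) \<le> M * D + W * (m * W + W)"
        unfolding add_mult_distrib2 using KW by (auto simp: M_def intro!: add_mono mult_le_mono)
      also have "\<dots> = M * D + (m + 1) * (W * W)" by (simp add: algebra_simps)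
      also have "\<dots> \<le> M * D + (m + 1) * D" using WD by (intro add_mono mult_le_mono) auto
      also have "\<dots> < M * D + c * D" using Dpos by (simp add: c_def)
      also have "\<dots> = K * d * D" using cM by (simp add: W_def flip: add_mult_distrib)
      finally show ?thesis .
    qed
    moreover have aQ: "a ^ Q = a" unfolding Q_def
    proof (induction n)
      case (Suc n)
      then show ?case using a by (simp add: power_mult)
    qed simp
    ultimately have "card S * M \<le> D + m * M + m * Q + Q * (K - 1)"
      using q d Dpos tK Ddef MQ S
      by (intro stepanov_bound[OF _ _ aQ f m_def, where n = n and d = d and \<zeta> = \<zeta>])
        (auto simp: Q_def D_def)
    also have "\<dots> \<le> Q + m * Q + m * Q + Q * (K - 1)"
      using DQ MQ by (intro add_mono mult_le_mono) auto
    also have "\<dots> = Q * (K + 2 * m)" using tK by (cases K) (auto simp: algebra_simps)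
    finally have main: "card S * M \<le> Q * (K + 2 * m)" .
    have M0: "real M \<ge> real K / 2" using cM KW t tK by linarith
    have Kpos: "real K > 0" using tK by simp
    have eq: "real M = real K * real d - real c" using cM by (simp add: W_def flip: of_nat_mult of_nat_add)
    have "real (card S) * real M \<le> real Q * (real K + 2 * real m)"
      using main by (metis of_nat_le_iff of_nat_mult of_nat_add of_nat_numeral)
    then have "real (card S) \<le> real Q * (real K + 2 * real m) / real M"
      using M0 Kpos by (simp add: pos_le_divide_eq)
    also have "\<dots> = real Q / real d + real Q * (real d * (2 * real m) + real c) / (real d * real M)"
    proof -
      have "real Q / real d + real Q * (real d * (2 * real m) + real c) / (real d * real M)
          = (real Q * real M + real Q * (real d * (2 * real m) + real c)) / (real d * real M)"
        using M0 Kpos d by (simp add: add_divide_distrib)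
      also have "real Q * real M + real Q * (real d * (2 * real m) + real c) = real d * (real Q * (real K + 2 * real m))"
        unfolding eq by (simp add: algebra_simps)
      finally show ?thesis using d by simp
    qed
    also have "real Q * (real d * (2 * real m) + real c) / (real d * real M) \<le> C * sqrt (real Q)"
    proof -
      have "real d * real M \<ge> 1 * (real K / 2)" using d M0 Kpos by (intro mult_mono) auto
      then have "real Q * (real d * (2 * real m) + real c) / (real d * real M)
          \<le> real Q * (real d * (2 * real m) + real c) / (real K / 2)"
        using Kpos by (intro divide_left_mono mult_pos_pos[of "real K / 2"]) (auto intro: less_le_trans[of 0 "real K / 2"])
      also have "\<dots> = 2 * (real d * (2 * real m) + real c) * (real Q / real K)" by simp
      also have "real Q / real K \<le> real q ^ 2 * sqrt (real Q)"
      proof -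
        have "real Q \<le> (real K * real q ^ 2)\<^sup>2"
        proof -
          have "Q \<le> q ^ (2 * t + 4)" unfolding Q_def using t q2 by (intro power_increasing) auto
          also have "\<dots> = (K * q ^ 2)\<^sup>2" by (simp add: K_def power_mult_distrib power_add mult.commute[of 2 t] flip: power_mult)
          finally have "Q \<le> (K * q ^ 2)\<^sup>2" .
          then show ?thesis by (metis of_nat_le_iff of_nat_mult of_nat_power)
        qed
        then have "sqrt (real Q) \<le> real K * real q ^ 2" by (intro real_le_lsqrt) auto
        then have "sqrt (real Q) * sqrt (real Q) \<le> real K * real q ^ 2 * sqrt (real Q)"
          by (intro mult_right_mono) auto
        then show ?thesis using Kpos by (simp add: field_simps)
      qed
      then have "2 * (real d * (2 * real m) + real c) * (real Q / real K) \<le> 2 * (real d * (2 * real m) + real c) * (real q ^ 2 * sqrt (real Q))"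
        by (intro mult_left_mono) auto
      finally show ?thesis by (simp add: C_def mult_ac)
    qed
    finally show "real (card S) \<le> real (q ^ n) / real (q - 1) + C * sqrt (real (q ^ n))"
      by (simp add: Q_def d_def)
  qed
qed

section \<open>Finite fields inside an algebraically closed field\<close>

lemma size_proots_alg_closed:
  fixes p :: "'a::alg_closed_field poly"
  assumes "p \<noteq> 0"
  shows "size (proots p) = degree p"
proof -
  obtain A where A: "size A = degree p" "p = smult (lead_coeff p) (\<Prod>x\<in>#A. [:-x, 1:])"
    using alg_closed_imp_factorization[OF assms] by blast
  have "proots (\<Prod>x\<in>#A. [:-x, 1:]) = A"
  proof (induction A)
    case (add x A)
    have "(\<Prod>x\<in>#A. [:-x, 1:]) \<noteq> 0" by (auto simp: prod_mset_zero_iff)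
    then have "proots ([:-x, 1:] * (\<Prod>x\<in>#A. [:-x, 1:])) = proots [:-x, 1:] + proots (\<Prod>x\<in>#A. [:-x, 1:])"
      by (intro proots_mult) auto
    then show ?case by (simp only: add.IH) (simp add: add.IH)
  qed simp
  then have "proots p = A"
    using assms by (subst A(2)) (simp add: proots_smult)
  then show ?thesis using A by simp
qed

text \<open>The polynomial \<open>X ^ (q ^ n) - X\<close> has derivative \<open>- 1\<close>, so all
  its zeros are simple. The set serves as the field with \<open>q ^ n\<close> elements, and all
  these fields live in one type.\<close>

lemma card_frobenius_fixed:
  fixes q :: nat
  assumes "prime q" "CHAR('a::alg_closed_field) = q" "n > 0"
  shows "card {x::'a. x ^ (q ^ n) = x} = q ^ n" and "finite {x::'a. x ^ (q ^ n) = x}"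
proof -
  define p where "p = monom (1::'a) (q ^ n) - [:0, 1:]"
  have Q: "q ^ n > 1" using assms prime_gt_1_nat one_less_power by blast
  have deg: "degree p = q ^ n"
    unfolding p_def diff_conv_add_uminus using Q prime_gt_0_nat[OF assms(1)]
    by (subst degree_add_eq_left) (simp_all add: degree_monom_eq)
  have p0: "p \<noteq> 0" using deg Q prime_gt_0_nat[OF assms(1)] by auto
  have roots: "{x::'a. x ^ (q ^ n) = x} = {x. poly p x = 0}"
    by (simp add: p_def poly_monom)
  then show "finite {x::'a. x ^ (q ^ n) = x}" using poly_roots_finite[OF p0] by simp
  have "of_nat (q ^ n) = (0 :: 'a)"
    using assms of_nat_CHAR[where 'a = 'a] by (cases n) auto
  then have "pderiv p = - 1"
    by (simp add: p_def pderiv_diff pderiv_monom pderiv_pCons one_pCons del: of_nat_power)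
  then have pd: "poly (pderiv p) x \<noteq> 0" for x by simp
  have ord: "order x p = 1" if "poly p x = 0" for x
  proof (rule ccontr)
    assume "order x p \<noteq> 1"
    then have "order x p \<ge> 2" using that p0 by (simp add: order_root)
    then have "[:-x, 1:] ^ 2 dvd p" using p0 by (simp add: order_divides)
    then obtain r where "p = [:-x, 1:] * ([:-x, 1:] * r)"
      unfolding power2_eq_square mult.assoc dvd_def by blast
    then have "pderiv p = [:-x, 1:] * pderiv ([:-x, 1:] * r) + [:-x, 1:] * r * pderiv [:-x, 1:]"
      by (simp only: pderiv_mult)
    then show False using pd[of x] by simp
  qed
  have "degree p = size (proots p)" using p0 by (simp add: size_proots_alg_closed)
  also have "\<dots> = (\<Sum>x | poly p x = 0. order x p)"
    using p0 by (simp add: size_multiset_overloaded_eq set_count_proots)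
  also have "\<dots> = card {x. poly p x = 0}"
    using ord by simp
  finally show "card {x::'a. x ^ (q ^ n) = x} = q ^ n" using deg roots by simp
qed

section \<open>Norm character sums over finite fields\<close>

text \<open>Fixed points of Frobenius instead of the image of the integers: closure properties and
  rationality of coefficients become power identities. The two descriptions are matched in
  \<open>bij_betw_of_int_prime_subfield\<close>.\<close>

definition prime_subfield :: "'a::field set" where
  "prime_subfield = {c. c ^ CHAR('a) = c}"

lemma prime_subfield_power:
  assumes "(c::'a::field) \<in> prime_subfield"
  shows "c ^ (CHAR('a) ^ n) = c"
  using assms by (induction n) (simp_all add: prime_subfield_def power_mult)

lemma prime_subfield_closed:
  fixes x y :: "'a::field"
  assumes "prime CHAR('a)"
  shows "0 \<in> (prime_subfield :: 'a set)" "1 \<in> (prime_subfield :: 'a set)"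
    "x \<in> prime_subfield \<Longrightarrow> y \<in> prime_subfield \<Longrightarrow> x + y \<in> prime_subfield"
    "x \<in> prime_subfield \<Longrightarrow> y \<in> prime_subfield \<Longrightarrow> x * y \<in> prime_subfield"
    "x \<in> prime_subfield \<Longrightarrow> y \<in> prime_subfield \<Longrightarrow> x - y \<in> prime_subfield"
proof -
  have pos: "CHAR('a) > 0" using assms prime_gt_0_nat by blast
  show "0 \<in> (prime_subfield :: 'a set)" "1 \<in> (prime_subfield :: 'a set)"
    using pos by (auto simp: prime_subfield_def)
  show "x \<in> prime_subfield \<Longrightarrow> y \<in> prime_subfield \<Longrightarrow> x + y \<in> prime_subfield"
    using freshmans_dream[OF assms refl, of x y] by (simp add: prime_subfield_def)
  show "x \<in> prime_subfield \<Longrightarrow> y \<in> prime_subfield \<Longrightarrow> x * y \<in> prime_subfield"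
    by (simp add: prime_subfield_def power_mult_distrib)
  show "x \<in> prime_subfield \<Longrightarrow> y \<in> prime_subfield \<Longrightarrow> x - y \<in> prime_subfield"
    using freshmans_dream[OF assms refl, of "x - y" y] by (simp add: prime_subfield_def eq_diff_eq)
qed

lemma card_prime_subfield:
  assumes "prime CHAR('a::alg_closed_field)"
  shows "card (prime_subfield :: 'a set) = CHAR('a)" "finite (prime_subfield :: 'a set)"
  using card_frobenius_fixed[OF assms refl, of 1] by (simp_all add: prime_subfield_def)

text \<open>The exponent \<open>\<Sum>i<n. q ^ i\<close> is that of the norm from the field with \<open>q ^ n\<close> elements.\<close>
lemma norm_in_prime_subfield:
  fixes y :: "'a::field"
  assumes q: "prime CHAR('a)" and y: "y ^ (CHAR('a) ^ n) = y"
  shows "y ^ (\<Sum>i<n. CHAR('a) ^ i) \<in> prime_subfield"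
proof (cases "y = 0 \<or> n = 0")
  case True
  have "(\<Sum>i<n. CHAR('a) ^ i) > 0" if "n > 0"
    using that q by (intro sum_pos2[of _ 0]) auto
  then show ?thesis using True prime_subfield_closed[OF q] by (cases "n = 0") (auto simp: power_0_left)
next
  case False
  have q0: "CHAR('a) > 0" using q prime_gt_0_nat by blast
  let ?D = "\<Sum>i<n. CHAR('a) ^ i"
  have "y ^ (CHAR('a) ^ n - 1) * y = y" using y q0 by (metis Suc_diff_1 mult.commute power_Suc zero_less_power)
  then have "y ^ (?D * (CHAR('a) - 1)) = 1" using False q0 by (simp only: geometric_sum_nat) simp
  then have "(y ^ ?D) ^ (CHAR('a) - 1) = 1" by (simp add: power_mult)
  then have "(y ^ ?D) ^ (CHAR('a) - 1) * y ^ ?D = y ^ ?D" by simp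
  then have "(y ^ ?D) ^ Suc (CHAR('a) - 1) = y ^ ?D" by (simp only: power_Suc2)
  then show ?thesis using q0 by (simp only: prime_subfield_def mem_Collect_eq Suc_diff_1)
qed

text \<open>Upper bounds for the fibres of the norm of \<open>f\<close> suffice. Subtracting the
  common bound \<open>B\<close> from every fibre size changes nothing, since \<open>\<psi>\<close>
  sums to zero, and makes all weights nonpositive. Their absolute values add up to
  \<open>(q - 1) * B\<close> minus the number of points with \<open>f x \<noteq> 0\<close>, where
  the main terms \<open>q ^ n\<close> cancel.\<close>

lemma norm_character_sum_bound:
  fixes f f1 :: "'a::alg_closed_field poly" and a :: 'a and \<psi> :: "'a \<Rightarrow> complex"
  assumes q: "prime q" "CHAR('a) = q" and a: "a \<in> prime_subfield"
    and f: "f = [:-a, 1:] * f1" "poly f1 a \<noteq> 0"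
    and fx: "\<And>n x. x ^ (q ^ n) = x \<Longrightarrow> poly f x ^ (q ^ n) = poly f x"
    and \<psi>: "\<psi> 0 = 0" "\<And>c. c \<in> prime_subfield \<Longrightarrow> norm (\<psi> c) \<le> 1" "(\<Sum>c\<in>prime_subfield. \<psi> c) = 0"
  obtains C n0 where "C \<ge> 0" "\<And>n. n \<ge> n0 \<Longrightarrow>
    norm (\<Sum>x | x ^ (q ^ n) = x. \<psi> (poly f x ^ (\<Sum>i<n. q ^ i))) \<le> C * sqrt (real (q ^ n))"
proof -
  obtain C n0 where C: "C \<ge> 0" and bound: "\<And>n \<zeta> S. n \<ge> n0 \<Longrightarrow> finite S \<Longrightarrow>
      (\<And>x. x \<in> S \<Longrightarrow> x ^ (q ^ n) = x \<and> poly f x ^ (\<Sum>i<n. q ^ i) = \<zeta>) \<Longrightarrow>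
      real (card S) \<le> real (q ^ n) / real (q - 1) + C * sqrt (real (q ^ n))"
    using stepanov_asymptotic[OF q _ f] a q by (auto simp: prime_subfield_def)
  define m where "m = degree f"
  have q2: "q \<ge> 2" using q prime_ge_2_nat by blast
  define U where "U = prime_subfield - {0::'a}"
  have cU: "card U = q - 1" "finite U"
    using card_prime_subfield[where 'a = 'a] q prime_subfield_closed(1)[where 'a = 'a] by (simp_all add: U_def)
  show ?thesis
  proof
    show "real (q - 1) * C + real m \<ge> 0" using C by simp
    fix n assume n: "n \<ge> max n0 1"
    define F where "F = {x::'a. x ^ (q ^ n) = x}"
    define D where "D = (\<Sum>i<n. q ^ i)"
    define T where "T = (\<lambda>\<zeta>. {x \<in> F. poly f x ^ D = \<zeta>})"
    define s where "s = sqrt (real (q ^ n))"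
    define B where "B = real (q ^ n) / real (q - 1) + C * s"
    have F: "card F = q ^ n" "finite F"
      using card_frobenius_fixed[OF q, of n] n by (auto simp: F_def)
    have D0: "D > 0" unfolding D_def using n q2 by (intro sum_pos2[of _ 0]) auto
    have nrm: "poly f x ^ D \<in> prime_subfield" if "x \<in> F" for x
      using norm_in_prime_subfield[of "poly f x" n] fx[of x n] that q by (simp add: F_def D_def)
    have f0: "f \<noteq> 0" using f(2) unfolding f(1) mult_eq_0_iff by auto
    have un: "(\<Union>\<zeta>\<in>U. T \<zeta>) = {x \<in> F. poly f x \<noteq> 0}"
      using nrm D0 by (auto simp: T_def U_def)
    have "(\<Sum>x\<in>F. \<psi> (poly f x ^ D)) = (\<Sum>x | x \<in> F \<and> poly f x \<noteq> 0. \<psi> (poly f x ^ D))"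
      using F \<psi>(1) D0 by (intro sum.mono_neutral_right) (auto simp: zero_power)
    also have "\<dots> = (\<Sum>\<zeta>\<in>U. \<Sum>x\<in>T \<zeta>. \<psi> (poly f x ^ D))"
      unfolding un[symmetric] using F cU by (intro sum.UNION_disjoint) (auto simp: T_def)
    also have "\<dots> = (\<Sum>\<zeta>\<in>U. of_nat (card (T \<zeta>)) * \<psi> \<zeta>)"
      by (intro sum.cong refl) (simp add: T_def)
    also have "\<dots> = (\<Sum>\<zeta>\<in>U. of_real (real (card (T \<zeta>)) - B) * \<psi> \<zeta>) + of_real B * (\<Sum>\<zeta>\<in>U. \<psi> \<zeta>)"
      by (simp add: sum_distrib_left flip: sum.distrib) (simp add: algebra_simps)
    also have "(\<Sum>\<zeta>\<in>U. \<psi> \<zeta>) = 0"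
      using \<psi>(3,1) card_prime_subfield(2)[where 'a = 'a] prime_subfield_closed(1)[where 'a = 'a] q
      by (simp add: U_def sum.remove[of _ 0])
    finally have "norm (\<Sum>x\<in>F. \<psi> (poly f x ^ D)) \<le> (\<Sum>\<zeta>\<in>U. norm (of_real (real (card (T \<zeta>)) - B) * \<psi> \<zeta>))"
      by (simp add: norm_sum)
    also have "\<dots> \<le> (\<Sum>\<zeta>\<in>U. B - real (card (T \<zeta>)))"
    proof (intro sum_mono)
      fix \<zeta> assume \<zeta>: "\<zeta> \<in> U"
      have "real (card (T \<zeta>)) \<le> B"
        unfolding B_def s_def using n F by (intro bound[where \<zeta> = \<zeta>]) (auto simp: T_def F_def D_def)
      moreover have "norm (\<psi> \<zeta>) \<le> 1" using \<psi> \<zeta> by (simp add: U_def)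
      ultimately show "norm (of_real (real (card (T \<zeta>)) - B) * \<psi> \<zeta>) \<le> B - real (card (T \<zeta>))"
        unfolding norm_mult norm_of_real by (simp add: mult_left_le)
    qed
    also have "\<dots> = real (q - 1) * B - real (card {x \<in> F. poly f x \<noteq> 0})"
    proof -
      have "card {x \<in> F. poly f x \<noteq> 0} = (\<Sum>\<zeta>\<in>U. card (T \<zeta>))"
        unfolding un[symmetric] using F cU by (intro card_UN_disjoint) (auto simp: T_def)
      then show ?thesis by (simp add: sum_subtractf cU)
    qed
    also have "\<dots> \<le> real (q - 1) * B - (real (q ^ n) - real m)"
    proof -
      have "F \<subseteq> {x \<in> F. poly f x \<noteq> 0} \<union> {x. poly f x = 0}" by auto
      then have "card F \<le> card ({x \<in> F. poly f x \<noteq> 0} \<union> {x. poly f x = 0})"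
        using F poly_roots_finite[OF f0] by (intro card_mono) auto
      also have "\<dots> \<le> card {x \<in> F. poly f x \<noteq> 0} + card {x. poly f x = 0}" by (rule card_Un_le)
      also have "card {x. poly f x = 0} \<le> m" using card_poly_roots_bound[OF f0] by (simp add: m_def)
      finally have "real (q ^ n) \<le> real (card {x \<in> F. poly f x \<noteq> 0}) + real m"
        unfolding F(1) of_nat_add[symmetric] of_nat_le_iff by simp
      then show ?thesis by linarith
    qed
    also have "real (q - 1) * B - (real (q ^ n) - real m) = real (q - 1) * C * s + real m"
      using q2 by (simp add: B_def field_simps)
    also have "real m \<le> real m * s"
      using q2 by (simp add: s_def mult_le_cancel_left1)
    finally show "norm (\<Sum>x | x ^ (q ^ n) = x. \<psi> (poly f x ^ (\<Sum>i<n. q ^ i)))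
        \<le> (real (q - 1) * C + real m) * sqrt (real (q ^ n))"
      by (simp add: F_def D_def s_def algebra_simps)
  qed
qed

section \<open>Frobenius orbits and monic polynomials over the prime field\<close>

definition frobenius_poly :: "'a::field poly \<Rightarrow> 'a poly" where
  "frobenius_poly p = map_poly (\<lambda>c. c ^ CHAR('a)) p"

lemma coeff_frobenius_poly:
  assumes "prime CHAR('a::field)"
  shows "coeff (frobenius_poly (p :: 'a poly)) i = coeff p i ^ CHAR('a)"
  using prime_gt_0_nat[OF assms] by (simp add: frobenius_poly_def coeff_map_poly)

lemma frobenius_poly_mult:
  assumes q: "prime CHAR('a::field)"
  shows "frobenius_poly (p * r :: 'a poly) = frobenius_poly p * frobenius_poly r"
  by (intro poly_eqI)
    (simp add: coeff_frobenius_poly[OF q] coeff_mult freshmans_dream_sum[OF q refl] power_mult_distrib)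

lemma frobenius_poly_1:
  assumes q: "prime CHAR('a::field)"
  shows "frobenius_poly (1 :: 'a poly) = 1"
  using prime_gt_0_nat[OF q] by (simp add: frobenius_poly_def map_poly_1 one_pCons)

lemma frobenius_poly_power:
  assumes q: "prime CHAR('a::field)"
  shows "frobenius_poly (p ^ n :: 'a poly) = frobenius_poly p ^ n"
  by (induction n) (simp_all add: frobenius_poly_mult[OF q] frobenius_poly_1[OF q])

lemma frobenius_poly_prod:
  assumes q: "prime CHAR('a::field)"
  shows "frobenius_poly (\<Prod>i\<in>I. g i :: 'a poly) = (\<Prod>i\<in>I. frobenius_poly (g i))"
  by (induction I rule: infinite_finite_induct) (simp_all add: frobenius_poly_mult[OF q] frobenius_poly_1[OF q])

lemma frobenius_poly_add:
  assumes q: "prime CHAR('a::field)"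
  shows "frobenius_poly (p + r :: 'a poly) = frobenius_poly p + frobenius_poly r"
  by (intro poly_eqI) (simp add: coeff_frobenius_poly[OF q] freshmans_dream[OF q refl])

lemma uminus_frobenius:
  fixes x :: "'a::field"
  assumes q: "prime CHAR('a)"
  shows "(- x) ^ CHAR('a) = - (x ^ CHAR('a))"
proof -
  have "(x + - x) ^ CHAR('a) = x ^ CHAR('a) + (- x) ^ CHAR('a)"
    by (rule freshmans_dream[OF q refl])
  then show ?thesis using prime_gt_0_nat[OF q] by (simp add: zero_power eq_neg_iff_add_eq_0 add.commute)
qed

lemma diff_frobenius_power:
  fixes x y :: "'a::field"
  assumes q: "prime CHAR('a)"
  shows "(x - y) ^ (CHAR('a) ^ n) = x ^ (CHAR('a) ^ n) - y ^ (CHAR('a) ^ n)"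
  using freshmans_dream'[OF q refl, of "x - y" y n] by (simp add: eq_diff_eq)

lemma frobenius_poly_linear:
  fixes x :: "'a::field"
  assumes q: "prime CHAR('a)"
  shows "frobenius_poly [:-x, 1:] = [:-(x ^ CHAR('a)), 1:]"
  using prime_gt_0_nat[OF q]
  by (simp add: frobenius_poly_def map_poly_pCons_zero zero_power uminus_frobenius[OF q])

lemma frobenius_poly_fixed_iff:
  assumes q: "prime CHAR('a::field)"
  shows "frobenius_poly g = (g :: 'a poly) \<longleftrightarrow> (\<forall>i. coeff g i \<in> prime_subfield)"
  by (auto simp: poly_eq_iff coeff_frobenius_poly[OF q] prime_subfield_def)

text \<open>Stands for the monic polynomials over the prime field, kept inside the polynomial ring
  of the large field so that they can be factored there; see
  \<open>frobenius_poly_fixed_iff\<close>.\<close>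

definition monics :: "nat \<Rightarrow> 'a::field poly set" where
  "monics n = {g. degree g = n \<and> lead_coeff g = 1 \<and> frobenius_poly g = g}"

lemma finite_monics:
  assumes q: "prime CHAR('a::alg_closed_field)"
  shows "finite (monics n :: 'a poly set)"
proof (rule finite_subset)
  show "(monics n :: 'a poly set) \<subseteq> Poly ` {xs. set xs \<subseteq> prime_subfield \<and> length xs = n + 1}"
  proof
    fix g :: "'a poly" assume g: "g \<in> monics n"
    then have "g \<noteq> 0" by (auto simp: monics_def)
    have "set (coeffs g) \<subseteq> range (coeff g)" by (auto simp: coeffs_def)
    then have "set (coeffs g) \<subseteq> prime_subfield" using g frobenius_poly_fixed_iff[OF q, of g] by (auto simp: monics_def)
    moreover have "length (coeffs g) = n + 1" using g \<open>g \<noteq> 0\<close> by (simp add: monics_def length_coeffs_degree)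
    ultimately show "g \<in> Poly ` {xs. set xs \<subseteq> prime_subfield \<and> length xs = n + 1}"
      by (intro image_eqI[of _ _ "coeffs g"]) auto
  qed
  show "finite (Poly ` {xs :: 'a list. set xs \<subseteq> prime_subfield \<and> length xs = n + 1})"
    by (intro finite_imageI finite_lists_length_eq card_prime_subfield(2) q)
qed

lemma monics_0: 
  assumes q: "prime CHAR('a::field)"
  shows "(monics 0 :: 'a poly set) = {1}"
proof -
  have "g = 1" if "degree g = 0" "lead_coeff g = 1" for g :: "'a poly"
    using that by (auto simp: one_pCons elim: degree_eq_zeroE)
  then show ?thesis by (auto simp: monics_def frobenius_poly_1[OF q])
qed

lemma monics_mult:
  assumes q: "prime CHAR('a::field)" and "g \<in> monics m" "(h :: 'a poly) \<in> monics n"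
  shows "g * h \<in> monics (m + n)"
proof -
  have "g \<noteq> 0" "h \<noteq> 0" using assms by (auto simp: monics_def)
  then show ?thesis using assms by (auto simp: monics_def degree_mult_eq frobenius_poly_mult[OF q] coeff_mult_degree_sum)
qed

lemma monics_mult_cancel:
  assumes q: "prime CHAR('a::field)" and g: "g \<in> monics m" and gh: "g * (h :: 'a poly) \<in> monics n"
  shows "m \<le> n" "h \<in> monics (n - m)"
proof -
  have 0: "g \<noteq> 0" "h \<noteq> 0" using assms by (auto simp: monics_def)
  then have n: "n = m + degree h" using assms by (auto simp: monics_def degree_mult_eq)
  then show "m \<le> n" by simp
  have "lead_coeff g = 1" "lead_coeff (g * h) = 1" using g gh by (auto simp: monics_def)
  then have "lead_coeff h = 1" unfolding lead_coeff_mult by simp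
  moreover have "g * frobenius_poly h = g * h"
    using g gh by (simp add: monics_def frobenius_poly_mult[OF q])
  ultimately show "h \<in> monics (n - m)" using 0 n by (simp add: monics_def)
qed

lemma poly_monics_in_prime_subfield:
  assumes q: "prime CHAR('a::field)" and g: "frobenius_poly (g :: 'a poly) = g" and a: "a \<in> prime_subfield"
  shows "poly g a \<in> prime_subfield"
proof -
  have "poly g a ^ CHAR('a) = (\<Sum>i\<le>degree g. (coeff g i * a ^ i) ^ CHAR('a))"
    unfolding poly_altdef by (rule freshmans_dream_sum[OF q refl])
  also have "\<dots> = poly g a"
    unfolding poly_altdef
  proof (intro sum.cong refl)
    fix i
    have "(a ^ i) ^ CHAR('a) = (a ^ CHAR('a)) ^ i" by (simp add: mult.commute flip: power_mult)
    then have "a ^ i \<in> prime_subfield" using a by (simp add: prime_subfield_def)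
    then show "(coeff g i * a ^ i) ^ CHAR('a) = coeff g i * a ^ i"
      using g frobenius_poly_fixed_iff[OF q, of g] by (simp add: power_mult_distrib prime_subfield_def)
  qed
  finally show ?thesis by (simp add: prime_subfield_def)
qed

text \<open>For \<open>x\<close> in the field with \<open>q ^ j\<close> elements this is the characteristic polynomial of \<open>x\<close> over the prime field.\<close>
definition orbit_poly :: "nat \<Rightarrow> 'a::field \<Rightarrow> 'a poly" where
  "orbit_poly j x = (\<Prod>i<j. [:- (x ^ (CHAR('a) ^ i)), 1:])"

lemma orbit_poly_monics:
  fixes x :: "'a::field"
  assumes q: "prime CHAR('a)" and x: "x ^ (CHAR('a) ^ j) = x"
  shows "orbit_poly j x \<in> monics j"
proof -
  have "frobenius_poly (orbit_poly j x) = (\<Prod>i<j. [:- (x ^ (CHAR('a) ^ Suc i)), 1:])"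
    unfolding orbit_poly_def frobenius_poly_prod[OF q] frobenius_poly_linear[OF q]
    by (simp add: mult.commute flip: power_mult)
  also have "\<dots> = orbit_poly j x"
  proof (cases j)
    case (Suc k)
    have "(\<Prod>i<j. [:- (x ^ (CHAR('a) ^ Suc i)), 1:]) = (\<Prod>i<k. [:- (x ^ (CHAR('a) ^ Suc i)), 1:]) * [:- (x ^ (CHAR('a) ^ j)), 1:]"
      by (simp only: Suc prod.lessThan_Suc)
    also have "\<dots> = [:- (x ^ (CHAR('a) ^ 0)), 1:] * (\<Prod>i<k. [:- (x ^ (CHAR('a) ^ Suc i)), 1:])"
      unfolding x by (simp only: power_0 power_one_right mult.commute)
    also have "\<dots> = (\<Prod>i<j. [:- (x ^ (CHAR('a) ^ i)), 1:])"
      by (simp only: Suc prod.lessThan_Suc_shift)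
    finally show ?thesis by (simp only: orbit_poly_def)
  qed (simp add: orbit_poly_def)
  finally have "frobenius_poly (orbit_poly j x) = orbit_poly j x" .
  moreover have "lead_coeff (orbit_poly j x) = 1"
    unfolding orbit_poly_def lead_coeff_prod by simp
  moreover have "degree (orbit_poly j x) = j"
    unfolding orbit_poly_def by (subst degree_prod_eq_sum_degree) auto
  ultimately show ?thesis by (simp add: monics_def)
qed

lemma poly_orbit_poly:
  fixes x a :: "'a::field"
  assumes q: "prime CHAR('a)" and a: "a \<in> prime_subfield"
  shows "poly (orbit_poly j x) a = (a - x) ^ (\<Sum>i<j. CHAR('a) ^ i)"
proof -
  have "poly (orbit_poly j x) a = (\<Prod>i<j. a ^ (CHAR('a) ^ i) - x ^ (CHAR('a) ^ i))"
    using prime_subfield_power[OF a] by (simp add: orbit_poly_def poly_prod)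
  also have "\<dots> = (a - x) ^ (\<Sum>i<j. CHAR('a) ^ i)"
    by (simp add: power_sum diff_frobenius_power[OF q])
  finally show ?thesis .
qed

lemma prod_linear_powers_dvd:
  fixes g :: "'a::field poly"
  assumes "finite O'" "g \<noteq> 0" "\<And>y. y \<in> O' \<Longrightarrow> [:-y, 1:] ^ k dvd g"
  shows "(\<Prod>y\<in>O'. [:-y, 1:] ^ k) dvd g"
  using assms(1,3)
proof (induction O' rule: finite_induct)
  case (insert y O')
  then obtain h where h: "g = (\<Prod>y\<in>O'. [:-y, 1:] ^ k) * h" by (auto elim: dvdE)
  have nz: "(\<Prod>y\<in>O'. [:-y, 1:] ^ k) \<noteq> 0" "h \<noteq> 0" using h assms(2) by auto
  have "poly (\<Prod>y\<in>O'. [:-y, 1:] ^ k) y \<noteq> 0"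
    using insert by (auto simp: poly_prod)
  then have "order y (\<Prod>y\<in>O'. [:-y, 1:] ^ k) = 0" by (simp add: order_root)
  moreover have "k \<le> order y g" using insert.prems assms(2) by (simp add: order_divides)
  ultimately have "k \<le> order y h" using nz by (simp add: h order_mult)
  then have "[:-y, 1:] ^ k dvd h" using nz by (simp add: order_divides)
  then show ?case using insert h by (simp add: mult_dvd_mono mult.commute)
qed simp

text \<open>Frobenius fixes \<open>g\<close> and carries the multiplicity of \<open>x\<close> to
  every point of its orbit, so divisibility by a power of the minimal polynomial can be read off at
  \<open>x\<close> alone.\<close>

lemma card_orbit_poly_dvd:
  fixes g :: "'a::field poly"
  assumes q: "prime CHAR('a)" and g: "g \<in> monics n" and x: "poly g x = 0"
  shows "card {j \<in> {1..n}. x ^ (CHAR('a) ^ j) = x \<and> orbit_poly j x dvd g} = order x g"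
proof -
  define p where "p = CHAR('a)"
  define \<phi> where "\<phi> = (\<lambda>i. x ^ (p ^ i))"
  have g0: "g \<noteq> 0" and fg: "frobenius_poly g = g" and dg: "degree g = n" using g by (auto simp: monics_def)
  have \<phi>_add: "\<phi> (i + j) = \<phi> i ^ (p ^ j)" for i j by (simp add: \<phi>_def power_add power_mult)
  have inj: "u = v" if "u ^ (p ^ i) = v ^ (p ^ i)" for u v :: 'a and i
    using that diff_frobenius_power[OF q, of u v i] by (simp add: p_def)
  have dvd: "[:- \<phi> i, 1:] ^ k dvd g" if "[:-x, 1:] ^ k dvd g" for i k
  proof (induction i)
    case 0
    then show ?case using that by (simp add: \<phi>_def)
  next
    case (Suc i)
    then obtain h where "g = [:- \<phi> i, 1:] ^ k * h" by (elim dvdE)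
    then have "frobenius_poly g = [:- (\<phi> i ^ p), 1:] ^ k * frobenius_poly h"
      by (simp only: frobenius_poly_mult[OF q] frobenius_poly_power[OF q] frobenius_poly_linear[OF q] p_def)
    moreover have "\<phi> i ^ p = \<phi> (Suc i)" using \<phi>_add[of i 1] by simp
    ultimately show ?case unfolding fg by (metis dvd_triv_left)
  qed
  \<comment> \<open>The orbit consists of zeros of \<open>g\<close> and is therefore finite. Since
    Frobenius is injective, a repetition in the orbit can be pulled back to a return to
    \<open>x\<close>.\<close>
  have "\<phi> i \<in> {y. poly g y = 0}" for i
    using dvd[of 1 i] x by (simp add: poly_eq_0_iff_dvd)
  then have "finite (range \<phi>)"
    using poly_roots_finite[OF g0] by (meson finite_subset image_subsetI)
  then have "\<not> inj \<phi>" using finite_imageD infinite_UNIV_nat by blast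
  then obtain i k where "i < k" "\<phi> i = \<phi> k" unfolding inj_def by (metis linorder_neqE_nat)
  then have "x ^ (p ^ i) = (x ^ (p ^ (k - i))) ^ (p ^ i)" using \<phi>_add[of "k - i" i] by (simp add: \<phi>_def)
  then have "\<phi> (k - i) = x" using inj by (metis \<phi>_def)
  then have ex: "\<exists>e>0. \<phi> e = x" using \<open>i < k\<close> by (intro exI[of _ "k - i"]) simp
  define e where "e = (LEAST e. e > 0 \<and> \<phi> e = x)"
  have e: "e > 0" "\<phi> e = x" using LeastI_ex[OF ex] by (simp_all add: e_def)
  have least: "e \<le> j" if "j > 0" "\<phi> j = x" for j unfolding e_def using that by (intro Least_le) simp
  have per: "\<phi> (m * e + i) = \<phi> i" for m i
  proof (induction m)
    case (Suc m)
    have "\<phi> (Suc m * e + i) = \<phi> (e + (m * e + i))" by (simp add: add.assoc)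
    also have "\<dots> = \<phi> (m * e + i)" by (simp only: \<phi>_add[of e "m * e + i"] e(2)) (simp only: \<phi>_def)
    finally show ?case using Suc by simp
  qed simp
  have per_iff: "\<phi> j = x \<longleftrightarrow> e dvd j" for j
  proof
    assume "\<phi> j = x"
    then have "\<phi> (j mod e) = x" using per[of "j div e" "j mod e"] by simp
    then have "j mod e = 0" using least[of "j mod e"] e(1) by (metis gr0I leD mod_less_divisor)
    then show "e dvd j" by auto
  next
    assume "e dvd j"
    then show "\<phi> j = x" using per[of "j div e" 0] by (simp add: \<phi>_def)
  qed
  have neq: "\<phi> i \<noteq> \<phi> k" if ik: "i < k" "k < e" for i k
  proof
    assume "\<phi> i = \<phi> k"
    then have "x ^ (p ^ i) = (x ^ (p ^ (k - i))) ^ (p ^ i)" using \<phi>_add[of "k - i" i] ik by (simp add: \<phi>_def)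
    then have "\<phi> (k - i) = x" using inj by (metis \<phi>_def)
    then show False using least[of "k - i"] ik by simp
  qed
  have inj_e: "inj_on \<phi> {..<e}"
    by (intro inj_onI) (metis lessThan_iff linorder_neqE_nat neq)
  have orb: "orbit_poly (m * e) x = (\<Prod>y\<in>\<phi> ` {..<e}. [:-y, 1:] ^ m)" for m
  proof -
    have "orbit_poly (m * e) x = (\<Prod>u<m. \<Prod>i\<in>{u * e..<u * e + e}. [:- \<phi> i, 1:])"
      by (simp add: orbit_poly_def prod.nat_group \<phi>_def p_def)
    also have "\<dots> = (\<Prod>u<m. \<Prod>i<e. [:- \<phi> i, 1:])"
    proof (rule prod.cong[OF refl])
      fix u
      have "(\<Prod>i\<in>{u * e..<u * e + e}. [:- \<phi> i, 1:]) = (\<Prod>i<e. [:- \<phi> (u * e + i), 1:])"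
        by (intro prod.reindex_bij_witness[of _ "\<lambda>i. u * e + i" "\<lambda>i. i - u * e"]) auto
      then show "(\<Prod>i\<in>{u * e..<u * e + e}. [:- \<phi> i, 1:]) = (\<Prod>i<e. [:- \<phi> i, 1:])" by (simp add: per)
    qed
    also have "\<dots> = (\<Prod>y\<in>\<phi> ` {..<e}. [:-y, 1:]) ^ m"
      by (simp add: prod.reindex[OF inj_e])
    also have "\<dots> = (\<Prod>y\<in>\<phi> ` {..<e}. [:-y, 1:] ^ m)" by (rule prod_power_distrib)
    finally show ?thesis .
  qed
  have iff: "orbit_poly (m * e) x dvd g \<longleftrightarrow> m \<le> order x g" for m
  proof
    assume "orbit_poly (m * e) x dvd g"
    moreover have "[:-x, 1:] ^ m dvd orbit_poly (m * e) x"
      unfolding orb using e by (intro dvd_prodI) (auto intro!: image_eqI[of _ _ 0] simp: \<phi>_def)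
    ultimately show "m \<le> order x g" using g0 by (metis dvd_trans order_divides)
  next
    assume "m \<le> order x g"
    then have "[:-x, 1:] ^ m dvd g" by (simp add: order_divides)
    then show "orbit_poly (m * e) x dvd g"
      unfolding orb using dvd g0 by (intro prod_linear_powers_dvd) auto
  qed
  have "{j \<in> {1..n}. x ^ (CHAR('a) ^ j) = x \<and> orbit_poly j x dvd g} = (\<lambda>m. m * e) ` {1..order x g}"
  proof (intro equalityI subsetI)
    fix j assume "j \<in> {j \<in> {1..n}. x ^ (CHAR('a) ^ j) = x \<and> orbit_poly j x dvd g}"
    then have j: "1 \<le> j" "e dvd j" "orbit_poly j x dvd g" using per_iff[of j] by (auto simp: \<phi>_def p_def)
    then obtain m where m: "j = m * e" by (metis dvd_def mult.commute)
    then show "j \<in> (\<lambda>m. m * e) ` {1..order x g}" using j iff[of m] by (auto simp: Suc_le_eq)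
  next
    fix j assume "j \<in> (\<lambda>m. m * e) ` {1..order x g}"
    then obtain m where "j = m * e" "m \<in> {1..order x g}" by blast
    then have m: "j = m * e" "1 \<le> m" "m \<le> order x g" by simp_all
    have fx: "x ^ (CHAR('a) ^ j) = x" using per_iff[of j] m by (simp add: \<phi>_def p_def)
    have dv: "orbit_poly j x dvd g" using iff m by simp
    have "degree (orbit_poly j x) = j" using orbit_poly_monics[OF q fx] by (simp add: monics_def)
    then have "j \<le> n" using dvd_imp_degree_le[OF dv g0] dg by simp
    then show "j \<in> {j \<in> {1..n}. x ^ (CHAR('a) ^ j) = x \<and> orbit_poly j x dvd g}"
      using m e fx dv by (simp add: Suc_le_eq)
  qed
  moreover have "inj_on (\<lambda>m. m * e) {1..order x g}" using e by (auto intro: inj_onI)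
  ultimately show ?thesis by (simp add: card_image)
qed

section \<open>The L-function and Newton's identities\<close>

text \<open>A root \<open>x\<close> of \<open>g\<close> with minimal polynomial \<open>p\<close> of degree \<open>e\<close> contributes to \<open>j = k e\<close>, where \<open>orbit_poly j x = p ^ k\<close>,
  exactly for \<open>1 \<le> k \<le> order x g\<close>.\<close>
lemma card_orbit_pairs:
  fixes g :: "'a::alg_closed_field poly"
  assumes q: "prime CHAR('a)" and g: "g \<in> monics n"
  shows "(\<Sum>j\<in>{1..n}. card {x. x ^ (CHAR('a) ^ j) = x \<and> orbit_poly j x dvd g}) = n"
proof -
  define P where "P = (\<lambda>j x. x ^ (CHAR('a) ^ j) = x \<and> orbit_poly j x dvd g)"
  define Z where "Z = {x. poly g x = 0}"
  have g0: "g \<noteq> 0" "degree g = n" using g by (auto simp: monics_def)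
  have Z: "finite Z" using poly_roots_finite[OF g0(1)] by (simp add: Z_def)
  have sub: "x \<in> Z" if "j \<in> {1..n}" "P j x" for j x
  proof -
    have "poly (orbit_poly j x) x = 0"
      using that(1) by (auto simp: orbit_poly_def poly_prod intro!: bexI[of _ 0])
    then show ?thesis using that(2) by (auto simp: P_def Z_def elim!: dvdE)
  qed
  have "(\<Sum>j\<in>{1..n}. card {x. P j x}) = (\<Sum>j\<in>{1..n}. \<Sum>x\<in>Z. if P j x then 1 else 0)"
  proof (intro sum.cong refl)
    fix j assume "j \<in> {1..n}"
    then have "{x. P j x} = {x \<in> Z. P j x}" using sub by auto
    then show "card {x. P j x} = (\<Sum>x\<in>Z. if P j x then 1 else 0)" using Z by (simp add: sum.If_cases Int_def)
  qed
  also have "\<dots> = (\<Sum>x\<in>Z. \<Sum>j\<in>{1..n}. if P j x then 1 else 0)" by (rule sum.swap)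
  also have "\<dots> = (\<Sum>x\<in>Z. card {j \<in> {1..n}. P j x})" by (simp add: sum.If_cases Int_def)
  also have "\<dots> = (\<Sum>x\<in>Z. order x g)"
    using card_orbit_poly_dvd[OF q g] by (intro sum.cong refl) (simp add: P_def Z_def)
  also have "\<dots> = size (proots g)"
    using g0 by (simp add: size_multiset_overloaded_eq set_count_proots Z_def)
  also have "\<dots> = n" using g0 by (simp add: size_proots_alg_closed)
  finally show ?thesis by (simp add: P_def)
qed

text \<open>\<open>\<psi>\<close> models a nonprincipal Dirichlet character carried over to the
  prime subfield; \<open>a0\<close> is the point whose linear factor occurs exactly once.\<close>

locale character_tuple =
  fixes A :: "'a::alg_closed_field set" and e :: "'a \<Rightarrow> nat" and a0 :: 'a and \<psi> :: "'a \<Rightarrow> complex"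
  assumes q: "prime CHAR('a)"
    and A: "A \<subseteq> prime_subfield" "a0 \<in> A" and e: "e a0 = 1"
    and psi_mult: "\<And>x y. x \<in> prime_subfield \<Longrightarrow> y \<in> prime_subfield \<Longrightarrow> \<psi> (x * y) = \<psi> x * \<psi> y"
    and psi_0: "\<psi> 0 = 0" and psi_1: "\<psi> 1 = 1" and psi_le: "\<And>c. c \<in> prime_subfield \<Longrightarrow> norm (\<psi> c) \<le> 1"
    and psi_sum: "(\<Sum>c\<in>prime_subfield. \<psi> c) = 0"
begin

lemma finite_A: "finite A"
  using A card_prime_subfield(2)[OF q] finite_subset by blast

text \<open>A multiplicative function on polynomials over the prime field that depends only on
  \<open>g\<close> modulo the product of the \<open>X - a\<close>; the numbers \<open>c n\<close>
  are the coefficients of its L-function.\<close>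

definition \<Psi> :: "'a poly \<Rightarrow> complex" where
  "\<Psi> g = \<psi> (\<Prod>a\<in>A. poly g a ^ e a)"

text \<open>The factors are \<open>a - X\<close>, not \<open>X - a\<close>, to agree with the value
  of the orbit polynomial at \<open>a\<close>, which is the norm of \<open>a - x\<close>; otherwise
  signs would enter \<open>Psi_orbit_poly\<close>.\<close>

definition f :: "'a poly" where
  "f = (\<Prod>a\<in>A. [:a, -1:] ^ e a)"

definition c :: "nat \<Rightarrow> complex" where
  "c n = (\<Sum>g\<in>monics n. \<Psi> g)"

definition S :: "nat \<Rightarrow> complex" where
  "S n = (\<Sum>x | x ^ (CHAR('a) ^ n) = x. \<psi> (poly f x ^ (\<Sum>i<n. CHAR('a) ^ i)))"

lemma power_in_prime_subfield: "x \<in> prime_subfield \<Longrightarrow> (x::'a) ^ n \<in> prime_subfield"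
  by (induction n) (auto intro: prime_subfield_closed[OF q])

lemma prod_in_prime_subfield: "(\<And>a. a \<in> B \<Longrightarrow> h a \<in> prime_subfield) \<Longrightarrow> (\<Prod>a\<in>B. h a :: 'a) \<in> prime_subfield"
  by (induction B rule: infinite_finite_induct) (auto intro: prime_subfield_closed[OF q])

lemma Psi_mult:
  assumes "frobenius_poly g = g" "frobenius_poly h = h"
  shows "\<Psi> (g * h) = \<Psi> g * \<Psi> h"
  unfolding \<Psi>_def poly_mult power_mult_distrib prod.distrib
  using assms A by (intro psi_mult prod_in_prime_subfield power_in_prime_subfield poly_monics_in_prime_subfield q) auto

lemma c_0: "c 0 = 1"
  using psi_1 by (simp add: c_def monics_0[OF q] \<Psi>_def)

lemma frobenius_poly_smult:
  assumes "(t::'a) \<in> prime_subfield" "frobenius_poly g = g"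
  shows "frobenius_poly (smult t g) = smult t g"
  using assms unfolding frobenius_poly_fixed_iff[OF q] by (simp add: prime_subfield_closed(4)[OF q])

text \<open>Adding multiples of \<open>E\<close>, which vanishes on \<open>A - {a0}\<close>, moves only the value at \<open>a0\<close>, and \<open>\<psi>\<close> sums to zero.\<close>
lemma c_eq_0:
  assumes n: "card A \<le> n"
  shows "c n = 0"
proof -
  define E where "E = (\<Prod>b\<in>A-{a0}. [:-b, 1:])"
  define U where "U = (prime_subfield :: 'a set)"
  have "degree E = card (A - {a0})" unfolding E_def by (subst degree_prod_eq_sum_degree) auto
  also have "\<dots> < card A" using A finite_A by (intro psubset_card_mono) auto
  finally have degE: "degree E < n" using n by simp
  have "frobenius_poly [:-b, 1:] = [:-b, 1:]" if "b \<in> A" for b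
    using A that by (subst frobenius_poly_linear[OF q]) (auto simp: prime_subfield_def)
  then have fE: "frobenius_poly E = E" by (simp add: E_def frobenius_poly_prod[OF q])
  have Ea0: "poly E a0 \<noteq> 0" using finite_A by (auto simp: E_def poly_prod)
  have Eb: "poly E b = 0" if "b \<in> A" "b \<noteq> a0" for b using finite_A that by (auto simp: E_def poly_prod)
  have shift: "g + smult t E \<in> monics n" if "t \<in> U" "g \<in> monics n" for t g
  proof -
    have d: "degree (smult t E) < degree g" using degE that degree_smult_le[of t E] by (auto simp: monics_def)
    show ?thesis
      using that d fE frobenius_poly_smult[of t E] coeff_eq_0[OF degE]
      by (auto simp: monics_def U_def degree_add_eq_left coeff_eq_0 frobenius_poly_add[OF q])
  qed
  have c_shift: "c n = (\<Sum>g\<in>monics n. \<Psi> (g + smult t E))" if t: "t \<in> U" for t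
  proof -
    have mt: "- t \<in> U" using t prime_subfield_closed(1)[OF q] prime_subfield_closed(5)[OF q, of 0 t] by (simp add: U_def)
    show ?thesis unfolding c_def
      using shift[OF t] shift[OF mt]
      by (intro sum.reindex_bij_witness[of _ "\<lambda>g. g + smult t E" "\<lambda>g. g + smult (- t) E"]) auto
  qed
  have "of_nat (card U) * c n = (\<Sum>t\<in>U. c n)" by simp
  also have "\<dots> = (\<Sum>t\<in>U. \<Sum>g\<in>monics n. \<Psi> (g + smult t E))"
    by (intro sum.cong refl c_shift)
  also have "\<dots> = (\<Sum>g\<in>monics n. \<Sum>t\<in>U. \<Psi> (g + smult t E))" by (rule sum.swap)
  also have "\<dots> = 0"
  proof (rule sum.neutral, rule ballI)
    fix g :: "'a poly" assume g: "g \<in> monics n"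
    have gU: "poly g b \<in> U" if "b \<in> A" for b
      using g A that poly_monics_in_prime_subfield[OF q] by (auto simp: monics_def U_def)
    have EU: "poly E a0 \<in> U" using poly_monics_in_prime_subfield[OF q fE] A by (auto simp: U_def)
    define w where "w = (\<Prod>b\<in>A-{a0}. poly g b ^ e b)"
    have wU: "w \<in> U" using gU unfolding w_def U_def
      by (intro prod_in_prime_subfield power_in_prime_subfield) auto
    have cl: "x + y \<in> U" "x * y \<in> U" "x - y \<in> U" if "x \<in> U" "y \<in> U" for x y
      using prime_subfield_closed[OF q] that by (auto simp: U_def)
    have "\<Psi> (g + smult t E) = \<psi> (poly g a0 + t * poly E a0) * \<psi> w" if t: "t \<in> U" for t
    proof -
      have "(\<Prod>a\<in>A. poly (g + smult t E) a ^ e a) = poly (g + smult t E) a0 ^ e a0 * (\<Prod>a\<in>A-{a0}. poly (g + smult t E) a ^ e a)"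
        using A finite_A by (intro prod.remove)
      also have "(\<Prod>a\<in>A-{a0}. poly (g + smult t E) a ^ e a) = w"
        unfolding w_def by (intro prod.cong refl) (simp add: Eb)
      finally show ?thesis
        unfolding \<Psi>_def using psi_mult cl gU[OF A(2)] EU t wU by (simp add: e U_def)
    qed
    then have "(\<Sum>t\<in>U. \<Psi> (g + smult t E)) = (\<Sum>t\<in>U. \<psi> (poly g a0 + t * poly E a0)) * \<psi> w"
      by (simp add: sum_distrib_right)
    also have "(\<Sum>t\<in>U. \<psi> (poly g a0 + t * poly E a0)) = (\<Sum>s\<in>U. \<psi> s)"
    proof (rule sum.reindex_bij_betw[of "\<lambda>t. poly g a0 + t * poly E a0" U U])
      have fin: "finite U" using card_prime_subfield(2)[OF q] by (simp add: U_def)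
      have "inj_on (\<lambda>t. poly g a0 + t * poly E a0) U" using Ea0 by (auto intro: inj_onI)
      moreover have "(\<lambda>t. poly g a0 + t * poly E a0) ` U \<subseteq> U" using cl gU[OF A(2)] EU by auto
      ultimately show "bij_betw (\<lambda>t. poly g a0 + t * poly E a0) U U"
        using fin by (simp add: bij_betw_def endo_inj_surj)
    qed
    finally show "(\<Sum>t\<in>U. \<Psi> (g + smult t E)) = 0" using psi_sum by (simp add: U_def)
  qed
  finally show ?thesis using card_prime_subfield(1)[OF q] prime_gt_0_nat[OF q] by (simp add: U_def)
qed

lemma Psi_orbit_poly: "\<Psi> (orbit_poly j x) = \<psi> (poly f x ^ (\<Sum>i<j. CHAR('a) ^ i))"
proof -
  have "(\<Prod>a\<in>A. poly (orbit_poly j x) a ^ e a) = (\<Prod>a\<in>A. ((a - x) ^ (\<Sum>i<j. CHAR('a) ^ i)) ^ e a)"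
    using A by (intro prod.cong refl) (auto simp: poly_orbit_poly[OF q])
  also have "\<dots> = poly f x ^ (\<Sum>i<j. CHAR('a) ^ i)"
    by (simp add: f_def poly_prod prod_power_distrib mult.commute flip: power_mult)
  finally show ?thesis by (simp add: \<Psi>_def)
qed

text \<open>Double counting: by \<open>card_orbit_pairs\<close> the factor \<open>n\<close> is the
  number of pairs \<open>(j, x)\<close> whose orbit polynomial divides \<open>g\<close>. For a fixed
  pair the multiples \<open>g\<close> are the orbit polynomial times a monic polynomial of degree
  \<open>n - j\<close>, and \<open>\<Psi>\<close> splits over this product.\<close>

lemma newton_identity: "of_nat n * c n = (\<Sum>j\<in>{1..n}. S j * c (n - j))"
proof -
  have fin: "finite {x::'a. x ^ (CHAR('a) ^ j) = x}" if "j \<in> {1..n}" for j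
    using card_frobenius_fixed(2)[OF q refl] that by auto
  have "of_nat n * c n = (\<Sum>g\<in>monics n. \<Psi> g * of_nat (\<Sum>j\<in>{1..n}. card {x. x ^ (CHAR('a) ^ j) = x \<and> orbit_poly j x dvd g}))"
    unfolding c_def sum_distrib_left by (intro sum.cong refl) (subst card_orbit_pairs[OF q], auto)
  also have "\<dots> = (\<Sum>g\<in>monics n. \<Sum>j\<in>{1..n}. \<Sum>x | x ^ (CHAR('a) ^ j) = x. if orbit_poly j x dvd g then \<Psi> g else 0)"
    using fin by (intro sum.cong refl) (simp add: sum_distrib_left sum.If_cases Int_def mult.commute)
  also have "\<dots> = (\<Sum>j\<in>{1..n}. \<Sum>x | x ^ (CHAR('a) ^ j) = x. \<Sum>g\<in>monics n. if orbit_poly j x dvd g then \<Psi> g else 0)"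
    by (subst sum.swap) (intro sum.cong refl sum.swap)
  also have "\<dots> = (\<Sum>j\<in>{1..n}. \<Sum>x | x ^ (CHAR('a) ^ j) = x. \<Psi> (orbit_poly j x) * c (n - j))"
  proof (intro sum.cong refl)
    fix j x assume j: "j \<in> {1..n}" and "x \<in> {x::'a. x ^ (CHAR('a) ^ j) = x}"
    then have P: "orbit_poly j x \<in> monics j" using orbit_poly_monics[OF q] by auto
    then have P0: "orbit_poly j x \<noteq> 0" by (auto simp: monics_def)
    have "(\<Sum>g\<in>monics n. if orbit_poly j x dvd g then \<Psi> g else 0) = (\<Sum>g\<in>{g \<in> monics n. orbit_poly j x dvd g}. \<Psi> g)"
      using finite_monics[OF q] by (intro sum.inter_filter[symmetric])
    also have "{g \<in> monics n. orbit_poly j x dvd g} = (\<lambda>h. orbit_poly j x * h) ` monics (n - j)"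
    proof (intro equalityI subsetI)
      fix g assume "g \<in> {g \<in> monics n. orbit_poly j x dvd g}"
      then obtain h where "g = orbit_poly j x * h" "orbit_poly j x * h \<in> monics n"
        unfolding dvd_def by blast
      then show "g \<in> (\<lambda>h. orbit_poly j x * h) ` monics (n - j)"
        using monics_mult_cancel(2)[OF q P] by auto
    next
      fix g assume "g \<in> (\<lambda>h. orbit_poly j x * h) ` monics (n - j)"
      then show "g \<in> {g \<in> monics n. orbit_poly j x dvd g}"
        using monics_mult[OF q P, of _ "n - j"] j by auto
    qed
    also have "(\<Sum>g\<in>(\<lambda>h. orbit_poly j x * h) ` monics (n - j). \<Psi> g) = (\<Sum>h\<in>monics (n - j). \<Psi> (orbit_poly j x * h))"
      using P0 by (subst sum.reindex) (auto intro: inj_onI)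
    also have "\<dots> = \<Psi> (orbit_poly j x) * c (n - j)"
      using P by (simp add: c_def sum_distrib_left Psi_mult monics_def)
    finally show "(\<Sum>g\<in>monics n. if orbit_poly j x dvd g then \<Psi> g else 0) = \<Psi> (orbit_poly j x) * c (n - j)" .
  qed
  also have "\<dots> = (\<Sum>j\<in>{1..n}. S j * c (n - j))"
    by (simp add: S_def Psi_orbit_poly sum_distrib_right)
  finally show ?thesis .
qed

lemma S_bound:
  obtains C n0 where "C \<ge> 0" "\<And>n. n \<ge> n0 \<Longrightarrow> norm (S n) \<le> C * sqrt (real CHAR('a)) ^ n"
proof -
  \<comment> \<open>The sign turns \<open>a0 - X\<close> into the monic factor \<open>X - a0\<close>
    required by \<open>norm_character_sum_bound\<close>.\<close>
  define f1 where "f1 = - (\<Prod>a\<in>A-{a0}. [:a, -1:] ^ e a)"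
  have "f = [:a0, -1:] * (\<Prod>a\<in>A-{a0}. [:a, -1:] ^ e a)"
    unfolding f_def using A finite_A by (subst prod.remove[of _ a0]) (auto simp: e)
  also have "[:a0, -1:] = - [:-a0, 1:]" by simp
  finally have f: "f = [:-a0, 1:] * f1" by (simp only: f1_def minus_mult_minus minus_mult_commute mult_minus_left mult_minus_right)
  have f1: "poly f1 a0 \<noteq> 0" using finite_A by (auto simp: f1_def poly_prod)
  have fx: "poly f x ^ (CHAR('a) ^ n) = poly f x" if "x ^ (CHAR('a) ^ n) = x" for n x
  proof -
    have "poly f x ^ (CHAR('a) ^ n) = (\<Prod>a\<in>A. ((a - x) ^ (CHAR('a) ^ n)) ^ e a)"
      by (simp add: f_def poly_prod prod_power_distrib mult.commute flip: power_mult)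
    also have "\<dots> = (\<Prod>a\<in>A. (a - x) ^ e a)"
      using that A prime_subfield_power[where 'a = 'a] by (intro prod.cong refl) (auto simp: diff_frobenius_power[OF q])
    finally show ?thesis by (simp add: f_def poly_prod)
  qed
  obtain C n0 where "C \<ge> 0" "\<And>n. n \<ge> n0 \<Longrightarrow>
    norm (\<Sum>x | x ^ (CHAR('a) ^ n) = x. \<psi> (poly f x ^ (\<Sum>i<n. CHAR('a) ^ i))) \<le> C * sqrt (real (CHAR('a) ^ n))"
    using norm_character_sum_bound[OF q refl _ f f1 fx psi_0 psi_le psi_sum] A by blast
  then show ?thesis by (intro that[of C n0]) (simp_all add: S_def real_sqrt_power)
qed

end

text \<open>The logarithmic derivative at 0. It expresses the first power sum of the inverse zeros
  by the two lowest coefficients.\<close>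

lemma coeff_1_prod_mset_linear:
  fixes R :: "complex multiset"
  assumes "0 \<notin># R"
  shows "coeff (\<Prod>x\<in>#R. [:-x, 1:]) 1 = - (\<Sum>x\<in>#R. 1 / x) * coeff (\<Prod>x\<in>#R. [:-x, 1:]) 0"
  using assms
proof (induction R)
  case (add x R)
  have step: "coeff ([:-x, 1:] * p) 1 = coeff p 0 - x * coeff p 1" "coeff ([:-x, 1:] * p) 0 = - x * coeff p 0" for p
    by (simp_all add: mult_pCons_left)
  have "x \<noteq> 0" and IH: "coeff (\<Prod>x\<in>#R. [:-x, 1:]) 1
      = - (\<Sum>x\<in>#R. 1 / x) * coeff (\<Prod>x\<in>#R. [:-x, 1:]) 0"
    using add by auto
  then show ?case
    unfolding image_mset_add_mset prod_mset.add_mset sum_mset.add_mset step IH by (simp add: algebra_simps)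
qed simp

text \<open>With \<open>L\<close> and \<open>\<sigma>\<close> the generating functions of \<open>c\<close> and \<open>s\<close>, the recurrence says \<open>z L' = \<sigma> L\<close>.  A root \<open>\<rho>\<close>
  of \<open>L\<close> inside the disc of convergence of \<open>\<sigma>\<close> would have a smaller multiplicity on the left
  than on the right.\<close>
lemma newton_identity_bound:
  fixes c s :: "nat \<Rightarrow> complex" and B C :: real
  assumes c0: "c 0 = 1" and ck: "\<And>n. n \<ge> k \<Longrightarrow> c n = 0"
    and newton: "\<And>n. of_nat n * c n = (\<Sum>j\<in>{1..n}. s j * c (n - j))"
    and bound: "\<And>n. n \<ge> n0 \<Longrightarrow> norm (s n) \<le> C * B ^ n" and B: "B > 0"
  shows "norm (s 1) \<le> real k * B"
proof -
  define L where "L = (\<Sum>n<k. monom (c n) n)"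
  have coeffL: "coeff L n = c n" for n
    using ck[of n] by (auto simp: L_def coeff_sum)
  have L0: "L \<noteq> 0" using coeffL[of 0] c0 by auto
  \<comment> \<open>The recurrence starts at \<open>j = 1\<close>, so \<open>s 0\<close> must not
    enter the series.\<close>
  define a where "a = (\<lambda>n. if n = 0 then 0 else s n)"
  define \<sigma> where "\<sigma> = (\<lambda>z. \<Sum>n. a n * z ^ n)"
  have summ: "summable (\<lambda>n. norm (a n * z ^ n))" if z: "norm z < 1 / B" for z
  proof (rule summable_comparison_test_ev)
    have "norm (norm (a n * z ^ n)) \<le> C * (B * norm z) ^ n" if "n \<ge> max n0 1" for n
    proof -
      have "norm (a n) * norm z ^ n \<le> C * B ^ n * norm z ^ n"
        using bound[of n] that by (intro mult_right_mono) (auto simp: a_def)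
      then show ?thesis by (simp add: norm_mult norm_power power_mult_distrib mult.assoc)
    qed
    then show "eventually (\<lambda>n. norm (norm (a n * z ^ n)) \<le> C * (B * norm z) ^ n) sequentially"
      unfolding eventually_sequentially by blast
    have "B * norm z < 1" using z B by (simp add: field_simps)
    then show "summable (\<lambda>n. C * (B * norm z) ^ n)"
      using B by (intro summable_mult summable_geometric) (simp add: abs_mult)
  qed
  have polysums: "(\<lambda>n. coeff p n * z ^ n) sums poly p z" for p :: "complex poly" and z
    unfolding poly_altdef by (rule sums_finite) (auto simp: coeff_eq_0)
  have eq: "z * poly (pderiv L) z = \<sigma> z * poly L z" if z: "norm z < 1 / B" for z
  proof -
    have nL: "summable (\<lambda>n. norm (coeff L n * z ^ n))"
      by (rule summable_finite[of "{..<k}"]) (auto simp: coeffL ck)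
    have "(\<lambda>n. \<Sum>i\<le>n. (a i * z ^ i) * (coeff L (n - i) * z ^ (n - i))) sums (\<sigma> z * (\<Sum>n. coeff L n * z ^ n))"
      unfolding \<sigma>_def by (rule Cauchy_product_sums[OF summ[OF z] nL])
    also have "(\<Sum>n. coeff L n * z ^ n) = poly L z"
      using polysums[of L z] by (simp add: sums_iff)
    also have "(\<lambda>n. \<Sum>i\<le>n. (a i * z ^ i) * (coeff L (n - i) * z ^ (n - i))) = (\<lambda>n. coeff (pCons 0 (pderiv L)) n * z ^ n)"
    proof
      fix n
      have "(\<Sum>i\<le>n. (a i * z ^ i) * (coeff L (n - i) * z ^ (n - i))) = (\<Sum>i\<le>n. a i * c (n - i)) * z ^ n"
        unfolding sum_distrib_right by (intro sum.cong refl) (simp add: coeffL flip: power_add)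
      also have "(\<Sum>i\<le>n. a i * c (n - i)) = (\<Sum>i\<in>{1..n}. s i * c (n - i))"
        by (intro sum.mono_neutral_cong_right) (auto simp: a_def)
      also have "\<dots> = coeff (pCons 0 (pderiv L)) n"
        unfolding newton[symmetric] by (cases n) (simp_all add: coeff_pderiv coeffL)
      finally show "(\<Sum>i\<le>n. (a i * z ^ i) * (coeff L (n - i) * z ^ (n - i))) = coeff (pCons 0 (pderiv L)) n * z ^ n" .
    qed
    finally have "(\<lambda>n. coeff (pCons 0 (pderiv L)) n * z ^ n) sums (\<sigma> z * poly L z)" .
    with polysums[of "pCons 0 (pderiv L)" z] have "poly (pCons 0 (pderiv L)) z = \<sigma> z * poly L z"
      by (rule sums_unique2)
    then show ?thesis by simp
  qed
  have roots: "norm \<rho> \<ge> 1 / B" if \<rho>: "poly L \<rho> = 0" for \<rho>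
  proof (rule ccontr)
    assume "\<not> norm \<rho> \<ge> 1 / B"
    then have small: "norm \<rho> < 1 / B" by simp
    have \<rho>0: "\<rho> \<noteq> 0" using \<rho> coeffL[of 0] c0 by (auto simp: poly_0_coeff_0)
    obtain L2 where L2: "L = [:-\<rho>, 1:] ^ order \<rho> L * L2" "\<not> [:-\<rho>, 1:] dvd L2"
      using order_decomp[OF L0] by blast
    obtain m where m: "order \<rho> L = Suc m" using \<rho> L0 by (metis not0_implies_Suc order_root)
    \<comment> \<open>The derivative of \<open>L\<close> divided by \<open>(X - \<rho>) ^ m\<close>.
      At \<open>\<rho>\<close> it takes the value \<open>Suc m * L2\<close>, which is nonzero
      because \<open>L2\<close> does not vanish there.\<close>
    define W where "W = smult (of_nat (Suc m)) L2 + [:-\<rho>, 1:] * pderiv L2"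
    have LS: "L = [:-\<rho>, 1:] ^ Suc m * L2" using L2(1) unfolding m .
    have L: "L = [:-\<rho>, 1:] ^ m * ([:-\<rho>, 1:] * L2)" using LS unfolding power_Suc2 mult.assoc .
    have "pderiv L = [:-\<rho>, 1:] ^ Suc m * pderiv L2 + pderiv ([:-\<rho>, 1:] ^ Suc m) * L2"
      by (subst LS) (simp only: pderiv_mult mult.commute add.commute)
    also have "pderiv ([:-\<rho>, 1:] ^ Suc m) = smult (of_nat (Suc m)) ([:-\<rho>, 1:] ^ m)"
      by (simp only: pderiv_power_Suc) (simp add: pderiv_pCons)
    finally have dL: "pderiv L = [:-\<rho>, 1:] ^ m * W"
      unfolding W_def by (simp add: algebra_simps)
    have "isCont \<sigma> \<rho>"
    proof -
      obtain K where K: "norm \<rho> < K" "K < 1 / B" using dense[OF small] by blast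
      then have "0 < K" using norm_ge_zero[of \<rho>] by linarith
      then have K0: "norm (complex_of_real K) = K" using norm_ge_zero[of \<rho>] by (simp add: abs_of_nonneg)
      have "summable (\<lambda>n. a n * complex_of_real K ^ n)"
        using summ[of "of_real K"] K K0 by (simp add: summable_norm_cancel)
      then show ?thesis unfolding \<sigma>_def using K K0 by (intro isCont_powser[of a "of_real K"]) auto
    qed
    \<comment> \<open>The factor \<open>(z - \<rho>) ^ m\<close> can be cancelled only for
      \<open>z \<noteq> \<rho>\<close>, so the identity at \<open>\<rho>\<close> is obtained as a
      limit; this needs the continuity of \<open>\<sigma>\<close>.\<close>
    then have lim1: "(\<lambda>z. \<sigma> z * ((z - \<rho>) * poly L2 z)) \<midarrow>\<rho>\<rightarrow> \<sigma> \<rho> * ((\<rho> - \<rho>) * poly L2 \<rho>)"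
      by (intro tendsto_intros isContD)
    have lim2: "(\<lambda>z. z * poly W z) \<midarrow>\<rho>\<rightarrow> \<rho> * poly W \<rho>"
      by (intro tendsto_intros)
    have "eventually (\<lambda>z. norm z < 1 / B) (at \<rho>)"
      using small by (intro order_tendstoD(2)[of norm "norm \<rho>"] tendsto_intros)
    then have "eventually (\<lambda>z. \<sigma> z * ((z - \<rho>) * poly L2 z) = z * poly W z) (at \<rho>)"
      using eventually_neq_at_within[of \<rho> \<rho> UNIV]
    proof eventually_elim
      case (elim z)
      have "(z - \<rho>) ^ m * (z * poly W z) = (z - \<rho>) ^ m * (\<sigma> z * ((z - \<rho>) * poly L2 z))"
      proof -
        have "poly L z = (z - \<rho>) ^ m * ((z - \<rho>) * poly L2 z)" by (subst L) (simp add: algebra_simps)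
        moreover have "poly (pderiv L) z = (z - \<rho>) ^ m * poly W z" by (simp add: dL)
        ultimately show ?thesis using eq[of z] elim(1) by (simp add: mult_ac)
      qed
      then show ?case using elim(2) by simp
    qed
    then have "(\<lambda>z. z * poly W z) \<midarrow>\<rho>\<rightarrow> \<sigma> \<rho> * ((\<rho> - \<rho>) * poly L2 \<rho>)"
      using lim1 by (rule Lim_transform_eventually[rotated])
    then have "\<rho> * poly W \<rho> = 0" using lim2 LIM_unique by fastforce
    then have "poly L2 \<rho> = 0" using \<rho>0 by (auto simp: W_def simp del: of_nat_Suc)
    then show False using L2(2) by (simp add: poly_eq_0_iff_dvd)
  qed
  obtain R where R: "size R = degree L" "L = smult (lead_coeff L) (\<Prod>x\<in>#R. [:-x, 1:])"
    using alg_closed_imp_factorization[OF L0] by blast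
  have vanish: "poly (\<Prod>x\<in>#R. [:-x, 1:]) \<rho> = 0" if "\<rho> \<in># R" for \<rho>
    using that by (auto simp: poly_prod_mset image_mset.compositionality o_def prod_mset_zero_iff)
  have rootR: "norm \<rho> \<ge> 1 / B" if "\<rho> \<in># R" for \<rho>
  proof -
    have "poly L \<rho> = 0" by (subst R(2)) (simp add: that vanish)
    then show ?thesis by (rule roots)
  qed
  then have "0 \<notin># R" using B by force
  then have "coeff L 1 = - (\<Sum>x\<in>#R. 1 / x) * coeff L 0"
    using coeff_1_prod_mset_linear[of R] by (subst (1 2) R(2)) simp
  moreover have "c 1 = s 1" using newton[of 1] c0 by simp
  ultimately have "s 1 = - (\<Sum>x\<in>#R. 1 / x)" using c0 by (simp add: coeffL)
  then have "norm (s 1) = norm (\<Sum>x\<in>#R. 1 / x)" by (simp only: norm_minus_cancel)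
  also have "\<dots> \<le> (\<Sum>x\<in>#R. norm (1 / x))" by (induction R) (auto intro: norm_triangle_le)
  also have "\<dots> \<le> (\<Sum>x\<in>#R. B)"
  proof (intro sum_mset_mono)
    fix x assume "x \<in># R"
    then have "1 / norm x \<le> 1 / (1 / B)" using rootR[of x] B by (intro divide_left_mono mult_pos_pos) (auto intro: less_le_trans[of 0 "1 / B"])
    then show "norm (1 / x) \<le> B" by (simp add: norm_divide)
  qed
  also have "\<dots> = real (degree L) * B" using R by simp
  also have "degree L \<le> k"
    by (rule degree_le) (simp add: coeffL ck)
  finally show ?thesis using B by (simp add: mult_right_mono)
qed

section \<open>Weil's bound\<close>

lemma dirichlet_character_cong:
  assumes "dirichlet_character q \<chi>" "[m = n] (mod int q)"
  shows "\<chi> m = \<chi> n"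
proof -
  have shift: "\<chi> (m + int q * int k) = \<chi> m" for m k
  proof (induction k)
    case (Suc k)
    have "\<chi> (m + int q * int (Suc k)) = \<chi> ((m + int q * int k) + int q)" by (simp add: algebra_simps)
    also have "\<dots> = \<chi> (m + int q * int k)" using assms(1) by (simp add: dirichlet_character_def)
    finally show ?case using Suc by simp
  qed simp
  obtain t where t: "n = m + int q * t" using assms(2) by (metis cong_iff_lin mult.commute)
  show ?thesis
  proof (cases "t \<ge> 0")
    case True
    then show ?thesis using shift[of m "nat t"] t by simp
  next
    case False
    then show ?thesis using shift[of n "nat (- t)"] t by simp
  qed
qed

lemma dirichlet_character_1:
  assumes "dirichlet_character q \<chi>"
  shows "\<chi> 1 = 1"
proof -
  have "\<chi> (1 * 1) = \<chi> 1 * \<chi> 1" "\<chi> 1 \<noteq> 0"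
    using assms coprime_1_left unfolding dirichlet_character_def by blast+
  then show ?thesis by simp
qed

lemma dirichlet_character_mult:
  assumes "dirichlet_character q \<chi>"
  shows "\<chi> (m * n) = \<chi> m * \<chi> n"
  using assms unfolding dirichlet_character_def by blast

lemma dirichlet_character_power:
  assumes "dirichlet_character q \<chi>"
  shows "\<chi> (m ^ n) = \<chi> m ^ n"
  by (induction n) (simp_all add: dirichlet_character_1[OF assms] dirichlet_character_mult[OF assms])

lemma dirichlet_character_prod:
  assumes "dirichlet_character q \<chi>"
  shows "\<chi> (\<Prod>i\<in>I. f i) = (\<Prod>i\<in>I. \<chi> (f i))"
  by (induction I rule: infinite_finite_induct)
    (simp_all add: dirichlet_character_1[OF assms] dirichlet_character_mult[OF assms])

lemma dirichlet_character_eq_0_iff: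
  assumes "dirichlet_character q \<chi>" "prime q"
  shows "\<chi> m = 0 \<longleftrightarrow> int q dvd m"
proof -
  have "prime (int q)" using assms by simp
  then have "coprime m (int q) \<longleftrightarrow> \<not> int q dvd m"
    by (metis coprime_commute coprime_absorb_left not_prime_unit prime_imp_coprime)
  then show ?thesis using assms unfolding dirichlet_character_def by blast
qed

lemma dirichlet_character_power_eq_1:
  assumes \<chi>: "dirichlet_character q \<chi>" and q: "prime q" and False: "\<not> int q dvd m"
  shows "\<chi> m ^ (q - 1) = 1"
proof -
  have "[m ^ (q - 1) = 1] (mod int q)"
  proof -
    have "[nat (m mod int q) ^ (q - 1) = 1] (mod q)"
    proof (rule fermat_theorem[OF q])
      have *: "int (nat (m mod int q)) = m mod int q" using prime_gt_0_nat[OF q] by simp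
      have "\<not> int q dvd int (nat (m mod int q))" using False unfolding * by (simp add: dvd_eq_mod_eq_0)
      then show "\<not> q dvd nat (m mod int q)" unfolding int_dvd_int_iff .
    qed
    then have "[int (nat (m mod int q) ^ (q - 1)) = int 1] (mod int q)" by (simp only: cong_int_iff)
    then have "[(m mod int q) ^ (q - 1) = 1] (mod int q)" using prime_gt_0_nat[OF q] by simp
    then show ?thesis unfolding cong_def power_mod .
  qed
  then have "\<chi> (m ^ (q - 1)) = 1"
    using dirichlet_character_cong[OF \<chi>, of "m ^ (q - 1)" 1] dirichlet_character_1[OF \<chi>] by simp
  then show ?thesis by (simp add: dirichlet_character_power[OF \<chi>])
qed

lemma norm_dirichlet_character:
  assumes \<chi>: "dirichlet_character q \<chi>" and q: "prime q"
  shows "norm (\<chi> m) = (if int q dvd m then 0 else 1)"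
proof (cases "int q dvd m")
  case False
  then have "norm (\<chi> m) ^ (q - 1) = 1"
    using dirichlet_character_power_eq_1[OF \<chi> q] by (simp flip: norm_power)
  then have "norm (\<chi> m) = 1"
    using prime_gt_1_nat[OF q] power_eq_imp_eq_base[of "norm (\<chi> m)" "q - 1" 1] by simp
  then show ?thesis using False by simp
qed (use dirichlet_character_eq_0_iff[OF assms] in simp)

lemma sum_residues_mult:
  assumes "coprime u (int q)" and F: "\<And>x y. [x = y] (mod int q) \<Longrightarrow> F x = F y"
  shows "(\<Sum>x\<in>{0..<int q}. F (u * x)) = (\<Sum>x\<in>{0..<int q}. F x)"
proof -
  have "(\<Sum>x\<in>{0..<int q}. F x) = (\<Sum>x\<in>{0..<int q}. F (u * x mod int q))"
  proof (rule sum.reindex_bij_betw[symmetric])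
    have "inj_on (\<lambda>x. u * x mod int q) {0..<int q}"
    proof (rule inj_onI)
      fix x y assume xy: "x \<in> {0..<int q}" "y \<in> {0..<int q}" "u * x mod int q = u * y mod int q"
      then have "[x = y] (mod int q)" using assms(1) by (simp add: cong_mult_lcancel flip: cong_def)
      then show "x = y" using xy by (simp add: cong_def)
    qed
    moreover have "(\<lambda>x. u * x mod int q) ` {0..<int q} \<subseteq> {0..<int q}" by (cases "q = 0") auto
    ultimately show "bij_betw (\<lambda>x. u * x mod int q) {0..<int q} {0..<int q}"
      by (simp add: bij_betw_def endo_inj_surj)
  qed
  also have "\<dots> = (\<Sum>x\<in>{0..<int q}. F (u * x))"
    by (intro sum.cong refl F) (simp add: cong_def)
  finally show ?thesis ..
qed

lemma sum_nonprincipal_character: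
  assumes \<chi>: "dirichlet_character q \<chi>" "\<chi> \<noteq> principal_character q"
  shows "(\<Sum>x\<in>{0..<int q}. \<chi> x) = 0"
proof -
  obtain m where m: "\<chi> m \<noteq> principal_character q m" using \<chi> by auto
  have cop: "coprime m (int q)"
    using m \<chi>(1) by (auto simp: principal_character_def dirichlet_character_def split: if_splits)
  then have m1: "\<chi> m \<noteq> 1" using m by (simp add: principal_character_def)
  have "(\<Sum>x\<in>{0..<int q}. \<chi> x) = (\<Sum>x\<in>{0..<int q}. \<chi> (m * x))"
    using cop dirichlet_character_cong[OF \<chi>(1)] by (intro sum_residues_mult[symmetric])
  also have "\<dots> = \<chi> m * (\<Sum>x\<in>{0..<int q}. \<chi> x)"
    by (simp only: dirichlet_character_mult[OF \<chi>(1)] sum_distrib_left)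
  finally have "(1 - \<chi> m) * (\<Sum>x\<in>{0..<int q}. \<chi> x) = 0" by (simp add: left_diff_distrib)
  then show ?thesis using m1 by simp
qed

text \<open>The bound is uniform in the exponents \<open>e\<close>. This matters because complex
  conjugation of \<open>\<chi>\<close> will be expressed by the exponent
  \<open>q - 2\<close>.\<close>

definition weil_estimate :: "nat \<Rightarrow> bool" where
  "weil_estimate q \<longleftrightarrow> (\<forall>\<chi> B b0 e. dirichlet_character q \<chi> \<longrightarrow> \<chi> \<noteq> principal_character q \<longrightarrow>
     B \<subseteq> {0..<int q} \<longrightarrow> b0 \<in> B \<longrightarrow> e b0 = (1::nat) \<longrightarrow>
     norm (\<Sum>x\<in>{0..<int q}. \<chi> (\<Prod>b\<in>B. (x + b) ^ e b)) \<le> real (card B) * sqrt (real q))"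

lemma bij_betw_of_int_prime_subfield:
  assumes q: "prime CHAR('a::alg_closed_field)"
  shows "bij_betw (of_int :: int \<Rightarrow> 'a) {0..<int CHAR('a)} prime_subfield"
proof -
  have inj: "inj_on (of_int :: int \<Rightarrow> 'a) {0..<int CHAR('a)}"
    by (rule inj_onI) (auto simp: of_int_eq_iff_cong_CHAR cong_def)
  have "(of_int m :: 'a) \<in> prime_subfield" if "m \<ge> 0" for m
    using that
  proof (induction m rule: int_ge_induct)
    case (step i)
    then show ?case using prime_subfield_closed[OF q] by auto
  qed (use prime_subfield_closed[OF q] in auto)
  then have "(of_int :: int \<Rightarrow> 'a) ` {0..<int CHAR('a)} = prime_subfield"
    using card_prime_subfield[OF q] inj by (intro card_subset_eq) (auto simp: card_image)
  then show ?thesis using inj by (simp add: bij_betw_def)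
qed

text \<open>\<open>of_int\<close> carries residues to the prime subfield, and the sum in question
  becomes \<open>S 1\<close>. The asymptotic bound on \<open>S n\<close> enters only through
  \<open>newton_identity_bound\<close>, with \<open>k = card A\<close> and
  \<open>B = sqrt q\<close>.\<close>

lemma weil_estimate_CHAR:
  assumes q: "prime CHAR('a::alg_closed_field)"
  shows "weil_estimate CHAR('a)"
  unfolding weil_estimate_def
proof (intro allI impI)
  fix \<chi> B b0 and e :: "int \<Rightarrow> nat"
  define p where "p = CHAR('a)"
  assume \<chi>: "dirichlet_character CHAR('a) \<chi>" "\<chi> \<noteq> principal_character CHAR('a)"
    and B: "B \<subseteq> {0..<int CHAR('a)}" "b0 \<in> B" "e b0 = 1"
  define I where "I = {0..<int CHAR('a)}"
  define g where "g = inv_into I (of_int :: int \<Rightarrow> 'a)"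
  define \<psi> where "\<psi> = (\<lambda>y::'a. \<chi> (g y))"
  have bij: "bij_betw (of_int :: int \<Rightarrow> 'a) I prime_subfield"
    unfolding I_def by (rule bij_betw_of_int_prime_subfield[OF q])
  have g: "of_int (g y) = y" if "y \<in> prime_subfield" for y
    using bij that unfolding g_def by (metis bij_betw_def f_inv_into_f)
  have g': "g (of_int k) = k" if "k \<in> I" for k
    using bij that unfolding g_def by (simp add: bij_betw_def)
  have psi: "\<psi> (of_int k) = \<chi> k" for k
  proof -
    have "(of_int k :: 'a) = of_int (k mod int CHAR('a))"
      unfolding of_int_eq_iff_cong_CHAR by (simp add: cong_def)
    then have "\<psi> (of_int k) = \<psi> (of_int (k mod int CHAR('a)))" by (rule arg_cong)
    also have "\<psi> (of_int (k mod int CHAR('a))) = \<chi> (k mod int CHAR('a))"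
      unfolding \<psi>_def using prime_gt_0_nat[OF q] by (subst g') (auto simp: I_def)
    also have "\<dots> = \<chi> k" by (rule dirichlet_character_cong[OF \<chi>(1)]) (simp add: cong_def)
    finally show ?thesis .
  qed
  define A where "A = (of_int ` B :: 'a set)"
  have injB: "inj_on (of_int :: int \<Rightarrow> 'a) B" using bij B by (metis I_def bij_betw_def inj_on_subset)
  have gB: "g (of_int b) = b" if "b \<in> B" for b using that B g' by (auto simp: I_def)
  interpret character_tuple A "\<lambda>a. e (g a)" "of_int b0" \<psi>
  proof
    show "prime CHAR('a)" by (rule q)
    show "A \<subseteq> prime_subfield" using bij B by (auto simp: A_def I_def bij_betw_def)
    show "of_int b0 \<in> A" using B by (simp add: A_def)
    show "e (g (of_int b0)) = 1" using gB B by simp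
    show "\<psi> (x * y) = \<psi> x * \<psi> y" if "x \<in> prime_subfield" "y \<in> prime_subfield" for x y
    proof -
      have "\<psi> (x * y) = \<psi> (of_int (g x * g y))" using g that by simp
      also have "\<dots> = \<chi> (g x) * \<chi> (g y)" unfolding psi by (rule dirichlet_character_mult[OF \<chi>(1)])
      finally show ?thesis by (simp add: \<psi>_def)
    qed
    show "\<psi> 0 = 0" using psi[of 0] dirichlet_character_eq_0_iff[OF \<chi>(1) q, of 0] by simp
    show "\<psi> 1 = 1" using psi[of 1] dirichlet_character_1[OF \<chi>(1)] by simp
    show "norm (\<psi> c) \<le> 1" for c by (simp add: \<psi>_def norm_dirichlet_character[OF \<chi>(1) q])
    have "(\<Sum>c\<in>prime_subfield. \<psi> c) = (\<Sum>k\<in>I. \<psi> (of_int k))"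
      using sum.reindex_bij_betw[OF bij, of \<psi>] by simp
    also have "\<dots> = 0" using sum_nonprincipal_character[OF \<chi>] by (simp add: psi I_def)
    finally show "(\<Sum>c\<in>prime_subfield. \<psi> c) = 0" .
  qed
  obtain C n0 where C: "C \<ge> 0" "\<And>n. n \<ge> n0 \<Longrightarrow> norm (S n) \<le> C * sqrt (real CHAR('a)) ^ n"
    using S_bound by blast
  have "norm (S 1) \<le> real (card A) * sqrt (real CHAR('a))"
    using prime_gt_0_nat[OF q]
    by (intro newton_identity_bound[OF c_0 c_eq_0 newton_identity C(2)]) auto
  also have "card A = card B" by (simp add: A_def card_image injB)
  also have "S 1 = (\<Sum>x\<in>prime_subfield. \<psi> (poly f x))"
    by (simp add: S_def prime_subfield_def)
  \<comment> \<open>Reflection turns the factors \<open>a - x\<close> of \<open>f\<close> into the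
    factors \<open>x + b\<close> of the estimate.\<close>
  also have "\<dots> = (\<Sum>x\<in>prime_subfield. \<psi> (poly f (- x)))"
  proof (rule sum.reindex_bij_witness[of _ uminus uminus])
    have neg: "- x \<in> prime_subfield" if "x \<in> prime_subfield" for x :: 'a
      using prime_subfield_closed(5)[OF q prime_subfield_closed(1)[OF q] that] by simp
    show "x \<in> prime_subfield \<Longrightarrow> - x \<in> prime_subfield" "x \<in> prime_subfield \<Longrightarrow> - x \<in> prime_subfield" for x :: 'a
      by (auto intro: neg)
  qed auto
  also have "\<dots> = (\<Sum>k\<in>I. \<psi> (poly f (- of_int k)))"
    using sum.reindex_bij_betw[OF bij, of "\<lambda>x. \<psi> (poly f (- x))"] by simp
  also have "\<dots> = (\<Sum>k\<in>I. \<chi> (\<Prod>b\<in>B. (k + b) ^ e b))"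
  proof (intro sum.cong refl)
    fix k
    have "poly f (- of_int k) = (\<Prod>a\<in>A. (a + of_int k) ^ e (g a))" by (simp add: f_def poly_prod)
    also have "\<dots> = (\<Prod>b\<in>B. (of_int b + of_int k) ^ e b)"
      unfolding A_def by (subst prod.reindex[OF injB]) (simp add: gB)
    also have "\<dots> = of_int (\<Prod>b\<in>B. (k + b) ^ e b)" by (simp add: add.commute)
    finally show "\<psi> (poly f (- of_int k)) = \<chi> (\<Prod>b\<in>B. (k + b) ^ e b)" by (simp only: psi)
  qed
  finally show "norm (\<Sum>x\<in>{0..<int CHAR('a)}. \<chi> (\<Prod>b\<in>B. (x + b) ^ e b)) \<le> real (card B) * sqrt (real CHAR('a))"
    by (simp add: I_def)
qed

text \<open>A field of \<open>q\<close> elements is needed as a type, although \<open>q\<close> is a variable.  It suffices to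
  have such a type for one (hypothetical) prime violating the estimate.\<close>
definition weil_prime :: nat where
  "weil_prime = (if \<exists>q. prime q \<and> \<not> weil_estimate q then SOME q. prime q \<and> \<not> weil_estimate q else 2)"

lemma prime_weil_prime: "prime weil_prime"
  unfolding weil_prime_def using someI_ex[of "\<lambda>q. prime q \<and> \<not> weil_estimate q"] by auto

typedef weil_index = "{..<weil_prime}"
  using prime_gt_0_nat[OF prime_weil_prime] by auto

lemma card_weil_index: "CARD(weil_index) = weil_prime"
  by (simp add: type_definition.card[OF type_definition_weil_index])

instance weil_index :: prime_card
  by standard (simp add: card_weil_index prime_weil_prime)

theorem weil_estimate:
  assumes "prime q"
  shows "weil_estimate q"
proof (rule ccontr)
  assume "\<not> weil_estimate q"
  then have ex: "\<exists>q. prime q \<and> \<not> weil_estimate q" using assms by blast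
  have char: "CHAR(weil_index mod_ring alg_closure) = weil_prime" by (simp add: card_weil_index)
  have "weil_estimate weil_prime"
    using weil_estimate_CHAR[where 'a = "weil_index mod_ring alg_closure"] unfolding char
    by (simp add: prime_weil_prime)
  moreover have "\<not> weil_estimate weil_prime"
    using someI_ex[OF ex] ex by (simp add: weil_prime_def)
  ultimately show False by simp
qed

section \<open>Moments of short character sums\<close>

text \<open>Modulo 2 every unit is 1, so only the principal character exists. The bound gives
  \<open>ln q \<ge> 1\<close> and makes the exponent \<open>q - 2\<close> positive.\<close>

lemma nonprincipal_modulus_ge_3:
  assumes "dirichlet_character q \<chi>" "\<chi> \<noteq> principal_character q" "prime q"
  shows "q \<ge> 3"
proof (rule ccontr)
  assume "\<not> q \<ge> 3"
  then have q: "q = 2" using prime_ge_2_nat[OF assms(3)] by simp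
  have "\<chi> m = principal_character q m" for m
  proof (cases "coprime m (int q)")
    case True
    then have "[m = 1] (mod int q)" unfolding q by (simp add: cong_def odd_iff_mod_2_eq_one)
    then show ?thesis using True dirichlet_character_cong[OF assms(1)] dirichlet_character_1[OF assms(1)]
      by (simp add: principal_character_def)
  next
    case False
    then show ?thesis using assms(1) by (auto simp: principal_character_def dirichlet_character_def)
  qed
  then show False using assms(2) by auto
qed

lemma dirichlet_character_cnj:
  assumes "dirichlet_character q \<chi>"
  shows "dirichlet_character q (\<lambda>m. cnj (\<chi> m))"
  using assms unfolding dirichlet_character_def by simp

lemma cnj_nonprincipal:
  assumes "\<chi> \<noteq> principal_character q"
  shows "(\<lambda>m. cnj (\<chi> m)) \<noteq> principal_character q"
proof
  assume *: "(\<lambda>m. cnj (\<chi> m)) = principal_character q"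
  have "\<chi> m = principal_character q m" for m
  proof -
    have "\<chi> m = cnj (principal_character q m)" by (simp flip: *)
    then show ?thesis by (simp add: principal_character_def)
  qed
  then show False using assms by auto
qed

text \<open>Nonzero values have norm 1, so conjugation inverts them, and by Fermat inversion is the
  power \<open>q - 2\<close>. Multiples of \<open>q\<close> give 0 on both sides because the
  exponent is positive.\<close>

lemma cnj_dirichlet_character:
  assumes \<chi>: "dirichlet_character q \<chi>" "\<chi> \<noteq> principal_character q" and q: "prime q"
  shows "cnj (\<chi> m) = \<chi> (m ^ (q - 2))"
proof (cases "\<chi> m = 0")
  case True
  then show ?thesis
    using nonprincipal_modulus_ge_3[OF \<chi> q] by (simp add: dirichlet_character_power[OF \<chi>(1)] zero_power)
next
  case False
  then have dvd: "\<not> int q dvd m" using dirichlet_character_eq_0_iff[OF \<chi>(1) q] by simp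
  have q3: "q \<ge> 3" by (rule nonprincipal_modulus_ge_3[OF \<chi> q])
  have "\<chi> m ^ (q - 1) = 1"
    using dirichlet_character_power_eq_1[OF \<chi>(1) q dvd] .
  moreover have "q - 1 = Suc (q - 2)" using q3 by simp
  ultimately have "\<chi> m * \<chi> m ^ (q - 2) = 1" by simp
  moreover have "\<chi> m * cnj (\<chi> m) = 1"
    using norm_dirichlet_character[OF \<chi>(1) q, of m] dvd by (simp add: complex_norm_square[symmetric])
  ultimately have "\<chi> m * cnj (\<chi> m) = \<chi> m * \<chi> m ^ (q - 2)" by simp
  then show ?thesis using False by (simp add: dirichlet_character_power[OF \<chi>(1)])
qed

text \<open>Indices with equal shift are merged and their exponents added, 1 for
  \<open>\<chi>\<close> and \<open>q - 2\<close> for its conjugate. The index \<open>k\<close> is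
  alone at its shift and not conjugated, so the exponent there is exactly one.\<close>

lemma weil_estimate_conjugates:
  fixes f :: "nat \<Rightarrow> int"
  assumes \<chi>: "dirichlet_character q \<chi>" "\<chi> \<noteq> principal_character q" and q: "prime q"
    and f: "finite I" "\<And>i. i \<in> I \<Longrightarrow> f i \<in> {0..<int q}"
    and k: "k \<in> I" "w k" "\<And>i. i \<in> I \<Longrightarrow> f i = f k \<Longrightarrow> i = k"
  shows "norm (\<Sum>x\<in>{0..<int q}. \<Prod>i\<in>I. if w i then \<chi> (x + f i) else cnj (\<chi> (x + f i))) \<le> real (card I) * sqrt (real q)"
proof -
  define u where "u = (\<lambda>i. if w i then 1 else q - 2)"
  define e where "e = (\<lambda>b. \<Sum>i | i \<in> I \<and> f i = b. u i)"
  have "{i \<in> I. f i = f k} = {k}" using k by auto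
  then have e1: "e (f k) = 1" using k by (simp add: e_def u_def)
  have "(\<Prod>i\<in>I. if w i then \<chi> (x + f i) else cnj (\<chi> (x + f i))) = \<chi> (\<Prod>b\<in>f ` I. (x + b) ^ e b)" for x
  proof -
    have "(\<Prod>b\<in>f ` I. (x + b) ^ e b) = (\<Prod>b\<in>f ` I. \<Prod>i | i \<in> I \<and> f i = b. (x + f i) ^ u i)"
      by (intro prod.cong refl) (simp add: e_def power_sum)
    also have "\<dots> = (\<Prod>i\<in>I. (x + f i) ^ u i)"
      using f(1) by (rule prod.image_gen[symmetric])
    finally show ?thesis
      by (simp add: dirichlet_character_prod[OF \<chi>(1)] u_def if_distrib cnj_dirichlet_character[OF \<chi> q] cong: if_cong)
  qed
  then have "norm (\<Sum>x\<in>{0..<int q}. \<Prod>i\<in>I. if w i then \<chi> (x + f i) else cnj (\<chi> (x + f i)))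
      = norm (\<Sum>x\<in>{0..<int q}. \<chi> (\<Prod>b\<in>f ` I. (x + b) ^ e b))" by simp
  also have "\<dots> \<le> real (card (f ` I)) * sqrt (real q)"
    using weil_estimate[OF q] \<chi> f k e1 unfolding weil_estimate_def by blast
  also have "\<dots> \<le> real (card I) * sqrt (real q)"
    using f(1) by (intro mult_right_mono) (auto intro: card_image_le)
  finally show ?thesis .
qed

text \<open>Each value is taken at least twice, so there are at most \<open>r\<close> values and
  \<open>f\<close> factors through \<open>{..<r}\<close>. The bound is the number of pairs
  \<open>(v, k)\<close> with \<open>f = v \<circ> k\<close>.\<close>

lemma card_functions_without_simple_value:
  fixes r B :: nat
  shows "card {f \<in> PiE {..<2*r} (\<lambda>_. {1..B}). \<forall>i<2*r. \<exists>j<2*r. j \<noteq> i \<and> f j = f i} \<le> r ^ (2*r) * B ^ r"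
proof (cases "B = 0 \<or> r = 0")
  case True
  have "card {f \<in> PiE {..<2*r} (\<lambda>_. {1..B}). \<forall>i<2*r. \<exists>j<2*r. j \<noteq> i \<and> f j = f i} \<le> card (PiE {..<2*r} (\<lambda>_. {1..B}))"
    by (intro card_mono finite_PiE) auto
  also have "\<dots> = B ^ (2*r)" by (simp add: card_PiE)
  finally show ?thesis using True by (cases "r = 0") (auto simp: zero_power)
next
  case False
  let ?I = "{..<2*r}"
  define Z where "Z = {f \<in> PiE ?I (\<lambda>_. {1..B}). \<forall>i<2*r. \<exists>j<2*r. j \<noteq> i \<and> f j = f i}"
  define V where "V = PiE {..<r} (\<lambda>_. {1..B})"
  define K where "K = PiE ?I (\<lambda>_. {..<r})"
  have fin: "finite V" "finite K" by (auto simp: V_def K_def intro!: finite_PiE)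
  have "Z \<subseteq> (\<lambda>(v, k). restrict (v \<circ> k) ?I) ` (V \<times> K)"
  proof
    fix f assume f: "f \<in> Z"
    define J where "J = f ` ?I"
    have "2 \<le> card {i \<in> ?I. f i = y}" if y: "y \<in> J" for y
    proof -
      obtain i where i: "i < 2*r" "f i = y" using y by (auto simp: J_def)
      have "\<forall>i<2*r. \<exists>j<2*r. j \<noteq> i \<and> f j = f i" using f by (simp add: Z_def)
      then obtain j where j: "j < 2*r" "j \<noteq> i" "f j = y" using i by blast
      have "card {i, j} \<le> card {i \<in> ?I. f i = y}" using i j by (intro card_mono) auto
      then show ?thesis using j by simp
    qed
    then have "(\<Sum>y\<in>J. 2) \<le> (\<Sum>y\<in>J. card {i \<in> ?I. f i = y})" by (intro sum_mono)
    also have "\<dots> = card ?I"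
      using sum.image_gen[of ?I "\<lambda>_. 1::nat" f] by (simp add: J_def)
    finally have cJ: "card J \<le> r" by simp
    have finJ: "finite J" by (simp add: J_def)
    obtain h where h: "bij_betw h {0..<card J} J" using ex_bij_betw_nat_finite[OF finJ] by blast
    \<comment> \<open>Slots beyond the actual number of values get the dummy value 1, admissible
      since \<open>B > 0\<close> in this case.\<close>
    define v where "v = restrict (\<lambda>t. if t < card J then h t else 1) {..<r}"
    define k where "k = restrict (\<lambda>i. inv_into {0..<card J} h (f i)) ?I"
    have kin: "inv_into {0..<card J} h (f i) < card J" "h (inv_into {0..<card J} h (f i)) = f i" if "i < 2*r" for i
    proof -
      have "f i \<in> h ` {0..<card J}" using that h by (auto simp: J_def bij_betw_def)
      then show "inv_into {0..<card J} h (f i) < card J" "h (inv_into {0..<card J} h (f i)) = f i"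
        using inv_into_into[of "f i" h "{0..<card J}"] f_inv_into_f[of "f i" h "{0..<card J}"] by auto
    qed
    have JB: "J \<subseteq> {1..B}" using f by (auto simp: J_def Z_def PiE_def Pi_def)
    have "h t \<in> {1..B}" if "t < card J" for t using h that JB by (force simp: bij_betw_def)
    then have "v \<in> V" using False by (auto simp: v_def V_def)
    moreover have "k \<in> K" using kin(1) cJ by (auto simp: k_def K_def intro: less_le_trans)
    moreover have "f = restrict (v \<circ> k) ?I"
    proof
      fix i show "f i = restrict (v \<circ> k) ?I i"
      proof (cases "i < 2*r")
        case True
        then show ?thesis using kin[OF True] cJ by (simp add: v_def k_def)
      next
        case False
        then show ?thesis using f by (simp add: Z_def PiE_def extensional_def)
      qed
    qed
    ultimately show "f \<in> (\<lambda>(v, k). restrict (v \<circ> k) ?I) ` (V \<times> K)" by (intro image_eqI[of _ _ "(v, k)"]) auto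
  qed
  then have "card Z \<le> card ((\<lambda>(v, k). restrict (v \<circ> k) ?I) ` (V \<times> K))" using fin by (intro card_mono) auto
  also have "\<dots> \<le> card (V \<times> K)" using fin by (intro card_image_le) auto
  also have "\<dots> = r ^ (2*r) * B ^ r" by (simp add: V_def K_def card_PiE card_cartesian_product)
  finally show ?thesis by (simp add: Z_def)
qed

lemma character_moment_bound:
  assumes \<chi>: "dirichlet_character q \<chi>" "\<chi> \<noteq> principal_character q" and q: "prime q" and B: "B < q"
  shows "(\<Sum>x\<in>{0..<int q}. norm (\<Sum>b\<in>{1..B}. \<chi> (x + int b)) ^ (2*r))
    \<le> real (r ^ (2*r)) * real B ^ r * real q + real (2*r) * real B ^ (2*r) * sqrt (real q)"
proof -
  let ?I = "{..<2*r}"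
  define F where "F = {0..<int q}"
  define T where "T = (\<lambda>x. \<Sum>b\<in>{1..B}. \<chi> (x + int b))"
  define P where "P = PiE ?I (\<lambda>_. {1..B})"
  define Z where "Z = {f \<in> P. \<forall>i<2*r. \<exists>j<2*r. j \<noteq> i \<and> f j = f i}"
  define G where "G = (\<lambda>f x. \<Prod>i\<in>?I. if i < r then \<chi> (x + int (f i)) else cnj (\<chi> (x + int (f i))))"
  have finP: "finite P" by (auto simp: P_def intro!: finite_PiE)
  have "of_real (norm (T x) ^ (2*r)) = (\<Sum>f\<in>P. G f x)" for x
  proof -
    have I: "?I = {..<r} \<union> {r..<2*r}" by auto
    have "of_real (norm (T x) ^ (2*r)) = (T x * cnj (T x)) ^ r"
      unfolding power_mult of_real_power[where x = "(cmod (T x))\<^sup>2"] complex_norm_square ..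
    also have "\<dots> = (\<Prod>i\<in>?I. if i < r then T x else cnj (T x))"
      unfolding I by (subst prod.union_disjoint) (auto simp: power_mult_distrib)
    also have "\<dots> = (\<Prod>i\<in>?I. \<Sum>b\<in>{1..B}. if i < r then \<chi> (x + int b) else cnj (\<chi> (x + int b)))"
      by (intro prod.cong refl) (simp add: T_def)
    also have "\<dots> = (\<Sum>f\<in>P. G f x)"
      unfolding P_def G_def by (rule prod_sum_PiE) auto
    finally show ?thesis .
  qed
  then have "of_real (\<Sum>x\<in>F. norm (T x) ^ (2*r)) = (\<Sum>x\<in>F. \<Sum>f\<in>P. G f x)" by simp
  also have "\<dots> = (\<Sum>f\<in>P. \<Sum>x\<in>F. G f x)" by (rule sum.swap)
  finally have eq: "of_real (\<Sum>x\<in>F. norm (T x) ^ (2*r)) = (\<Sum>f\<in>P. \<Sum>x\<in>F. G f x)" .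
  have "(\<Sum>x\<in>F. norm (T x) ^ (2*r)) = norm (of_real (\<Sum>x\<in>F. norm (T x) ^ (2*r)) :: complex)"
    by (simp only: norm_of_real) (simp add: sum_nonneg)
  also have "\<dots> \<le> (\<Sum>f\<in>P. norm (\<Sum>x\<in>F. G f x))" unfolding eq by (rule norm_sum)
  also have "\<dots> \<le> (\<Sum>f\<in>P. if f \<in> Z then real q else real (2*r) * sqrt (real q))"
  proof (intro sum_mono)
    fix f assume f: "f \<in> P"
    show "norm (\<Sum>x\<in>F. G f x) \<le> (if f \<in> Z then real q else real (2*r) * sqrt (real q))"
    proof (cases "f \<in> Z")
      case True
      have "norm (\<Sum>x\<in>F. G f x) \<le> (\<Sum>x\<in>F. 1)"
      proof (rule order_trans[OF norm_sum], rule sum_mono)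
        fix x
        show "norm (G f x) \<le> 1" unfolding G_def prod_norm[symmetric]
          by (intro prod_le_1) (auto simp: norm_dirichlet_character[OF \<chi>(1) q])
      qed
      then show ?thesis using True by (simp add: F_def)
    next
      case False
      then have "\<exists>i0<2*r. \<forall>i<2*r. f i = f i0 \<longrightarrow> i = i0"
        using f unfolding Z_def mem_Collect_eq by blast
      then obtain i0 where "i0 < 2*r \<and> (\<forall>i<2*r. f i = f i0 \<longrightarrow> i = i0)" ..
      then have i0: "i0 < 2*r" "\<And>i. i < 2*r \<Longrightarrow> f i = f i0 \<Longrightarrow> i = i0"
        by simp_all
      \<comment> \<open>Because \<open>B < q\<close>, distinct shifts are distinct residues, so a
        value taken once is a linear factor occurring once.\<close>
      have fq: "int (f i) \<in> {0..<int q}" if "i \<in> ?I" for i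
      proof -
        have "f i \<in> {1..B}" using PiE_mem[OF f[unfolded P_def] that] .
        then show ?thesis using B by auto
      qed
      have "norm (\<Sum>x\<in>F. G f x) \<le> real (card ?I) * sqrt (real q)"
      proof (cases "i0 < r")
        case True
        then show ?thesis unfolding F_def G_def
          using i0 fq by (intro weil_estimate_conjugates[OF \<chi> q, where w = "\<lambda>i. i < r" and f = "\<lambda>i. int (f i)" and k = i0]) auto
      next
        case False
        \<comment> \<open>The simple factor is conjugated here, so the estimate is applied to the
          conjugate character.\<close>
        have "norm (\<Sum>x\<in>F. \<Prod>i\<in>?I. if \<not> i < r then cnj (\<chi> (x + int (f i))) else cnj (cnj (\<chi> (x + int (f i))))) \<le> real (card ?I) * sqrt (real q)"
          unfolding F_def using i0 fq False
          by (intro weil_estimate_conjugates[OF dirichlet_character_cnj[OF \<chi>(1)] cnj_nonprincipal[OF \<chi>(2)] q,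
                where w = "\<lambda>i. \<not> i < r" and f = "\<lambda>i. int (f i)" and k = i0]) auto
        also have "(\<Sum>x\<in>F. \<Prod>i\<in>?I. if \<not> i < r then cnj (\<chi> (x + int (f i))) else cnj (cnj (\<chi> (x + int (f i))))) = (\<Sum>x\<in>F. G f x)"
          unfolding G_def by (intro sum.cong prod.cong refl) auto
        finally show ?thesis .
      qed
      then show ?thesis using False by simp
    qed
  qed
  also have "\<dots> = real (card Z) * real q + real (card (P - Z)) * (real (2*r) * sqrt (real q))"
  proof -
    have "P \<inter> {f. f \<in> Z} = Z" "P \<inter> - {f. f \<in> Z} = P - Z" by (auto simp: Z_def)
    then show ?thesis using finP by (subst sum.If_cases) auto
  qed
  also have "\<dots> \<le> real (r ^ (2*r) * B ^ r) * real q + real (B ^ (2*r)) * (real (2*r) * sqrt (real q))"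
  proof (intro add_mono mult_right_mono)
    show "real (card Z) \<le> real (r ^ (2*r) * B ^ r)"
      unfolding of_nat_le_iff Z_def P_def by (rule card_functions_without_simple_value)
    have "card (P - Z) \<le> card P" using finP by (intro card_mono) auto
    also have "card P = B ^ (2*r)" by (simp add: P_def card_PiE)
    finally show "real (card (P - Z)) \<le> real (B ^ (2*r))" by simp
  qed auto
  finally show ?thesis by (simp add: F_def T_def mult_ac)
qed

section \<open>The Polya-Vinogradov inequality\<close>

lemma sin_pi_mult_ge:
  assumes "0 \<le> t" "t \<le> 1"
  shows "sin (pi * t) \<ge> min t (1 - t)"
proof -
  have *: "sin (pi * t) \<ge> t" if t: "0 \<le> t" "t \<le> 1/2" for t
  proof -
    define y where "y = pi * t"
    have y: "0 \<le> y" "y \<le> 2"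
      using t pi_less_4 by (auto simp: y_def) (use mult_mono[of pi 4 t "1/2"] in simp)
    \<comment> \<open>For \<open>0 \<le> y \<le> 2\<close> the cubic term removes at most two thirds
      of \<open>y\<close>; the remaining third is at least \<open>t\<close> because
      \<open>pi > 3\<close>.\<close>
    have "\<bar>sin y - (\<Sum>m<3. sin_coeff m * y ^ m)\<bar> \<le> inverse (fact 3) * \<bar>y\<bar> ^ 3"
      by (rule Maclaurin_sin_bound)
    then have "sin y \<ge> y - y ^ 3 / 6"
      using y by (simp add: sin_coeff_def eval_nat_numeral fact_numeral abs_if split: if_splits)
    moreover have "y ^ 3 / 6 \<le> y * 4 / 6"
    proof -
      have "y * y \<le> 2 * 2" using y by (intro mult_mono) auto
      then have "y * (y * y) \<le> y * 4" using y by (intro mult_left_mono) auto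
      then show ?thesis by (simp add: power3_eq_cube)
    qed
    ultimately have "sin y \<ge> y / 3" by linarith
    moreover have "y \<ge> 3 * t" unfolding y_def using pi_gt3 t by (intro mult_right_mono) auto
    ultimately show ?thesis by (simp add: y_def)
  qed
  show ?thesis
  proof (cases "t \<le> 1/2")
    case True
    then show ?thesis using *[of t] assms by simp
  next
    case False
    have "sin (pi * (1 - t)) = sin (pi * t)" by (simp add: right_diff_distrib)
    then show ?thesis using *[of "1 - t"] False assms by simp
  qed
qed

lemma harm_le: "n > 0 \<Longrightarrow> harm n \<le> 1 + ln (real n)"
  using euler_mascheroni_sequence_decreasing[of 1 n] by (simp add: harm_def)

lemma ln_ge_1: "q \<ge> (3::nat) \<Longrightarrow> ln (real q) \<ge> 1"
  using exp_le by (subst ln_ge_iff) auto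

text \<open>Finite Fourier expansion of \<open>\<chi>\<close>. The coefficients are Gauss sums, of
  norm \<open>sqrt q\<close> except for \<open>c 0 = 0\<close>, and the remaining sums over the
  interval are geometric.\<close>

lemma polya_vinogradov:
  assumes \<chi>: "dirichlet_character q \<chi>" "\<chi> \<noteq> principal_character q" and q: "prime q"
  shows "norm (\<Sum>h\<in>{1..H}. \<chi> (N + int h)) \<le> 4 * sqrt (real q) * ln (real q)"
proof -
  define ek where "ek = (\<lambda>k::int. cis (2 * pi * of_int k / real q))"
  define R where "R = {0..<int q}"
  define c where "c = (\<lambda>k::int. \<Sum>x\<in>R. \<chi> x * ek (- (k * x)))"
  have q3: "q \<ge> 3" by (rule nonprincipal_modulus_ge_3[OF \<chi> q])
  have ek_add: "ek (a + b) = ek a * ek b" for a b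
    by (simp add: ek_def cis_mult distrib_left add_divide_distrib)
  have ek_0: "ek 0 = 1" by (simp add: ek_def)
  have ek_diff: "ek (a - b) = ek a * ek (- b)" for a b
    unfolding diff_conv_add_uminus by (rule ek_add)
  have ek_norm: "norm (ek k) = 1" for k by (simp add: ek_def)
  have ek_cnj: "cnj (ek k) = ek (- k)" for k by (simp add: ek_def cis_cnj)
  have ek_pow: "ek (int n * k) = ek k ^ n" for n k
  proof (induction n)
    case (Suc n)
    have "int (Suc n) * k = k + int n * k" by (simp add: algebra_simps)
    then show ?case by (simp only: ek_add Suc.IH power_Suc)
  qed (simp add: ek_0)
  have ek_q: "ek (int q * t) = 1" for t
  proof -
    have "ek (int q * t) = cis (2 * pi * of_int t)"
      unfolding ek_def using q3 by (intro arg_cong[where f = cis]) simp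
    also have "\<dots> = 1" by (rule cis_multiple_2pi) auto
    finally show ?thesis .
  qed
  have ek_cong: "ek a = ek b" if ab: "[a = b] (mod int q)" for a b
  proof -
    obtain t where "b = a + int q * t" using ab unfolding cong_iff_lin by blast
    then show ?thesis by (simp only: ek_add ek_q mult_1_right)
  qed
  have ek_far: "2 / norm (ek (int k) - 1) \<le> real q * (1 / real k + 1 / real (q - k))"
      and ek_ne: "ek (int k) \<noteq> 1" if k: "0 < k" "k < q" for k
  proof -
    define t where "t = real k / real q"
    have t: "0 < t" "t < 1" using k by (auto simp: t_def)
    have "norm (ek (int k) - 1) = 2 * \<bar>sin (pi * t)\<bar>"
      using dist_exp_i_1[of "2 * pi * t"] by (simp add: ek_def cis_conv_exp t_def)
    moreover have "min t (1 - t) \<le> \<bar>sin (pi * t)\<bar>"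
      using t by (intro order_trans[OF sin_pi_mult_ge abs_ge_self]) auto
    ultimately have n: "norm (ek (int k) - 1) \<ge> 2 * min t (1 - t)"
      by (simp only: mult_le_cancel_left_pos zero_less_numeral)
    then show "ek (int k) \<noteq> 1" using t by (auto simp: min_def split: if_splits)
    have "2 / norm (ek (int k) - 1) \<le> 2 / (2 * min t (1 - t))"
      using n t by (intro divide_left_mono mult_pos_pos) (auto simp: min_def split: if_splits)
    \<comment> \<open>Replacing the reciprocal of the minimum by the sum of both reciprocals leads
      to two equal harmonic sums over \<open>k\<close>.\<close>
    also have "\<dots> \<le> 1 / t + 1 / (1 - t)" using t by (auto simp: min_def)
    also have "1 - t = real (q - k) / real q" using k by (simp add: t_def field_simps of_nat_diff)
    finally show "2 / norm (ek (int k) - 1) \<le> real q * (1 / real k + 1 / real (q - k))"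
      by (simp add: t_def distrib_left)
  qed
  have orth: "(\<Sum>k<q. ek (int k * m)) = (if int q dvd m then of_nat q else 0)" for m
  proof (cases "int q dvd m")
    case True
    then have "ek (int k * m) = 1" for k using ek_cong[of "int k * m" 0] ek_0 by (simp add: cong_0_iff)
    then show ?thesis using True by simp
  next
    case False
    define k where "k = nat (m mod int q)"
    have k: "int k = m mod int q" using q3 by (simp add: k_def)
    have "ek m = ek (int k)" by (rule ek_cong) (simp add: k cong_def)
    moreover have "0 < k" "k < q"
      using False q3 pos_mod_bound[of "int q" m] by (auto simp: k_def dvd_eq_mod_eq_0 order_le_neq_trans) (simp add: nat_less_iff)
    ultimately have ne: "ek m \<noteq> 1" using ek_ne by simp
    have "(ek m - 1) * (\<Sum>k<q. ek m ^ k) = ek m ^ q - 1" by (simp add: power_diff_1_eq)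
    also have "ek m ^ q = 1" using ek_q[of m] by (simp flip: ek_pow)
    finally show ?thesis using ne False by (simp add: ek_pow)
  qed
  have c_norm: "norm (c (int k)) = norm (c 1)" if k: "0 < k" "k < q" for k
  proof -
    have "\<not> q dvd k" using k by (auto dest: dvd_imp_le)
    then have "coprime q k" using prime_imp_coprime[OF q] by simp
    then have cop: "coprime (int k) (int q)" by (simp add: coprime_commute)
    have per: "\<chi> x * ek (- (1 * x)) = \<chi> y * ek (- (1 * y))" if "[x = y] (mod int q)" for x y
    proof (rule arg_cong2[where f = "(*)"])
      show "\<chi> x = \<chi> y" using dirichlet_character_cong[OF \<chi>(1) that] .
      show "ek (- (1 * x)) = ek (- (1 * y))" using that by (intro ek_cong) (simp add: cong_minus_minus_iff)
    qed
    have "c 1 = (\<Sum>x\<in>R. \<chi> (int k * x) * ek (- (1 * (int k * x))))"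
      unfolding c_def R_def by (rule sum_residues_mult[OF cop per, symmetric])
    also have "\<dots> = \<chi> (int k) * c (int k)"
      by (simp add: c_def sum_distrib_left dirichlet_character_mult[OF \<chi>(1)] mult_ac)
    finally show ?thesis
      using norm_dirichlet_character[OF \<chi>(1) q, of "int k"] \<open>\<not> q dvd k\<close> by (simp add: norm_mult)
  qed
  have c_0: "c 0 = 0"
    using sum_nonprincipal_character[OF \<chi>] by (simp add: c_def ek_0 R_def)
  \<comment> \<open>Parseval: the squares add up to \<open>q * (q - 1)\<close>, shared equally by
    the \<open>q - 1\<close> nonzero frequencies.\<close>
  have c_1: "norm (c 1) = sqrt (real q)"
  proof -
    have "of_real (\<Sum>k<q. (norm (c (int k)))\<^sup>2) = (\<Sum>k<q. c (int k) * cnj (c (int k)))"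
      by (simp only: of_real_sum complex_norm_square)
    also have "\<dots> = (\<Sum>k<q. \<Sum>x\<in>R. \<Sum>y\<in>R. \<chi> x * cnj (\<chi> y) * ek (int k * (y - x)))"
      unfolding c_def cnj_sum sum_product
      by (intro sum.cong refl) (simp only: ek_cnj complex_cnj_mult minus_minus right_diff_distrib ek_diff mult_ac)
    also have "\<dots> = (\<Sum>x\<in>R. \<Sum>y\<in>R. \<Sum>k<q. \<chi> x * cnj (\<chi> y) * ek (int k * (y - x)))"
      by (subst sum.swap) (intro sum.cong refl sum.swap)
    also have "\<dots> = (\<Sum>x\<in>R. \<Sum>y\<in>R. if y = x then of_nat q * (\<chi> x * cnj (\<chi> x)) else 0)"
    proof (intro sum.cong refl)
      fix x y assume xy: "x \<in> R" "y \<in> R"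
      have "int q dvd y - x \<longleftrightarrow> y = x"
        using xy by (auto simp: R_def mod_eq_dvd_iff[symmetric])
      then show "(\<Sum>k<q. \<chi> x * cnj (\<chi> y) * ek (int k * (y - x))) = (if y = x then of_nat q * (\<chi> x * cnj (\<chi> x)) else 0)"
        by (simp add: orth flip: sum_distrib_left)
    qed
    also have "\<dots> = (\<Sum>x\<in>R. of_nat q * (\<chi> x * cnj (\<chi> x)))"
      by (intro sum.cong refl) (simp add: R_def)
    also have "\<dots> = of_real (\<Sum>x\<in>R. real q * (norm (\<chi> x))\<^sup>2)"
      by (simp only: of_real_sum of_real_mult complex_norm_square of_real_of_nat_eq)
    finally have "(\<Sum>k<q. (norm (c (int k)))\<^sup>2) = (\<Sum>x\<in>R. real q * (norm (\<chi> x))\<^sup>2)"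
      unfolding of_real_eq_iff .
    also have "\<dots> = (\<Sum>x\<in>R-{0}. real q)"
    proof (rule sum.mono_neutral_cong_right)
      have dv: "int q dvd x \<longleftrightarrow> x = 0" if "x \<in> R" for x using that by (auto simp: R_def dest: zdvd_imp_le)
      show "\<forall>x\<in>R - (R - {0}). real q * (norm (\<chi> x))\<^sup>2 = 0" by (auto simp: norm_dirichlet_character[OF \<chi>(1) q])
      show "\<And>x. x \<in> R - {0} \<Longrightarrow> real q * (norm (\<chi> x))\<^sup>2 = real q" using dv by (auto simp: norm_dirichlet_character[OF \<chi>(1) q])
    qed (auto simp: R_def)
    also have "\<dots> = real (q - 1) * real q" using q3 by (simp add: R_def)
    also have "(\<Sum>k<q. (norm (c (int k)))\<^sup>2) = (\<Sum>k\<in>{..<q}-{0}. (norm (c 1))\<^sup>2)"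
      using c_norm c_0 by (intro sum.mono_neutral_cong_right) auto
    finally have "real (q - 1) * (norm (c 1))\<^sup>2 = real (q - 1) * real q" using q3 by simp
    then have "(norm (c 1))\<^sup>2 = real q" using q3 by simp
    then show ?thesis by (simp add: real_sqrt_unique)
  qed
  have inversion: "of_nat q * \<chi> m = (\<Sum>k<q. c (int k) * ek (int k * m))" for m
  proof -
    have "(\<Sum>k<q. c (int k) * ek (int k * m)) = (\<Sum>k<q. \<Sum>x\<in>R. \<chi> x * ek (int k * (m - x)))"
      unfolding c_def sum_distrib_right
      by (intro sum.cong refl) (simp only: right_diff_distrib ek_diff mult_ac)
    also have "\<dots> = (\<Sum>x\<in>R. \<Sum>k<q. \<chi> x * ek (int k * (m - x)))" by (rule sum.swap)
    also have "\<dots> = (\<Sum>x\<in>R. if x = m mod int q then of_nat q * \<chi> x else 0)"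
    proof (intro sum.cong refl)
      fix x assume x: "x \<in> R"
      have "int q dvd m - x \<longleftrightarrow> x = m mod int q"
        using x by (auto simp: R_def mod_eq_dvd_iff[symmetric])
      then show "(\<Sum>k<q. \<chi> x * ek (int k * (m - x))) = (if x = m mod int q then of_nat q * \<chi> x else 0)"
        by (simp add: orth flip: sum_distrib_left)
    qed
    also have "\<dots> = of_nat q * \<chi> (m mod int q)" using q3 by (simp add: R_def)
    also have "\<chi> (m mod int q) = \<chi> m" by (rule dirichlet_character_cong[OF \<chi>(1)]) (simp add: cong_def)
    finally show ?thesis ..
  qed
  define g where "g = (\<lambda>k. \<Sum>h\<in>{1..H}. ek (int k * (N + int h)))"
  have g: "norm (g k) \<le> real q * (1 / real k + 1 / real (q - k))" if k: "0 < k" "k < q" for k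
  proof -
    let ?z = "ek (int k)"
    have "g k = (\<Sum>h\<in>{1..H}. ek (int k * N) * ?z * ?z ^ (h - 1))"
      unfolding g_def
    proof (intro sum.cong refl)
      fix h assume "h \<in> {1..H}"
      then have "?z ^ h = ?z * ?z ^ (h - 1)" by (cases h) auto
      moreover have "int k * (N + int h) = int k * N + int h * int k" by (simp add: algebra_simps)
      ultimately show "ek (int k * (N + int h)) = ek (int k * N) * ?z * ?z ^ (h - 1)"
        by (simp only: ek_add ek_pow mult.assoc)
    qed
    also have "\<dots> = ek (int k * N) * ?z * (\<Sum>h<H. ?z ^ h)"
      unfolding sum_distrib_left by (rule sum.reindex_bij_witness[of _ Suc "\<lambda>h. h - 1"]) auto
    finally have "norm (g k) = norm (\<Sum>h<H. ?z ^ h)" by (simp add: norm_mult ek_norm)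
    also have "(\<Sum>h<H. ?z ^ h) = (?z ^ H - 1) / (?z - 1)"
      using ek_ne[OF k] by (simp add: geometric_sum)
    also have "norm \<dots> \<le> 2 / norm (?z - 1)"
    proof -
      have "norm (?z ^ H - 1) \<le> norm (?z ^ H) + norm (1::complex)" by (rule norm_triangle_ineq4)
      then show ?thesis by (simp add: norm_divide norm_power ek_norm divide_right_mono)
    qed
    also have "\<dots> \<le> real q * (1 / real k + 1 / real (q - k))" by (rule ek_far[OF k])
    finally show ?thesis .
  qed
  have "of_nat q * (\<Sum>h\<in>{1..H}. \<chi> (N + int h)) = (\<Sum>h\<in>{1..H}. \<Sum>k<q. c (int k) * ek (int k * (N + int h)))"
    by (simp add: sum_distrib_left inversion)
  also have "\<dots> = (\<Sum>k<q. c (int k) * g k)"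
    by (subst sum.swap) (simp add: g_def sum_distrib_left)
  also have "\<dots> = (\<Sum>k\<in>{1..<q}. c (int k) * g k)"
    using c_0 by (intro sum.mono_neutral_right) (auto simp: Suc_le_eq)
  finally have "real q * norm (\<Sum>h\<in>{1..H}. \<chi> (N + int h)) = norm (\<Sum>k\<in>{1..<q}. c (int k) * g k)"
    by (metis norm_mult norm_of_nat)
  also have "\<dots> \<le> (\<Sum>k\<in>{1..<q}. sqrt (real q) * (real q * (1 / real k + 1 / real (q - k))))"
    using g c_norm c_1 by (intro order_trans[OF norm_sum] sum_mono) (auto simp: norm_mult intro!: mult_left_mono)
  also have "\<dots> = sqrt (real q) * real q * ((\<Sum>k\<in>{1..<q}. 1 / real k) + (\<Sum>k\<in>{1..<q}. 1 / real (q - k)))"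
    by (simp add: sum_distrib_left sum.distrib distrib_left mult_ac)
  also have "(\<Sum>k\<in>{1..<q}. 1 / real (q - k)) = (\<Sum>k\<in>{1..<q}. 1 / real k)"
    by (rule sum.reindex_bij_witness[of _ "\<lambda>k. q - k" "\<lambda>k. q - k"]) auto
  also have "(\<Sum>k\<in>{1..<q}. 1 / real k) = harm (q - 1)"
    unfolding harm_def using q3 by (intro sum.cong) (auto simp: inverse_eq_divide)
  also have "sqrt (real q) * real q * (harm (q - 1) + harm (q - 1)) \<le> sqrt (real q) * real q * (4 * ln (real q))"
  proof (intro mult_left_mono)
    have "harm (q - 1) \<le> 1 + ln (real (q - 1))" using q3 by (intro harm_le) simp
    also have "\<dots> \<le> ln (real q) + ln (real q)" using q3 ln_ge_1[OF q3] by (intro add_mono) auto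
    finally show "harm (q - 1) + harm (q - 1) \<le> 4 * ln (real q)" by simp
  qed auto
  finally have "real q * norm (\<Sum>h\<in>{1..H}. \<chi> (N + int h)) \<le> real q * (4 * sqrt (real q) * ln (real q))"
    by (simp add: mult_ac)
  then show ?thesis using q3 by simp
qed

section \<open>Burgess' method\<close>

lemma power_weighted_sum_le:
  fixes \<nu> F :: "'i \<Rightarrow> real"
  assumes "finite I" "\<And>i. i \<in> I \<Longrightarrow> \<nu> i \<ge> 0" "\<And>i. i \<in> I \<Longrightarrow> F i \<ge> 0" "r > 0"
  shows "(\<Sum>i\<in>I. \<nu> i * F i) ^ r \<le> (\<Sum>i\<in>I. \<nu> i) ^ (r - 1) * (\<Sum>i\<in>I. \<nu> i * F i ^ r)"
proof (cases "(\<Sum>i\<in>I. \<nu> i) = 0")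
  case True
  then have "\<nu> i = 0" if "i \<in> I" for i using assms that by (simp add: sum_nonneg_eq_0_iff)
  then show ?thesis using assms by (simp add: zero_power)
next
  case False
  define s where "s = (\<Sum>i\<in>I. \<nu> i)"
  have "s \<ge> 0" unfolding s_def using assms by (intro sum_nonneg) auto
  then have s: "s > 0" using False by (simp add: s_def)
  have conv: "convex_on {0..} (\<lambda>x::real. x ^ r)"
    using convex_power_even[of r] convex_power_odd[of r] by (cases "even r") (auto intro: convex_on_subset)
  have "(\<Sum>i\<in>I. (\<nu> i / s) *\<^sub>R F i) ^ r \<le> (\<Sum>i\<in>I. (\<nu> i / s) * F i ^ r)"
    using assms s False
    by (intro convex_on_sum[OF _ _ conv]) (auto simp: s_def simp flip: sum_divide_distrib)
  also have "(\<Sum>i\<in>I. (\<nu> i / s) *\<^sub>R F i) = (\<Sum>i\<in>I. \<nu> i * F i) / s"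
    by (simp add: sum_divide_distrib)
  also have "(\<Sum>i\<in>I. (\<nu> i / s) * F i ^ r) = (\<Sum>i\<in>I. \<nu> i * F i ^ r) / s"
    by (simp add: sum_divide_distrib)
  finally have "(\<Sum>i\<in>I. \<nu> i * F i) ^ r \<le> (\<Sum>i\<in>I. \<nu> i * F i ^ r) / s * s ^ r"
    using s by (simp add: power_divide pos_divide_le_eq)
  also have "s ^ r = s * s ^ (r - 1)" using assms(4) by (cases r) auto
  finally show ?thesis using s by (simp add: s_def mult.commute)
qed

text \<open>Hoelder's inequality for integer exponents: Jensen for \<open>x ^ r\<close> with weights
  \<open>\<nu>\<close>, then Cauchy-Schwarz to separate \<open>\<nu>\<close> from
  \<open>F ^ r\<close>.\<close>

lemma weighted_moment_bound:
  fixes \<nu> F :: "'i \<Rightarrow> real"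
  assumes "finite I" "\<And>i. i \<in> I \<Longrightarrow> \<nu> i \<ge> 0" "\<And>i. i \<in> I \<Longrightarrow> F i \<ge> 0" "r > 0"
  shows "(\<Sum>i\<in>I. \<nu> i * F i) ^ (2 * r)
    \<le> (\<Sum>i\<in>I. \<nu> i) ^ (2 * r - 2) * (\<Sum>i\<in>I. (\<nu> i)\<^sup>2) * (\<Sum>i\<in>I. F i ^ (2 * r))"
proof -
  have "(\<Sum>i\<in>I. \<nu> i * F i) ^ (2 * r) = ((\<Sum>i\<in>I. \<nu> i * F i) ^ r)\<^sup>2"
    by (simp add: mult.commute flip: power_mult)
  also have "\<dots> \<le> ((\<Sum>i\<in>I. \<nu> i) ^ (r - 1) * (\<Sum>i\<in>I. \<nu> i * F i ^ r))\<^sup>2"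
    using assms by (intro power_mono power_weighted_sum_le zero_le_power sum_nonneg) auto
  also have "\<dots> = (\<Sum>i\<in>I. \<nu> i) ^ (2 * r - 2) * (\<Sum>i\<in>I. \<nu> i * F i ^ r)\<^sup>2"
  proof -
    have "(s ^ (r - 1))\<^sup>2 = s ^ (2 * r - 2)" for s :: real
      unfolding power_mult[symmetric] by (intro arg_cong2[where f = "(^)"]) auto
    then show ?thesis by (simp only: power_mult_distrib)
  qed
  also have "\<dots> \<le> (\<Sum>i\<in>I. \<nu> i) ^ (2 * r - 2) * ((\<Sum>i\<in>I. (\<nu> i)\<^sup>2) * (\<Sum>i\<in>I. (F i ^ r)\<^sup>2))"
    using assms by (intro mult_left_mono Cauchy_Schwarz_ineq_sum zero_le_power sum_nonneg) auto
  also have "(\<Sum>i\<in>I. (F i ^ r)\<^sup>2) = (\<Sum>i\<in>I. F i ^ (2 * r))"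
    by (intro sum.cong refl) (simp add: mult.commute flip: power_mult)
  finally show ?thesis unfolding mult.assoc .
qed

section \<open>The second moment of the representation counts\<close>

lemma card_congruent_subset:
  fixes d H :: nat
  assumes "F \<subseteq> {1..H}" "d > 0" "\<And>x y. x \<in> F \<Longrightarrow> y \<in> F \<Longrightarrow> [x = y] (mod d)"
  shows "card F \<le> H div d + 1"
proof -
  have "inj_on (\<lambda>x. x div d) F"
  proof (rule inj_onI)
    fix x y assume xy: "x \<in> F" "y \<in> F" "x div d = y div d"
    have m: "x mod d = y mod d" using assms(3)[OF xy(1,2)] unfolding cong_def .
    have "x = x div d * d + x mod d" by (rule div_mult_mod_eq[symmetric])
    also have "\<dots> = y" unfolding xy(3) m by (rule div_mult_mod_eq)
    finally show "x = y" .
  qed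
  then have "card F = card ((\<lambda>x. x div d) ` F)" by (simp add: card_image)
  also have "\<dots> \<le> card {..H div d}"
    using assms(1) by (intro card_mono) (auto intro!: div_le_mono)
  finally show ?thesis by simp
qed

text \<open>\<open>h1\<close> determines \<open>h2\<close>, and any two admissible \<open>h1\<close>
  differ by a multiple of \<open>a1 div gcd a1 a2\<close>.\<close>

lemma card_linear_solutions:
  fixes a1 a2 H :: nat and L :: int
  assumes "a1 > 0"
  shows "card {(h1, h2) \<in> {1..H} \<times> {1..H}. int a1 * int h2 - int a2 * int h1 = L} \<le> H div (a1 div gcd a1 a2) + 1"
proof -
  define F where "F = {(h1, h2) \<in> {1..H} \<times> {1..H}. int a1 * int h2 - int a2 * int h1 = L}"
  have "inj_on fst F" using assms by (auto simp: F_def inj_on_def)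
  then have "card F = card (fst ` F)" by (simp add: card_image)
  also have "\<dots> \<le> H div (a1 div gcd a1 a2) + 1"
  proof (rule card_congruent_subset)
    show "fst ` F \<subseteq> {1..H}" by (auto simp: F_def)
    have "gcd a1 a2 \<le> a1" using assms by (intro gcd_le1_nat) simp
    then show "a1 div gcd a1 a2 > 0" using assms by (simp add: div_greater_zero_iff)
    fix x y assume "x \<in> fst ` F" "y \<in> fst ` F"
    then obtain x' y' where "(x, x') \<in> F" "(y, y') \<in> F" by auto
    then have xy: "int a1 * int x' - int a2 * int x = L" "int a1 * int y' - int a2 * int y = L"
      by (auto simp: F_def)
    define g where "g = gcd a1 a2"
    have g0: "g > 0" using assms by (simp add: g_def)
    then have "\<exists>u v. a1 = u * g \<and> a2 = v * g \<and> coprime u v"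
      unfolding g_def by (intro gcd_coprime_exists) simp
    then obtain u v where uv: "a1 = u * g" "a2 = v * g" "coprime u v" by blast
    have "int a1 * (int x' - int y') = int a2 * (int x - int y)" using xy by (simp add: algebra_simps)
    then have "int g * (int u * (int x' - int y')) = int g * (int v * (int x - int y))"
      unfolding uv(1,2) of_nat_mult by (simp only: mult_ac)
    then have "int v * (int x - int y) = int u * (int x' - int y')" using g0 by simp
    then have "int u dvd int v * (int x - int y)" by simp
    then have "int u dvd int x - int y" using uv(3) by (simp add: coprime_dvd_mult_right_iff)
    then have "[x = y] (mod u)" by (simp add: cong_iff_dvd_diff flip: cong_int_iff)
    moreover have "a1 div g = u" using uv(1) g0 by simp
    ultimately show "[x = y] (mod (a1 div gcd a1 a2))" by (simp add: g_def)
  qed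
  finally show ?thesis by (simp add: F_def)
qed

text \<open>The congruence prescribes \<open>a1 * h2 - a2 * h1\<close> modulo \<open>q\<close>, and
  \<open>A * H \<le> q\<close> confines it strictly between \<open>- q\<close> and \<open>q\<close>.
  So it takes one of two integer values, which leaves two linear equations.\<close>

lemma card_congruent_products:
  fixes a1 a2 A H q :: nat and N :: int
  assumes a: "a1 \<in> {1..A}" "a2 \<in> {1..A}" and AH: "A * H \<le> q" and q: "q > 0"
  shows "card {(h1, h2) \<in> {1..H} \<times> {1..H}. int q dvd int a1 * (N + int h2) - int a2 * (N + int h1)}
    \<le> 2 * (H div (a1 div gcd a1 a2) + 1)"
proof -
  define c where "c = (int a2 - int a1) * N"
  define LL where "LL = {c mod int q, c mod int q - int q}"
  define F where "F = (\<lambda>L. {(h1, h2) \<in> {1..H} \<times> {1..H}. int a1 * int h2 - int a2 * int h1 = L})"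
  have sub: "{(h1, h2) \<in> {1..H} \<times> {1..H}. int q dvd int a1 * (N + int h2) - int a2 * (N + int h1)} \<subseteq> (\<Union>L\<in>LL. F L)"
  proof clarify
    fix h1 h2 assume h: "h1 \<in> {1..H}" "h2 \<in> {1..H}" and dvd: "int q dvd int a1 * (N + int h2) - int a2 * (N + int h1)"
    define L where "L = int a1 * int h2 - int a2 * int h1"
    have bd: "0 < int a1 * int h2 \<and> int a1 * int h2 \<le> int q" if "a1 \<in> {1..A}" "h2 \<in> {1..H}" for a1 h2 :: nat
    proof -
      have "a1 * h2 \<le> A * H" using that by (intro mult_le_mono) auto
      then have "a1 * h2 \<le> q" using AH by simp
      then have "int (a1 * h2) \<le> int q" by (simp only: of_nat_le_iff)
      then show ?thesis using that by simp
    qed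
    have L: "- int q < L" "L < int q" using bd[OF a(1) h(2)] bd[OF a(2) h(1)] by (auto simp: L_def)
    have "int q dvd L - c" using dvd by (simp add: L_def c_def algebra_simps)
    then have "L mod int q = c mod int q" by (simp add: mod_eq_dvd_iff)
    moreover have "L mod int q = (if L \<ge> 0 then L else L + int q)"
    proof (cases "L \<ge> 0")
      case False
      have "L mod int q = (L + int q) mod int q" by simp
      also have "\<dots> = L + int q" using L False by (intro mod_pos_pos_trivial) auto
      finally show ?thesis using False by simp
    qed (use L in simp)
    ultimately have "L \<in> LL" by (auto simp: LL_def split: if_splits)
    then show "(h1, h2) \<in> (\<Union>L\<in>LL. F L)" using h by (auto simp: F_def L_def)
  qed
  have fin: "finite (F L)" for L
    by (rule finite_subset[of _ "{1..H} \<times> {1..H}"]) (auto simp: F_def)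
  have "card {(h1, h2) \<in> {1..H} \<times> {1..H}. int q dvd int a1 * (N + int h2) - int a2 * (N + int h1)}
      \<le> card (\<Union>L\<in>LL. F L)"
    using fin by (intro card_mono sub) (auto simp: LL_def)
  also have "\<dots> \<le> (\<Sum>L\<in>LL. card (F L))" by (rule card_UN_le) (simp add: LL_def)
  also have "\<dots> \<le> (\<Sum>L\<in>LL. H div (a1 div gcd a1 a2) + 1)"
    unfolding F_def using a by (intro sum_mono card_linear_solutions) auto
  also have "\<dots> = card LL * (H div (a1 div gcd a1 a2) + 1)" by simp
  also have "\<dots> \<le> 2 * (H div (a1 div gcd a1 a2) + 1)"
    by (intro mult_le_mono1) (simp add: LL_def card_insert_if)
  finally show ?thesis .
qed

text \<open>The gcd is itself a common divisor \<open>g\<close>, hence at most the sum of all of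
  them. After this enlargement the sums over \<open>a1\<close> and \<open>a2\<close> separate and
  are at most \<open>harm A\<close> and \<open>A / g\<close>.\<close>

lemma sum_gcd_div_le:
  fixes A :: nat
  shows "(\<Sum>a1\<in>{1..A}. \<Sum>a2\<in>{1..A}. real (gcd a1 a2) / real a1) \<le> real A * (harm A)\<^sup>2"
proof -
  let ?I = "{1..A}"
  have "(\<Sum>a1\<in>?I. \<Sum>a2\<in>?I. real (gcd a1 a2) / real a1)
      \<le> (\<Sum>a1\<in>?I. \<Sum>a2\<in>?I. \<Sum>g\<in>?I. (if g dvd a1 then real g / real a1 else 0) * (if g dvd a2 then 1 else 0))"
  proof (intro sum_mono)
    fix a1 a2 assume a: "a1 \<in> ?I" "a2 \<in> ?I"
    have "gcd a1 a2 \<in> ?I" using a by (auto simp: Suc_le_eq intro: order_trans[OF gcd_le1_nat])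
    then have "(if gcd a1 a2 dvd a1 then real (gcd a1 a2) / real a1 else 0) * (if gcd a1 a2 dvd a2 then 1 else 0)
      \<le> (\<Sum>g\<in>?I. (if g dvd a1 then real g / real a1 else 0) * (if g dvd a2 then 1 else 0))"
      by (intro member_le_sum) auto
    then show "real (gcd a1 a2) / real a1 \<le> (\<Sum>g\<in>?I. (if g dvd a1 then real g / real a1 else 0) * (if g dvd a2 then 1 else 0))"
      by simp
  qed
  also have "\<dots> = (\<Sum>a1\<in>?I. \<Sum>g\<in>?I. \<Sum>a2\<in>?I. (if g dvd a1 then real g / real a1 else 0) * (if g dvd a2 then 1 else 0))"
    by (rule sum.cong[OF refl], rule sum.swap)
  also have "\<dots> = (\<Sum>g\<in>?I. \<Sum>a1\<in>?I. \<Sum>a2\<in>?I. (if g dvd a1 then real g / real a1 else 0) * (if g dvd a2 then 1 else 0))"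
    by (rule sum.swap)
  also have "\<dots> = (\<Sum>g\<in>?I. (\<Sum>a1\<in>?I. if g dvd a1 then real g / real a1 else 0) * (\<Sum>a2\<in>?I. if g dvd a2 then 1 else 0))"
    by (simp only: sum_product)
  also have "\<dots> \<le> (\<Sum>g\<in>?I. harm A * (real A / real g))"
  proof (intro sum_mono mult_mono)
    fix g assume g: "g \<in> ?I"
    have mult: "{a \<in> ?I. g dvd a} = (\<lambda>j. g * j) ` {1..A div g}"
    proof (intro equalityI subsetI)
      fix a assume "a \<in> {a \<in> ?I. g dvd a}"
      then obtain j where j: "a = g * j" "1 \<le> g * j" "g * j \<le> A" by (auto elim!: dvdE)
      then have "1 \<le> j" "j \<le> A div g" using g by (auto simp: less_eq_div_iff_mult_less_eq mult.commute Suc_le_eq)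
      then show "a \<in> (\<lambda>j. g * j) ` {1..A div g}" using j by auto
    next
      fix a assume "a \<in> (\<lambda>j. g * j) ` {1..A div g}"
      then show "a \<in> {a \<in> ?I. g dvd a}"
        using g by (auto simp: less_eq_div_iff_mult_less_eq mult.commute Suc_le_eq)
    qed
    have inj: "inj_on (\<lambda>j. g * j) {1..A div g}" using g by (auto intro: inj_onI)
    have "(\<Sum>a1\<in>?I. if g dvd a1 then real g / real a1 else 0) = (\<Sum>a1\<in>{a \<in> ?I. g dvd a}. real g / real a1)"
      by (rule sum.inter_filter[symmetric]) simp
    also have "\<dots> = (\<Sum>j\<in>{1..A div g}. 1 / real j)"
      unfolding mult using g by (subst sum.reindex[OF inj]) (auto intro!: sum.cong)
    also have "\<dots> \<le> (\<Sum>j\<in>?I. 1 / real j)" by (intro sum_mono2) (auto intro: order_trans[OF _ div_le_dividend])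
    also have "\<dots> = harm A" by (simp add: harm_def inverse_eq_divide)
    finally show "(\<Sum>a1\<in>?I. if g dvd a1 then real g / real a1 else 0) \<le> harm A" .
    have "(\<Sum>a2\<in>?I. if g dvd a2 then 1 else 0 :: real) = real (card {a \<in> ?I. g dvd a})"
      by (simp add: sum.If_cases Int_def)
    also have "\<dots> = real (A div g)" unfolding mult card_image[OF inj] by simp
    also have "\<dots> \<le> real A / real g" by (rule of_nat_div_le_of_nat)
    finally show "(\<Sum>a2\<in>?I. if g dvd a2 then 1 else 0 :: real) \<le> real A / real g" .
  qed (auto simp: harm_nonneg intro!: sum_nonneg)
  also have "\<dots> = real A * (harm A)\<^sup>2"
  proof -
    have h: "harm A = (\<Sum>g\<in>?I. 1 / real g)" by (simp add: harm_def inverse_eq_divide)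
    have "(\<Sum>g\<in>?I. harm A * (real A / real g)) = real A * harm A * (\<Sum>g\<in>?I. 1 / real g)"
      by (simp add: sum_distrib_left mult.commute)
    then show ?thesis unfolding h[symmetric] by (simp add: power2_eq_square)
  qed
  finally show ?thesis .
qed

text \<open>With \<open>y\<close> the quotient of \<open>N + h\<close> by \<open>a\<close> modulo
  \<open>q\<close>, a factor \<open>\<chi> a\<close> of norm 1 splits off and the inner sum depends
  on \<open>y\<close> alone.\<close>

lemma burgess_shift_sum:
  assumes \<chi>: "dirichlet_character q \<chi>" "\<chi> \<noteq> principal_character q" and q: "prime q"
    and A: "A < q" "A * H \<le> q" and B: "B < q" and r: "r > 0"
  shows "(\<Sum>a\<in>{1..A}. \<Sum>h\<in>{1..H}. norm (\<Sum>b\<in>{1..B}. \<chi> (N + int h + int a * int b))) ^ (2 * r)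
    \<le> (real A * real H) ^ (2 * r - 2) * (2 * (real A)\<^sup>2 + 2 * real H * real A * (harm A)\<^sup>2)
      * (real (r ^ (2*r)) * real B ^ r * real q + real (2*r) * real B ^ (2*r) * sqrt (real q))"
proof -
  define S where "S = {1..A} \<times> {1..H}"
  define R where "R = {0..<int q}"
  define T where "T = (\<lambda>x. norm (\<Sum>b\<in>{1..B}. \<chi> (x + int b)))"
  have qpos: "int q > 0" using prime_gt_0_nat[OF q] by simp
  have "\<exists>a'. [int a * a' = 1] (mod int q)" if a: "a \<in> {1..A}" for a
  proof -
    have "\<not> q dvd a" using a A by (auto dest: dvd_imp_le)
    then have "coprime q a" using prime_imp_coprime[OF q] by simp
    then have "coprime (int a) (int q)" by (simp add: coprime_commute)
    then show ?thesis by (rule cong_solve_coprime_int)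
  qed
  then obtain iv where iv: "\<And>a. a \<in> {1..A} \<Longrightarrow> [int a * iv a = 1] (mod int q)" by metis
  define y where "y = (\<lambda>(a, h). (iv a * (N + int h)) mod int q)"
  have y_cong: "[int a * y (a, h) = N + int h] (mod int q)" if "a \<in> {1..A}" for a h
  proof -
    have "[int a * y (a, h) = int a * (iv a * (N + int h))] (mod int q)"
      by (intro cong_mult) (simp_all add: y_def cong_def)
    moreover have "[int a * iv a * (N + int h) = 1 * (N + int h)] (mod int q)"
      using iv[OF that] by (intro cong_mult) simp_all
    ultimately show ?thesis by (metis cong_trans mult.assoc mult_1)
  qed
  have yR: "y ` S \<subseteq> R" using qpos by (auto simp: y_def R_def)
  have fin: "finite S" "finite R" by (auto simp: S_def R_def)
  define \<nu> where "\<nu> = (\<lambda>x. card {s \<in> S. y s = x})"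
  have tm: "norm (\<Sum>b\<in>{1..B}. \<chi> (N + int h + int a * int b)) = T (y (a, h))" if a: "a \<in> {1..A}" for a h
  proof -
    have "\<chi> (N + int h + int a * int b) = \<chi> (int a) * \<chi> (y (a, h) + int b)" for b
    proof -
      have "[int a * (y (a, h) + int b) = N + int h + int a * int b] (mod int q)"
        unfolding distrib_left using y_cong[OF a, of h] by (intro cong_add) auto
      then have "\<chi> (int a * (y (a, h) + int b)) = \<chi> (N + int h + int a * int b)"
        by (rule dirichlet_character_cong[OF \<chi>(1)])
      then show ?thesis by (simp add: dirichlet_character_mult[OF \<chi>(1)])
    qed
    then have "(\<Sum>b\<in>{1..B}. \<chi> (N + int h + int a * int b)) = \<chi> (int a) * (\<Sum>b\<in>{1..B}. \<chi> (y (a, h) + int b))"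
      by (simp add: sum_distrib_left)
    moreover have "\<not> int q dvd int a" using a A by (auto dest: dvd_imp_le)
    ultimately show ?thesis by (simp add: norm_mult T_def norm_dirichlet_character[OF \<chi>(1) q])
  qed
  have "(\<Sum>a\<in>{1..A}. \<Sum>h\<in>{1..H}. norm (\<Sum>b\<in>{1..B}. \<chi> (N + int h + int a * int b))) = (\<Sum>s\<in>S. T (y s))"
  proof -
    have "(\<Sum>a\<in>{1..A}. \<Sum>h\<in>{1..H}. norm (\<Sum>b\<in>{1..B}. \<chi> (N + int h + int a * int b))) = (\<Sum>a\<in>{1..A}. \<Sum>h\<in>{1..H}. T (y (a, h)))"
      by (intro sum.cong refl tm)
    then show ?thesis by (simp add: S_def sum.cartesian_product case_prod_unfold)
  qed
  also have "\<dots> = (\<Sum>x\<in>R. \<Sum>s\<in>{s \<in> S. y s = x}. T (y s))"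
    by (rule sum.group[OF fin yR, symmetric])
  also have "\<dots> = (\<Sum>x\<in>R. real (\<nu> x) * T x)"
    by (intro sum.cong refl) (simp add: \<nu>_def)
  finally have V: "(\<Sum>a\<in>{1..A}. \<Sum>h\<in>{1..H}. norm (\<Sum>b\<in>{1..B}. \<chi> (N + int h + int a * int b))) = (\<Sum>x\<in>R. real (\<nu> x) * T x)" .
  have nu1: "(\<Sum>x\<in>R. real (\<nu> x)) = real A * real H"
  proof -
    have "(\<Sum>x\<in>R. \<nu> x) = card S"
      using sum.group[OF fin yR, of "\<lambda>_. 1::nat"] by (simp add: \<nu>_def)
    then show ?thesis by (simp add: S_def flip: of_nat_sum)
  qed
  have nu2: "(\<Sum>x\<in>R. (real (\<nu> x))\<^sup>2) \<le> 2 * (real A)\<^sup>2 + 2 * real H * real A * (harm A)\<^sup>2"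
  proof -
    define c where "c = (\<lambda>a1 a2. card {(h1, h2) \<in> {1..H} \<times> {1..H}. int q dvd int a1 * (N + int h2) - int a2 * (N + int h1)})"
    \<comment> \<open>The second moment counts pairs with equal quotient; cross-multiplication turns
      this into the congruence of \<open>card_congruent_products\<close>.\<close>
    have "(\<Sum>x\<in>R. (\<nu> x)\<^sup>2) = (\<Sum>x\<in>R. \<Sum>s\<in>{s \<in> S. y s = x}. \<nu> (y s))"
      by (intro sum.cong refl) (simp add: \<nu>_def power2_eq_square)
    also have "\<dots> = (\<Sum>s\<in>S. \<nu> (y s))" by (rule sum.group[OF fin yR])
    also have "\<dots> = (\<Sum>s\<in>S. \<Sum>t\<in>S. if y t = y s then 1 else 0)"
      using fin by (simp add: \<nu>_def sum.If_cases Int_def)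
    also have "\<dots> = (\<Sum>a1\<in>{1..A}. \<Sum>h1\<in>{1..H}. \<Sum>a2\<in>{1..A}. \<Sum>h2\<in>{1..H}. if y (a2, h2) = y (a1, h1) then 1 else 0)"
    proof -
      have "(\<Sum>s\<in>S. F s) = (\<Sum>a\<in>{1..A}. \<Sum>h\<in>{1..H}. F (a, h))" for F :: "nat \<times> nat \<Rightarrow> nat"
        by (simp add: S_def sum.cartesian_product case_prod_unfold)
      then show ?thesis by (simp only:)
    qed
    also have "\<dots> = (\<Sum>a1\<in>{1..A}. \<Sum>a2\<in>{1..A}. \<Sum>h1\<in>{1..H}. \<Sum>h2\<in>{1..H}. if y (a2, h2) = y (a1, h1) then 1 else 0)"
      by (rule sum.cong[OF refl], rule sum.swap)
    also have "\<dots> \<le> (\<Sum>a1\<in>{1..A}. \<Sum>a2\<in>{1..A}. c a1 a2)"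
    proof (intro sum_mono)
      fix a1 a2 assume a: "a1 \<in> {1..A}" "a2 \<in> {1..A}"
      have "(\<Sum>h1\<in>{1..H}. \<Sum>h2\<in>{1..H}. if y (a2, h2) = y (a1, h1) then 1 else 0)
          = (\<Sum>p\<in>{1..H} \<times> {1..H}. if y (a2, snd p) = y (a1, fst p) then 1 else 0)"
        by (simp only: sum.cartesian_product case_prod_unfold)
      also have "\<dots> = card {p \<in> {1..H} \<times> {1..H}. y (a2, snd p) = y (a1, fst p)}"
        by (simp add: sum.If_cases Int_def)
      also have "\<dots> \<le> c a1 a2"
        unfolding c_def
      proof (intro card_mono)
        show "finite {(h1, h2) \<in> {1..H} \<times> {1..H}. int q dvd int a1 * (N + int h2) - int a2 * (N + int h1)}"
          by (rule finite_subset[of _ "{1..H} \<times> {1..H}"]) auto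
        have "int q dvd int a1 * (N + int h2) - int a2 * (N + int h1)" if "y (a2, h2) = y (a1, h1)" for h1 h2
        proof -
          have 1: "[int a1 * (int a2 * y (a2, h2)) = int a1 * (N + int h2)] (mod int q)"
            using y_cong[OF a(2), of h2] by (intro cong_mult) auto
          have 2: "[int a2 * (int a1 * y (a1, h1)) = int a2 * (N + int h1)] (mod int q)"
            using y_cong[OF a(1), of h1] by (intro cong_mult) auto
          have "int a1 * (int a2 * y (a2, h2)) = int a2 * (int a1 * y (a1, h1))"
            unfolding that by (simp only: mult_ac)
          then have "[int a1 * (N + int h2) = int a2 * (N + int h1)] (mod int q)"
            using 1 2 by (metis cong_sym cong_trans)
          then show ?thesis by (simp add: cong_iff_dvd_diff)
        qed
        then show "{p \<in> {1..H} \<times> {1..H}. y (a2, snd p) = y (a1, fst p)}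
            \<subseteq> {(h1, h2) \<in> {1..H} \<times> {1..H}. int q dvd int a1 * (N + int h2) - int a2 * (N + int h1)}" by auto
      qed
      finally show "(\<Sum>h1\<in>{1..H}. \<Sum>h2\<in>{1..H}. if y (a2, h2) = y (a1, h1) then 1 else 0) \<le> c a1 a2" .
    qed
    finally have "(\<Sum>x\<in>R. (\<nu> x)\<^sup>2) \<le> (\<Sum>a1\<in>{1..A}. \<Sum>a2\<in>{1..A}. c a1 a2)" .
    then have "(\<Sum>x\<in>R. (real (\<nu> x))\<^sup>2) \<le> (\<Sum>a1\<in>{1..A}. \<Sum>a2\<in>{1..A}. real (c a1 a2))"
      by (simp flip: of_nat_sum of_nat_power)
    also have "\<dots> \<le> (\<Sum>a1\<in>{1..A}. \<Sum>a2\<in>{1..A}. 2 * real H * (real (gcd a1 a2) / real a1) + 2)"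
    proof (intro sum_mono)
      fix a1 a2 assume a: "a1 \<in> {1..A}" "a2 \<in> {1..A}"
      have "c a1 a2 \<le> 2 * (H div (a1 div gcd a1 a2) + 1)"
        unfolding c_def using a A qpos by (intro card_congruent_products) auto
      then have "real (c a1 a2) \<le> real (2 * (H div (a1 div gcd a1 a2) + 1))" by (simp only: of_nat_le_iff)
      also have "\<dots> = 2 * real (H div (a1 div gcd a1 a2)) + 2" by simp
      also have "real (H div (a1 div gcd a1 a2)) \<le> real H / real (a1 div gcd a1 a2)" by (rule of_nat_div_le_of_nat)
      also have "real (a1 div gcd a1 a2) = real a1 / real (gcd a1 a2)" by (intro real_of_nat_div) simp
      finally show "real (c a1 a2) \<le> 2 * real H * (real (gcd a1 a2) / real a1) + 2" by simp
    qed
    also have "\<dots> = 2 * real H * (\<Sum>a1\<in>{1..A}. \<Sum>a2\<in>{1..A}. real (gcd a1 a2) / real a1) + 2 * (real A)\<^sup>2"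
      by (simp add: sum.distrib sum_distrib_left power2_eq_square)
    also have "\<dots> \<le> 2 * real H * (real A * (harm A)\<^sup>2) + 2 * (real A)\<^sup>2"
      by (intro add_mono mult_left_mono sum_gcd_div_le) auto
    finally show ?thesis by simp
  qed
  have "(\<Sum>x\<in>R. real (\<nu> x) * T x) ^ (2 * r)
      \<le> (\<Sum>x\<in>R. real (\<nu> x)) ^ (2 * r - 2) * (\<Sum>x\<in>R. (real (\<nu> x))\<^sup>2) * (\<Sum>x\<in>R. T x ^ (2 * r))"
    using fin r by (intro weighted_moment_bound) (auto simp: T_def)
  also have "\<dots> \<le> (real A * real H) ^ (2 * r - 2) * (2 * (real A)\<^sup>2 + 2 * real H * real A * (harm A)\<^sup>2)
      * (real (r ^ (2*r)) * real B ^ r * real q + real (2*r) * real B ^ (2*r) * sqrt (real q))"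
    unfolding nu1 using nu2 character_moment_bound[OF \<chi> q B, of r]
    by (intro mult_mono mult_nonneg_nonneg sum_nonneg) (auto simp: R_def T_def sum_nonneg)
  finally show ?thesis unfolding V .
qed

text \<open>The choice of parameters in the main step, with \<open>n = 2r\<close>, \<open>Q1 = q powr (1/n)\<close> and \<open>sq = sqrt q\<close>.\<close>
lemma burgess_arithmetic:
  fixes A B H q sq Q1 L G c V C :: real and n :: nat
  assumes n: "n \<ge> 2" and V: "V ^ n \<le> 10 * C * L\<^sup>2 * (A * H) ^ (n - 1) * (q * sq)"
    and G: "G ^ n = H ^ (n - 2) * (sq * Q1)" and Q1: "Q1 ^ n = q"
    and AB: "H / 18 \<le> A * B" and B: "Q1 / 2 \<le> B" and L: "L \<ge> 1"
    and pos: "A > 0" "H > 0" "sq > 0" "Q1 > 0" "C \<ge> 1" "G > 0" and c: "c = 180 * C * 2 ^ n"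
  shows "V \<le> A * B * c * G * L\<^sup>2"
proof -
  have c1: "c \<ge> 1"
  proof -
    have "1 * 1 \<le> C * 2 ^ n" using pos by (intro mult_mono) auto
    then show ?thesis by (simp add: c)
  qed
  have Bpos: "B > 0" using B pos by linarith
  have "10 * C * L\<^sup>2 * (H * (q * sq)) \<le> (A * B) * B ^ (n - 1) * c ^ n * (sq * Q1) * (L\<^sup>2) ^ n"
  proof -
    have "Q1 * Q1 ^ (n - 1) = q" using Q1 n by (cases n) auto
    then have qe: "q = 2 * 2 ^ (n - 1) * (Q1 / 2) ^ (n - 1) * (Q1 / 2)" by (simp add: power_divide mult.commute)
    have two: "(2::real) ^ n = 2 * 2 ^ (n - 1)" using n by (cases n) auto
    \<comment> \<open>Origin of \<open>c\<close>: the 10 belongs to the hypothesis on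
      \<open>V\<close>, the 18 to \<open>A * B \<ge> H / 18\<close>, and \<open>2 ^ n\<close> to
      \<open>B \<ge> Q1 / 2\<close>.\<close>
    have "10 * C * (H * q) = (H / 18) * (Q1 / 2) ^ (n - 1) * (180 * C * 2 ^ n) * (Q1 / 2)"
      unfolding qe two by (simp add: field_simps)
    also have "\<dots> \<le> (H / 18) * (Q1 / 2) ^ (n - 1) * (180 * C * 2 ^ n) * Q1"
      using pos by (intro mult_left_mono) auto
    also have "\<dots> \<le> (A * B) * B ^ (n - 1) * (180 * C * 2 ^ n) * Q1"
      using AB B pos Bpos by (intro mult_mono power_mono) auto
    also have "180 * C * 2 ^ n \<le> c ^ n"
      using c1 n self_le_power[of c n] by (simp flip: c)
    finally have 1: "10 * C * (H * q) \<le> (A * B) * B ^ (n - 1) * c ^ n * Q1"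
      using pos Bpos by (simp add: mult_left_mono mult_right_mono)
    have "L\<^sup>2 \<le> (L\<^sup>2) ^ n" using L n by (intro self_le_power) auto
    then have 2: "sq * L\<^sup>2 \<le> sq * (L\<^sup>2) ^ n" using pos by (intro mult_left_mono) auto
    have "10 * C * (H * q) * (sq * L\<^sup>2) \<le> (A * B) * B ^ (n - 1) * c ^ n * Q1 * (sq * (L\<^sup>2) ^ n)"
    proof (rule mult_mono[OF 1 2])
      show "0 \<le> (A * B) * B ^ (n - 1) * c ^ n * Q1" using pos Bpos c1 by simp
      show "0 \<le> sq * L\<^sup>2" using pos by simp
    qed
    then show ?thesis by (simp only: mult_ac)
  qed
  then have "(A ^ (n - 1) * H ^ (n - 2)) * (10 * C * L\<^sup>2 * (H * (q * sq)))
      \<le> (A ^ (n - 1) * H ^ (n - 2)) * ((A * B) * B ^ (n - 1) * c ^ n * (sq * Q1) * (L\<^sup>2) ^ n)"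
    using pos by (intro mult_left_mono) auto
  moreover have "H ^ (n - 1) = H ^ (n - 2) * H" "A ^ n = A ^ (n - 1) * A" "B ^ n = B ^ (n - 1) * B"
    using n power_Suc2[of H "n - 2"] power_Suc2[of A "n - 1"] power_Suc2[of B "n - 1"] by (simp_all add: Suc_diff_Suc numeral_2_eq_2)
  ultimately have "V ^ n \<le> (A * B * c * G * L\<^sup>2) ^ n"
    using V unfolding power_mult_distrib G by (simp only: mult_ac)
  then show ?thesis
    using n pos Bpos c1 by (intro power_le_imp_le_base[of V "n - 1"]) (auto simp: Suc_diff_Suc)
qed

section \<open>Induction on the length of the interval\<close>

lemma sum_shift_interval:
  fixes f :: "int \<Rightarrow> 'a::ab_group_add"
  shows "(\<Sum>h\<in>{1..H}. f (N + int h)) = (\<Sum>h\<in>{1..H}. f (N + int k + int h))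
    + ((\<Sum>h\<in>{1..k}. f (N + int h)) - (\<Sum>h\<in>{1..k}. f (N + int H + int h)))"
proof -
  have concat: "(\<Sum>h\<in>{1..m}. f (M + int h)) + (\<Sum>h\<in>{1..l}. f (M + int m + int h)) = (\<Sum>h\<in>{1..m + l}. f (M + int h))" for m l M
  proof (induction l)
    case (Suc l)
    have "(\<Sum>h\<in>{1..m}. f (M + int h)) + (\<Sum>h\<in>{1..Suc l}. f (M + int m + int h))
        = (\<Sum>h\<in>{1..m}. f (M + int h)) + (\<Sum>h\<in>{1..l}. f (M + int m + int h)) + f (M + int (Suc (m + l)))"
      by (simp add: add_ac)
    then show ?case unfolding Suc.IH by simp
  qed simp
  from concat[of N H k] concat[of N k H] show ?thesis by (simp add: algebra_simps)
qed

text \<open>The leading 3 closes the induction: the averaged term and each of the two boundary sums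
  contribute one third. Boundary sums have length at most \<open>H / 9\<close>, and
  \<open>9 powr (1 - 1 / r) \<ge> 3\<close> compensates the 3 in the induction hypothesis; this is
  where \<open>r \<ge> 2\<close> is used.\<close>

lemma burgess_bound:
  fixes q r H :: nat
  assumes \<chi>: "dirichlet_character q \<chi>" "\<chi> \<noteq> principal_character q" and q: "prime q"
    and r: "r \<ge> 2" and H: "H \<ge> 1"
  shows "norm (\<Sum>h\<in>{1..H}. \<chi> (N + int h)) \<le> 3 * (180 * (real (r ^ (2*r)) + real (2*r)) * 2 ^ (2*r))
    * (real H powr (1 - 1 / real r) * real q powr ((real r + 1) / (4 * (real r)\<^sup>2))) * (ln (real q))\<^sup>2"
  using H
proof (induction H arbitrary: N rule: less_induct)
  case (less H)
  define C where "C = real (r ^ (2*r)) + real (2*r)"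
  define c where "c = 180 * C * 2 ^ (2*r)"
  define L where "L = ln (real q)"
  define Q1 where "Q1 = real q powr (1 / (2 * real r))"
  define sq where "sq = sqrt (real q)"
  define g where "g = real q powr ((real r + 1) / (4 * (real r)\<^sup>2))"
  define G where "G = (\<lambda>H. real H powr (1 - 1 / real r) * g)"
  define S where "S = (\<lambda>N H. \<Sum>h\<in>{1..H}. \<chi> (N + int h))"
  have q3: "q \<ge> 3" by (rule nonprincipal_modulus_ge_3[OF \<chi> q])
  have L: "L \<ge> 1" unfolding L_def by (rule ln_ge_1[OF q3])
  have q1: "real q \<ge> 1" "real q > 1" using q3 by auto
  have rr: "real r \<ge> 2" using r by simp
  have IH: "norm (S N k) \<le> 3 * c * G k * L\<^sup>2" if "k < H" "k \<ge> 1" for N k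
    using less.IH[OF that] by (simp only: S_def c_def C_def G_def g_def L_def)
  have C1: "C \<ge> 1" using rr of_nat_0_le_iff[of "r ^ (2*r)", where 'a = real]
    unfolding C_def of_nat_mult of_nat_numeral by linarith
  have c180: "c \<ge> 180"
  proof -
    have "1 * 1 \<le> C * 2 ^ (2*r)" using C1 by (intro mult_mono) auto
    then show ?thesis by (simp add: c_def)
  qed
  have Hpos: "real H > 0" using less.prems by simp
  have gpos: "g > 0" using q1 by (simp add: g_def)
  have Gpos: "G H > 0" using Hpos gpos by (simp add: G_def)
  have GL: "x * G H * L\<^sup>2 \<le> 3 * c * G H * L\<^sup>2" if "x \<le> 18" for x
    using that c180 Gpos by (intro mult_right_mono) auto
  have "norm (S N H) \<le> 3 * c * G H * L\<^sup>2"
  \<comment> \<open>Here the trivial bound \<open>H\<close> is enough. In the other case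
    \<open>H > 18 * Q1\<close>, so rounding \<open>A\<close> down still leaves
    \<open>A * B \<ge> H / 18\<close>.\<close>
  proof (cases "real H \<le> 18 * real q powr ((real r + 1) / (4 * real r))")
    case True
    have "norm (S N H) \<le> (\<Sum>h\<in>{1..H}. 1)"
      unfolding S_def by (rule order_trans[OF norm_sum], rule sum_mono) (simp add: norm_dirichlet_character[OF \<chi>(1) q])
    also have "\<dots> = real H powr (1 - 1 / real r) * real H powr (1 / real r)"
      using Hpos by (simp flip: powr_add)
    also have "\<dots> \<le> real H powr (1 - 1 / real r) * (18 * g)"
    proof (intro mult_left_mono)
      have "real H powr (1 / real r) \<le> (18 * real q powr ((real r + 1) / (4 * real r))) powr (1 / real r)"
        using True by (intro powr_mono2) auto
      also have "\<dots> = 18 powr (1 / real r) * g"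
        by (simp add: powr_mult powr_powr g_def power2_eq_square mult.assoc)
      also have "\<dots> \<le> 18 powr 1 * g"
        using rr gpos by (intro mult_right_mono powr_mono) auto
      finally show "real H powr (1 / real r) \<le> 18 * g" by simp
    qed auto
    also have "\<dots> = 18 * G H * 1" by (simp add: G_def)
    also have "\<dots> \<le> 18 * G H * L\<^sup>2" using L Gpos by (intro mult_left_mono) auto
    also have "\<dots> \<le> 3 * c * G H * L\<^sup>2" by (rule GL) simp
    finally show ?thesis .
  next
    case large: False
    show ?thesis
    \<comment> \<open>At this threshold the claimed bound reaches \<open>sqrt q\<close>, so
      Polya-Vinogradov takes over. Below it the square of \<open>H\<close> is at most
      \<open>q * Q1\<close>, which yields \<open>A * H \<le> q\<close>.\<close>
    proof (cases "real H \<ge> real q powr (1/2 + 1 / (4 * real r))")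
      case True
      have "sq = real q powr (1/2)" using q1 by (simp add: sq_def powr_half_sqrt)
      also have "1/2 = (1/2 + 1 / (4 * real r)) * (1 - 1 / real r) + (real r + 1) / (4 * (real r)\<^sup>2)"
        using rr by (simp add: field_simps power2_eq_square)
      also have "real q powr \<dots> = (real q powr (1/2 + 1 / (4 * real r))) powr (1 - 1 / real r) * g"
        unfolding powr_powr g_def by (rule powr_add)
      also have "\<dots> \<le> real H powr (1 - 1 / real r) * g"
        using True rr gpos by (intro mult_right_mono powr_mono2) auto
      finally have "sq \<le> G H" by (simp add: G_def)
      have "norm (S N H) \<le> 4 * sq * L"
        unfolding S_def sq_def L_def by (rule polya_vinogradov[OF \<chi> q])
      also have "\<dots> \<le> 4 * G H * L\<^sup>2"
        using \<open>sq \<le> G H\<close> L Gpos by (intro mult_mono) (auto simp: power2_eq_square sq_def)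
      also have "\<dots> \<le> 3 * c * G H * L\<^sup>2" by (rule GL) simp
      finally show ?thesis .
    next
      case False
      \<comment> \<open>\<open>Q1\<close> balances the two terms of the moment bound:
        \<open>B ^ r\<close> is about \<open>sqrt q\<close>, and both terms have order
        \<open>q * sqrt q\<close>.\<close>
      define B where "B = nat \<lfloor>Q1\<rfloor>"
      define A where "A = H div (9 * B)"
      have Q1: "Q1 \<ge> 1" unfolding Q1_def using q1 by (intro ge_one_powr_ge_zero) auto
      have BQ: "real B \<le> Q1" "Q1 < real B + 1" "B \<ge> 1"
        using Q1 by (simp_all add: B_def le_nat_iff le_floor_iff)
      have Q1B: "Q1 / 2 \<le> real B" using BQ by linarith
      have powQ: "(real q powr x) ^ n = real q powr (x * real n)" for x n
        using q1 by (simp add: powr_realpow[symmetric] powr_powr)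
      have Q1n: "Q1 ^ (2*r) = real q" and Q1r: "Q1 ^ r = sq"
        using rr q1 by (simp_all add: Q1_def powQ sq_def powr_half_sqrt[symmetric] field_simps)
      have sqsq: "sq * sq = real q" "sq > 0" using q1 by (auto simp: sq_def)
      have "Q1 \<le> real q powr ((real r + 1) / (4 * real r))"
        unfolding Q1_def using q1 rr by (intro powr_mono) (auto simp: field_simps)
      then have HQ: "real H > 18 * Q1" using large by linarith
      have A9: "A * (9 * B) \<le> H" by (simp add: A_def)
      have "H < (A + 1) * (9 * B)"
        using BQ(3) dividend_less_div_times[of "9 * B" H] by (simp add: A_def)
      then have "real H < real ((A + 1) * (9 * B))" by (simp only: of_nat_less_iff)
      then have "real H < (real A + 1) * (9 * real B)"
        by (simp only: of_nat_mult of_nat_add of_nat_1 of_nat_numeral)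
      then have AB: "real H / 18 \<le> real A * real B" using HQ BQ(1) by (simp add: algebra_simps)
      have "real (A * (9 * B)) \<le> real H" using A9 by (simp only: of_nat_le_iff)
      then have A9': "real A * real B * 9 \<le> real H" by simp
      have Apos: "A > 0" using AB Hpos by (cases "A = 0") auto
      have "real H < real q powr 1"
        using False q1 rr by (intro less_le_trans[OF _ powr_mono[of "1/2 + 1 / (4 * real r)" 1]]) (auto simp: field_simps)
      then have Hq: "H < q" using q1 by simp
      have "A \<le> H" by (simp add: A_def)
      then have Aq: "A < q" using Hq by simp
      have "Q1 < real q powr 1" unfolding Q1_def using q1 rr by (intro powr_less_mono) auto
      then have Bq: "B < q" using BQ(1) q1 by simp
      have AH: "A * H \<le> q"
      proof -
        have "real H * real H \<le> real q powr (1/2 + 1 / (4 * real r)) * real q powr (1/2 + 1 / (4 * real r))"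
          using False by (intro mult_mono) auto
        also have "\<dots> = real q powr (1 + 1 / (2 * real r))"
          by (simp flip: powr_add)
        also have "\<dots> = real q * Q1" using q1 by (simp add: powr_add Q1_def)
        also have "\<dots> \<le> real q * (2 * real B)" using Q1B by (intro mult_left_mono) auto
        finally have "real H * real H \<le> real q * (2 * real B)" .
        moreover have "(real A * real B * 9) * real H \<le> real H * real H" using A9' by (intro mult_right_mono) auto
        ultimately have "(9 * (real A * real H)) * real B \<le> (2 * real q) * real B" by (simp add: mult_ac)
        then have "9 * (real A * real H) \<le> 2 * real q" using BQ(3) by simp
        then have "real A * real H \<le> real q" by simp
        then show ?thesis by (simp flip: of_nat_mult)
      qed
      define V where "V = (\<Sum>a\<in>{1..A}. \<Sum>h\<in>{1..H}. norm (\<Sum>b\<in>{1..B}. \<chi> (N + int h + int a * int b)))"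
      have n1: "2 * r - 1 = Suc (2 * r - 2)" using r by simp
      have "V ^ (2*r) \<le> (real A * real H) ^ (2 * r - 2) * (2 * (real A)\<^sup>2 + 2 * real H * real A * (harm A)\<^sup>2)
        * (real (r ^ (2*r)) * real B ^ r * real q + real (2*r) * real B ^ (2*r) * sqrt (real q))"
        unfolding V_def using r by (intro burgess_shift_sum[OF \<chi> q Aq AH Bq]) simp
      \<comment> \<open>The 10 is 2 from the diagonal term, by \<open>A \<le> H\<close>, plus 8 from
        \<open>harm A \<le> 2 * L\<close>.\<close>
      also have "\<dots> \<le> (real A * real H) ^ (2 * r - 2) * (10 * (real A * real H) * L\<^sup>2) * (C * (real q * sq))"
      proof (intro mult_mono mult_nonneg_nonneg)
        have "harm A \<le> 1 + ln (real A)" using Apos by (rule harm_le)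
        also have "ln (real A) \<le> L" unfolding L_def using Apos Aq by simp
        finally have "harm A \<le> 2 * L" using L by simp
        then have "(harm A)\<^sup>2 \<le> (2 * L)\<^sup>2" by (intro power_mono harm_nonneg)
        then have "2 * real H * real A * (harm A)\<^sup>2 \<le> 2 * real H * real A * (4 * L\<^sup>2)"
          by (intro mult_left_mono) (auto simp: power_mult_distrib)
        moreover have "(real A)\<^sup>2 \<le> (real A * real H) * L\<^sup>2"
        proof -
          have "real A * real A \<le> real A * real H" using \<open>A \<le> H\<close> by (intro mult_left_mono) auto
          also have "\<dots> * 1 \<le> (real A * real H) * L\<^sup>2" using L by (intro mult_left_mono) auto
          finally show ?thesis by (simp add: power2_eq_square)
        qed
        ultimately show "2 * (real A)\<^sup>2 + 2 * real H * real A * (harm A)\<^sup>2 \<le> 10 * (real A * real H) * L\<^sup>2"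
          by (simp add: algebra_simps)
        have "real B ^ r \<le> sq" using BQ(1) by (simp add: power_mono flip: Q1r)
        then have "real (r ^ (2*r)) * real B ^ r * real q \<le> real (r ^ (2*r)) * sq * real q"
          by (intro mult_left_mono mult_right_mono) auto
        moreover have "real B ^ (2*r) \<le> real q" using BQ(1) by (simp add: power_mono flip: Q1n)
        then have "real (2*r) * real B ^ (2*r) * sq \<le> real (2*r) * real q * sq"
          using sqsq by (intro mult_left_mono mult_right_mono) auto
        ultimately show "real (r ^ (2*r)) * real B ^ r * real q + real (2*r) * real B ^ (2*r) * sqrt (real q) \<le> C * (real q * sq)"
          unfolding C_def sq_def[symmetric] by (simp add: algebra_simps)
      qed (auto simp: harm_nonneg)
      also have "\<dots> = 10 * C * L\<^sup>2 * (real A * real H) ^ (2 * r - 1) * (real q * sq)"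
        unfolding n1 power_Suc by (simp only: mult_ac)
      finally have V: "V ^ (2*r) \<le> 10 * C * L\<^sup>2 * (real A * real H) ^ (2 * r - 1) * (real q * sq)" .
      have Gn: "G H ^ (2*r) = real H ^ (2*r - 2) * (sq * Q1)"
      proof -
        have "(real H powr (1 - 1 / real r)) ^ (2*r) = real H powr ((1 - 1 / real r) * real (2*r))"
          using Hpos by (simp add: powr_realpow[symmetric] powr_powr)
        also have "(1 - 1 / real r) * real (2*r) = real (2*r - 2)" using r by (simp add: field_simps of_nat_diff)
        also have "real H powr \<dots> = real H ^ (2*r - 2)" using Hpos by (rule powr_realpow)
        finally have 1: "(real H powr (1 - 1 / real r)) ^ (2*r) = real H ^ (2*r - 2)" .
        have "g ^ (2*r) = real q powr ((real r + 1) / (4 * (real r)\<^sup>2) * real (2*r))"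
          unfolding g_def by (rule powQ)
        also have "(real r + 1) / (4 * (real r)\<^sup>2) * real (2*r) = 1/2 + 1 / (2 * real r)"
          using rr by (simp add: field_simps power2_eq_square)
        also have "real q powr \<dots> = sq * Q1" using q1 by (simp add: powr_add sq_def Q1_def powr_half_sqrt)
        finally show ?thesis by (simp only: G_def power_mult_distrib 1)
      qed
      have Vle: "V \<le> real A * real B * c * G H * L\<^sup>2"
        using r Q1 Hpos Apos sqsq C1 Gpos L Q1B AB
        by (intro burgess_arithmetic[OF _ V Gn Q1n _ _ _ _ _ _ _ _ _ c_def]) auto
      have err: "norm (S N' k) \<le> c * G H * L\<^sup>2" if k: "1 \<le> k" "k \<le> A * B" for N' k
      proof -
        have "real k \<le> real A * real B" using k(2) by (simp only: of_nat_le_iff flip: of_nat_mult)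
        then have k9: "real k \<le> real H / 9" using A9' by linarith
        then have "k < H" using Hpos by linarith
        then have "norm (S N' k) \<le> 3 * c * G k * L\<^sup>2" using k by (intro IH)
        also have "G k \<le> G H / 3"
        proof -
          have "real k powr (1 - 1 / real r) \<le> (real H / 9) powr (1 - 1 / real r)"
            using k9 rr by (intro powr_mono2) auto
          also have "\<dots> = real H powr (1 - 1 / real r) / 9 powr (1 - 1 / real r)"
            using Hpos by (simp add: powr_divide)
          also have "\<dots> \<le> real H powr (1 - 1 / real r) / 3"
          proof (intro divide_left_mono)
            have "3 = (9::real) powr (1/2)" by (simp add: powr_half_sqrt)
            also have "\<dots> \<le> 9 powr (1 - 1 / real r)" using rr by (intro powr_mono) (auto simp: field_simps)
            finally show "3 \<le> (9::real) powr (1 - 1 / real r)" .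
          qed auto
          finally show ?thesis using gpos by (simp add: G_def mult_right_mono)
        qed
        then have "3 * c * G k * L\<^sup>2 \<le> 3 * c * (G H / 3) * L\<^sup>2"
          using c180 by (intro mult_right_mono mult_left_mono) auto
        finally show ?thesis by simp
      qed
      have split: "S N H = S (N + int (a * b)) H + (S N (a * b) - S (N + int H) (a * b))" for a b
        unfolding S_def by (rule sum_shift_interval)
      have "of_nat (A * B) * S N H = (\<Sum>a\<in>{1..A}. \<Sum>b\<in>{1..B}. S N H)" by simp
      also have "\<dots> = (\<Sum>a\<in>{1..A}. \<Sum>b\<in>{1..B}. S (N + int (a * b)) H)
          + (\<Sum>a\<in>{1..A}. \<Sum>b\<in>{1..B}. S N (a * b) - S (N + int H) (a * b))"
        unfolding sum.distrib[symmetric] by (intro sum.cong refl split)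
      also have "norm \<dots> \<le> V + (real A * real B) * (2 * (c * G H * L\<^sup>2))"
      proof (rule norm_triangle_le, rule add_mono)
        have "(\<Sum>b\<in>{1..B}. S (N + int (a * b)) H) = (\<Sum>h\<in>{1..H}. \<Sum>b\<in>{1..B}. \<chi> (N + int h + int a * int b))" for a
          unfolding S_def by (subst sum.swap) (simp add: add_ac)
        then show "norm (\<Sum>a\<in>{1..A}. \<Sum>b\<in>{1..B}. S (N + int (a * b)) H) \<le> V"
          unfolding V_def by (simp add: order_trans[OF norm_sum] sum_mono norm_sum)
        have "norm (\<Sum>a\<in>{1..A}. \<Sum>b\<in>{1..B}. S N (a * b) - S (N + int H) (a * b))
            \<le> (\<Sum>a\<in>{1..A}. \<Sum>b\<in>{1..B}. 2 * (c * G H * L\<^sup>2))"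
        proof (rule order_trans[OF norm_sum], rule sum_mono, rule order_trans[OF norm_sum], rule sum_mono)
          fix a b assume "a \<in> {1..A}" "b \<in> {1..B}"
          then have "1 \<le> a * b" "a * b \<le> A * B" by (auto intro: mult_le_mono)
          then have "norm (S N (a * b)) \<le> c * G H * L\<^sup>2" "norm (S (N + int H) (a * b)) \<le> c * G H * L\<^sup>2"
            by (auto intro: err)
          then show "norm (S N (a * b) - S (N + int H) (a * b)) \<le> 2 * (c * G H * L\<^sup>2)"
            by (intro order_trans[OF norm_triangle_ineq4]) simp
        qed
        then show "norm (\<Sum>a\<in>{1..A}. \<Sum>b\<in>{1..B}. S N (a * b) - S (N + int H) (a * b))
            \<le> (real A * real B) * (2 * (c * G H * L\<^sup>2))" by simp
      qed
      also have "\<dots> \<le> (real A * real B) * (3 * c * G H * L\<^sup>2)"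
        using Vle by (simp add: algebra_simps)
      finally have "(real A * real B) * norm (S N H) \<le> (real A * real B) * (3 * c * G H * L\<^sup>2)"
        by (simp add: norm_mult)
      moreover have "real A * real B > 0" using Apos BQ(3) by simp
      ultimately show ?thesis by (simp only: mult_le_cancel_left_pos)
    qed
  qed
  then show ?case by (simp only: S_def c_def C_def G_def g_def L_def)
qed

theorem theorem8p1:
  fixes r :: nat
  assumes "r \<ge> 1"
  shows "\<exists>C::real. \<forall>(q::nat) (\<chi>::int \<Rightarrow> complex) (N::int) (H::int).
           prime q \<longrightarrow> dirichlet_character q \<chi> \<longrightarrow> \<chi> \<noteq> principal_character q \<longrightarrow> H \<ge> 1 \<longrightarrow>
             norm (\<Sum>m\<in>{N<..N+H}. \<chi> m)
               \<le> C * real_of_int H powr (1 - 1 / real r)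
                   * real q powr ((real r + 1) / (4 * (real r)\<^sup>2)) * (ln (real q))\<^sup>2"
proof -
  \<comment> \<open>The 4 is the constant of \<open>polya_vinogradov\<close>, which settles
    \<open>r = 1\<close>: there \<open>H\<close> has exponent 0 and \<open>q\<close> has exponent
    \<open>1/2\<close>.\<close>
  define C where "C = max 4 (3 * (180 * (real (r ^ (2*r)) + real (2*r)) * 2 ^ (2*r)))"
  show ?thesis
  proof (intro exI[of _ C] allI impI)
    fix q :: nat and \<chi> :: "int \<Rightarrow> complex" and N H :: int
    assume q: "prime q" and \<chi>: "dirichlet_character q \<chi>" "\<chi> \<noteq> principal_character q" and H: "H \<ge> 1"
    define n where "n = nat H"
    have n: "H = int n" "n \<ge> 1" using H by (auto simp: n_def)
    have q3: "q \<ge> 3" by (rule nonprincipal_modulus_ge_3[OF \<chi> q])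
    have L: "ln (real q) \<ge> 1" by (rule ln_ge_1[OF q3])
    define X' where "X' = real n powr (1 - 1 / real r) * real q powr ((real r + 1) / (4 * (real r)\<^sup>2)) * (ln (real q))\<^sup>2"
    have X': "X' \<ge> 0" by (simp add: X'_def)
    have "(\<Sum>m\<in>{N<..N+H}. \<chi> m) = (\<Sum>h\<in>{1..n}. \<chi> (N + int h))"
      by (rule sum.reindex_bij_witness[of _ "\<lambda>h. N + int h" "\<lambda>m. nat (m - N)"]) (auto simp: n(1))
    also have "norm \<dots> \<le> C * X'"
    proof (cases "r = 1")
      case True
      have "norm (\<Sum>h\<in>{1..n}. \<chi> (N + int h)) \<le> 4 * sqrt (real q) * ln (real q)"
        by (rule polya_vinogradov[OF \<chi> q])
      also have "\<dots> \<le> 4 * X'"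
        using True L n q3 by (simp add: X'_def powr_half_sqrt power2_eq_square)
      also have "\<dots> \<le> C * X'" using X' by (intro mult_right_mono) (auto simp: C_def)
      finally show ?thesis .
    next
      case False
      then have "norm (\<Sum>h\<in>{1..n}. \<chi> (N + int h)) \<le> 3 * (180 * (real (r ^ (2*r)) + real (2*r)) * 2 ^ (2*r)) * X'"
        using burgess_bound[OF \<chi> q _ n(2), of r N] assms by (simp add: X'_def mult.assoc)
      also have "\<dots> \<le> C * X'" using X' by (intro mult_right_mono) (auto simp: C_def)
      finally show ?thesis .
    qed
    finally show "norm (\<Sum>m\<in>{N<..N+H}. \<chi> m)
               \<le> C * real_of_int H powr (1 - 1 / real r)
                   * real q powr ((real r + 1) / (4 * (real r)\<^sup>2)) * (ln (real q))\<^sup>2"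
      by (simp add: X'_def n(1) mult.assoc)
  qed
qed

end
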